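(* For any concrete site $\mathsf{D}$, the category $\mathsf{D}\mathrm{Space}$ of $\mathsf{D}$ spaces is a quasitopos with all (small) limits and colimits.
   Context: A family in a category is a collection of morphisms with common codomain. A coverage on a category $\mathsf{D}$ assigns to each object $D$ a collection of families $(f_i\colon D_i\to D\mid i\in I)$, called covering families, such that: given a covering family $(f_i\colon D_i\to D\mid i\in I)$ and a morphism $g\colon C\to D$, there is a covering family $(h_j\colon C_j\to C\mid j\in J)$ such that each $gh_j$ factors through some $f_i$. A site is a category equipped with a coverage. For a presheaf $X\colon\mathsf{D}^{\mathrm{op}}\to\mathrm{Set}$, elements of $X(D)$ are called plots in $X$ with domain $D$. Given a covering family $(f_i\colon D_i\to D\mid i\in I)$, a collection of plots $\{\varphi_i\in X(D_i)\mid i\in I\}$ is compatible if whenever $g\colon C\to D_i$ and $h\colon C\to D_j$ satisfy $f_ig=f_jh$, then $X(g)(\varphi_i)=X(h)(\varphi_j)$. $X$ is a sheaf if for every covering family $(f_i\colon D_i\to D\mid i\in I)$ and every compatible collection of plots $\{\varphi_i\in X(D_i)\mid i\in I\}$ there is a unique $\varphi\in X(D)$ with $X(f_i)(\varphi)=\varphi_i$ for all $i$. A site is subcanonical if every representable presheaf on it is a sheaf. A concrete site is a subcanonical site $\mathsf{D}$ with a terminal object $1$ such that the functor $\hom(1,-)\colon\mathsf{D}\to\mathrm{Set}$ is faithful, and for each covering family $(f_i\colon D_i\to D\mid i\in I)$ the functions $\hom(1,f_i)\colon\hom(1,D_i)\to\hom(1,D)$ are jointly surjective (the union of their images is $\hom(1,D)$).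 For a presheaf $X$ on a concrete site and $\varphi\in X(D)$, define $\underline{\varphi}\colon\hom(1,D)\to X(1)$ by $\underline{\varphi}(d)=X(d)(\varphi)$. A sheaf $X$ is concrete if for every object $D$ the function $\varphi\mapsto\underline{\varphi}$ on $X(D)$ is one-to-one. A $\mathsf{D}$ space is a concrete sheaf on $\mathsf{D}$; $\mathsf{D}\mathrm{Space}$ is the category of $\mathsf{D}$ spaces with natural transformations as morphisms. A quasitopos is a locally cartesian closed category with finite colimits and a weak subobject classifier. A category $\mathcal{C}$ is cartesian closed if it has finite products and each functor $-\times Y\colon\mathcal{C}\to\mathcal{C}$ has a right adjoint; it is locally cartesian closed if for every object $B$ the slice category $\mathcal{C}_B$ of objects over $B$ is cartesian closed. A monomorphism $i\colon A\to X$ is strong if for every epimorphism $p\colon E\to B$ and morphisms $f\colon E\to A$, $g\colon B\to X$ with $if=gp$ there is a unique $t\colon B\to A$ with $tp=f$ and $it=g$. In a category $\mathcal{C}$ with finite limits, a weak subobject classifier is an object $\Omega$ with a morphism $\top\colon 1\to\Omega$ such that for every strong monomorphism $i\colon C'\to C$ there is a unique morphism $\chi_i\colon C\to\Omega$ such that the square with sides $i\colon C'\to C$, $\chi_i\colon C\to\Omega$, $!\colon C'\to 1$, $\top\colon 1\to\Omega$ is a pullback. *)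

theory Defs
  imports "HOL-Library.Equipollence" "HOL-Library.FuncSet"
begin

text \<open>
  Sizes. The category of sets is rendered relative to a universe given by a type \<open>'u\<close>: the
  small sets are those of cardinality less than \<open>'u\<close>, and Set consists of the small subsets
  of \<open>'u\<close> with the functions between them. \<open>universe\<close> says that the cardinality of \<open>'u\<close> is an
  infinite regular strong limit, so that the small sets behave like the elements of a
  Grothendieck universe. Countable \<open>'u\<close>, where small means finite, is not excluded.
\<close>

definition small :: "'u itself \<Rightarrow> 'a set \<Rightarrow> bool" where
  "small U A \<longleftrightarrow> A \<prec> (UNIV :: 'u set)"

definition universe :: "'u itself \<Rightarrow> bool" where
  "universe U \<longleftrightarrow>
     infinite (UNIV :: 'u set) \<and>
     (\<forall>A :: 'u set. small U A \<longrightarrow> small U (Pow A)) \<and>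
     (\<forall>(A :: 'u set) (F :: 'u \<Rightarrow> 'u set).
        small U A \<and> (\<forall>a\<in>A. small U (F a)) \<longrightarrow> small U (\<Union>a\<in>A. F a))"


section \<open>Categories and functors\<close>

record ('o, 'm) cat =
  Obj :: "'o set"
  Arr :: "'m set"
  Dom :: "'m \<Rightarrow> 'o"
  Cod :: "'m \<Rightarrow> 'o"
  Ide :: "'o \<Rightarrow> 'm"
  Comp :: "'m \<Rightarrow> 'm \<Rightarrow> 'm"  (infixr "\<cdot>\<index>" 70)

definition Hom :: "('o, 'm, 'z) cat_scheme \<Rightarrow> 'o \<Rightarrow> 'o \<Rightarrow> 'm set" where
  "Hom C A B = {f \<in> Arr C. Dom C f = A \<and> Cod C f = B}"

locale category =
  fixes C :: "('o, 'm, 'z) cat_scheme" (structure)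
  assumes dom_closed: "f \<in> Arr C \<Longrightarrow> Dom C f \<in> Obj C"
    and cod_closed: "f \<in> Arr C \<Longrightarrow> Cod C f \<in> Obj C"
    and ide_closed: "A \<in> Obj C \<Longrightarrow> Ide C A \<in> Hom C A A"
    and comp_closed: "\<lbrakk>f \<in> Hom C A B; g \<in> Hom C B E\<rbrakk> \<Longrightarrow> g \<cdot> f \<in> Hom C A E"
    and comp_ide_right: "f \<in> Hom C A B \<Longrightarrow> f \<cdot> Ide C A = f"
    and comp_ide_left: "f \<in> Hom C A B \<Longrightarrow> Ide C B \<cdot> f = f"
    and comp_assoc: "\<lbrakk>f \<in> Hom C A B; g \<in> Hom C B E; h \<in> Hom C E F\<rbrakk>
      \<Longrightarrow> (h \<cdot> g) \<cdot> f = h \<cdot> (g \<cdot> f)"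

definition locally_small :: "'u itself \<Rightarrow> ('o, 'm, 'z) cat_scheme \<Rightarrow> bool" where
  "locally_small U C \<longleftrightarrow> (\<forall>A\<in>Obj C. \<forall>B\<in>Obj C. small U (Hom C A B))"

record ('o, 'm, 'p, 'n) fctr =
  OMap :: "'o \<Rightarrow> 'p"
  AMap :: "'m \<Rightarrow> 'n"

definition is_functor ::
  "('o, 'm, 'y) cat_scheme \<Rightarrow> ('p, 'n, 'z) cat_scheme \<Rightarrow> ('o, 'm, 'p, 'n) fctr \<Rightarrow> bool" where
  "is_functor C D F \<longleftrightarrow>
     category C \<and> category D \<and>
     (\<forall>A\<in>Obj C. OMap F A \<in> Obj D) \<and>
     (\<forall>A\<in>Obj C. \<forall>B\<in>Obj C. \<forall>f\<in>Hom C A B. AMap F f \<in> Hom D (OMap F A) (OMap F B)) \<and>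
     (\<forall>A\<in>Obj C. AMap F (Ide C A) = Ide D (OMap F A)) \<and>
     (\<forall>A\<in>Obj C. \<forall>B\<in>Obj C. \<forall>E\<in>Obj C. \<forall>f\<in>Hom C A B. \<forall>g\<in>Hom C B E.
        AMap F (g \<cdot>\<^bsub>C\<^esub> f) = AMap F g \<cdot>\<^bsub>D\<^esub> AMap F f)"

definition is_adjunction ::
  "('o, 'm, 'y) cat_scheme \<Rightarrow> ('p, 'n, 'z) cat_scheme \<Rightarrow>
   ('o, 'm, 'p, 'n) fctr \<Rightarrow> ('p, 'n, 'o, 'm) fctr \<Rightarrow> ('o \<Rightarrow> 'p \<Rightarrow> 'n \<Rightarrow> 'm) \<Rightarrow> bool" where
  "is_adjunction C D F G \<Phi> \<longleftrightarrow>
     is_functor C D F \<and> is_functor D C G \<and>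
     (\<forall>X\<in>Obj C. \<forall>Y\<in>Obj D. bij_betw (\<Phi> X Y) (Hom D (OMap F X) Y) (Hom C X (OMap G Y))) \<and>
     (\<forall>X\<in>Obj C. \<forall>X'\<in>Obj C. \<forall>Y\<in>Obj D. \<forall>Y'\<in>Obj D.
        \<forall>f\<in>Hom C X' X. \<forall>g\<in>Hom D Y Y'. \<forall>k\<in>Hom D (OMap F X) Y.
          \<Phi> X' Y' (g \<cdot>\<^bsub>D\<^esub> k \<cdot>\<^bsub>D\<^esub> AMap F f) = AMap G g \<cdot>\<^bsub>C\<^esub> \<Phi> X Y k \<cdot>\<^bsub>C\<^esub> f)"

definition has_right_adjoint ::
  "('o, 'm, 'y) cat_scheme \<Rightarrow> ('p, 'n, 'z) cat_scheme \<Rightarrow> ('o, 'm, 'p, 'n) fctr \<Rightarrow> bool" where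
  "has_right_adjoint C D F \<longleftrightarrow> (\<exists>G \<Phi>. is_adjunction C D F G \<Phi>)"


section \<open>Limits and colimits\<close>

definition is_terminal :: "('o, 'm, 'z) cat_scheme \<Rightarrow> 'o \<Rightarrow> bool" where
  "is_terminal C T \<longleftrightarrow> T \<in> Obj C \<and> (\<forall>A\<in>Obj C. \<exists>!f. f \<in> Hom C A T)"

definition is_product ::
  "('o, 'm, 'z) cat_scheme \<Rightarrow> 'i set \<Rightarrow> ('i \<Rightarrow> 'o) \<Rightarrow> 'o \<Rightarrow> ('i \<Rightarrow> 'm) \<Rightarrow> bool" where
  "is_product C I A P p \<longleftrightarrow>
     P \<in> Obj C \<and> (\<forall>i\<in>I. p i \<in> Hom C P (A i)) \<and>
     (\<forall>Q\<in>Obj C. \<forall>q. (\<forall>i\<in>I. q i \<in> Hom C Q (A i)) \<longrightarrow>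
        (\<exists>!h. h \<in> Hom C Q P \<and> (\<forall>i\<in>I. p i \<cdot>\<^bsub>C\<^esub> h = q i)))"

definition is_binary_product ::
  "('o, 'm, 'z) cat_scheme \<Rightarrow> 'o \<Rightarrow> 'o \<Rightarrow> 'o \<Rightarrow> 'm \<Rightarrow> 'm \<Rightarrow> bool" where
  "is_binary_product C X Y P p q \<longleftrightarrow>
     P \<in> Obj C \<and> p \<in> Hom C P X \<and> q \<in> Hom C P Y \<and>
     (\<forall>Q\<in>Obj C. \<forall>f\<in>Hom C Q X. \<forall>g\<in>Hom C Q Y.
        \<exists>!h. h \<in> Hom C Q P \<and> p \<cdot>\<^bsub>C\<^esub> h = f \<and> q \<cdot>\<^bsub>C\<^esub> h = g)"

definition has_finite_products :: "('o, 'm, 'z) cat_scheme \<Rightarrow> bool" where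
  "has_finite_products C \<longleftrightarrow>
     (\<forall>(I :: nat set) A. finite I \<and> (\<forall>i\<in>I. A i \<in> Obj C) \<longrightarrow> (\<exists>P p. is_product C I A P p))"

definition is_pullback ::
  "('o, 'm, 'z) cat_scheme \<Rightarrow> 'm \<Rightarrow> 'm \<Rightarrow> 'm \<Rightarrow> 'm \<Rightarrow> bool" where
  \<comment> \<open>the square \<open>f \<cdot> p = g \<cdot> q\<close> is a pullback of \<open>f\<close> and \<open>g\<close>\<close>
  "is_pullback C f g p q \<longleftrightarrow>
     f \<in> Arr C \<and> g \<in> Arr C \<and> p \<in> Arr C \<and> q \<in> Arr C \<and>
     Cod C f = Cod C g \<and> Dom C p = Dom C q \<and> Cod C p = Dom C f \<and> Cod C q = Dom C g \<and>
     f \<cdot>\<^bsub>C\<^esub> p = g \<cdot>\<^bsub>C\<^esub> q \<and>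
     (\<forall>Q\<in>Obj C. \<forall>a\<in>Hom C Q (Dom C f). \<forall>b\<in>Hom C Q (Dom C g).
        f \<cdot>\<^bsub>C\<^esub> a = g \<cdot>\<^bsub>C\<^esub> b \<longrightarrow>
        (\<exists>!h. h \<in> Hom C Q (Dom C p) \<and> p \<cdot>\<^bsub>C\<^esub> h = a \<and> q \<cdot>\<^bsub>C\<^esub> h = b))"

definition is_cone ::
  "('j, 'k, 'y) cat_scheme \<Rightarrow> ('o, 'm, 'z) cat_scheme \<Rightarrow> ('j, 'k, 'o, 'm) fctr \<Rightarrow>
   'o \<Rightarrow> ('j \<Rightarrow> 'm) \<Rightarrow> bool" where
  "is_cone J C F L \<pi> \<longleftrightarrow>
     L \<in> Obj C \<and> (\<forall>j\<in>Obj J. \<pi> j \<in> Hom C L (OMap F j)) \<and>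
     (\<forall>u\<in>Arr J. AMap F u \<cdot>\<^bsub>C\<^esub> \<pi> (Dom J u) = \<pi> (Cod J u))"

definition is_limit ::
  "('j, 'k, 'y) cat_scheme \<Rightarrow> ('o, 'm, 'z) cat_scheme \<Rightarrow> ('j, 'k, 'o, 'm) fctr \<Rightarrow>
   'o \<Rightarrow> ('j \<Rightarrow> 'm) \<Rightarrow> bool" where
  "is_limit J C F L \<pi> \<longleftrightarrow>
     is_cone J C F L \<pi> \<and>
     (\<forall>M \<mu>. is_cone J C F M \<mu> \<longrightarrow>
        (\<exists>!h. h \<in> Hom C M L \<and> (\<forall>j\<in>Obj J. \<pi> j \<cdot>\<^bsub>C\<^esub> h = \<mu> j)))"

definition is_cocone ::
  "('j, 'k, 'y) cat_scheme \<Rightarrow> ('o, 'm, 'z) cat_scheme \<Rightarrow> ('j, 'k, 'o, 'm) fctr \<Rightarrow>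
   'o \<Rightarrow> ('j \<Rightarrow> 'm) \<Rightarrow> bool" where
  "is_cocone J C F L \<iota> \<longleftrightarrow>
     L \<in> Obj C \<and> (\<forall>j\<in>Obj J. \<iota> j \<in> Hom C (OMap F j) L) \<and>
     (\<forall>u\<in>Arr J. \<iota> (Cod J u) \<cdot>\<^bsub>C\<^esub> AMap F u = \<iota> (Dom J u))"

definition is_colimit ::
  "('j, 'k, 'y) cat_scheme \<Rightarrow> ('o, 'm, 'z) cat_scheme \<Rightarrow> ('j, 'k, 'o, 'm) fctr \<Rightarrow>
   'o \<Rightarrow> ('j \<Rightarrow> 'm) \<Rightarrow> bool" where
  "is_colimit J C F L \<iota> \<longleftrightarrow>
     is_cocone J C F L \<iota> \<and>
     (\<forall>M \<mu>. is_cocone J C F M \<mu> \<longrightarrow>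
        (\<exists>!h. h \<in> Hom C L M \<and> (\<forall>j\<in>Obj J. h \<cdot>\<^bsub>C\<^esub> \<iota> j = \<mu> j)))"

definition has_limits_of_shape ::
  "('j, 'k, 'y) cat_scheme \<Rightarrow> ('o, 'm, 'z) cat_scheme \<Rightarrow> bool" where
  "has_limits_of_shape J C \<longleftrightarrow> (\<forall>F. is_functor J C F \<longrightarrow> (\<exists>L \<pi>. is_limit J C F L \<pi>))"

definition has_colimits_of_shape ::
  "('j, 'k, 'y) cat_scheme \<Rightarrow> ('o, 'm, 'z) cat_scheme \<Rightarrow> bool" where
  "has_colimits_of_shape J C \<longleftrightarrow> (\<forall>F. is_functor J C F \<longrightarrow> (\<exists>L \<iota>. is_colimit J C F L \<iota>))"

definition has_finite_limits :: "('o, 'm, 'z) cat_scheme \<Rightarrow> bool" where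
  "has_finite_limits C \<longleftrightarrow>
     (\<forall>J :: (nat, nat) cat. category J \<and> finite (Obj J) \<and> finite (Arr J)
        \<longrightarrow> has_limits_of_shape J C)"

definition has_finite_colimits :: "('o, 'm, 'z) cat_scheme \<Rightarrow> bool" where
  "has_finite_colimits C \<longleftrightarrow>
     (\<forall>J :: (nat, nat) cat. category J \<and> finite (Obj J) \<and> finite (Arr J)
        \<longrightarrow> has_colimits_of_shape J C)"

definition has_small_limits :: "'u itself \<Rightarrow> ('o, 'm, 'z) cat_scheme \<Rightarrow> bool" where
  "has_small_limits U C \<longleftrightarrow>
     (\<forall>J :: ('u, 'u) cat. category J \<and> small U (Obj J) \<and> small U (Arr J)
        \<longrightarrow> has_limits_of_shape J C)"

definition has_small_colimits :: "'u itself \<Rightarrow> ('o, 'm, 'z) cat_scheme \<Rightarrow> bool" where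
  "has_small_colimits U C \<longleftrightarrow>
     (\<forall>J :: ('u, 'u) cat. category J \<and> small U (Obj J) \<and> small U (Arr J)
        \<longrightarrow> has_colimits_of_shape J C)"


section \<open>Quasitoposes\<close>

definition is_product_functor ::
  "('o, 'm, 'z) cat_scheme \<Rightarrow> 'o \<Rightarrow> ('o, 'm, 'o, 'm) fctr \<Rightarrow> bool" where
  \<comment> \<open>\<open>F\<close> is the functor \<open>- \<times> Y\<close> for some choice of the products \<open>X \<times> Y\<close>\<close>
  "is_product_functor C Y F \<longleftrightarrow>
     is_functor C C F \<and>
     (\<exists>p q. (\<forall>X\<in>Obj C. is_binary_product C X Y (OMap F X) (p X) (q X)) \<and>
            (\<forall>X\<in>Obj C. \<forall>X'\<in>Obj C. \<forall>f\<in>Hom C X X'.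
               p X' \<cdot>\<^bsub>C\<^esub> AMap F f = f \<cdot>\<^bsub>C\<^esub> p X \<and> q X' \<cdot>\<^bsub>C\<^esub> AMap F f = q X))"

definition cartesian_closed :: "('o, 'm, 'z) cat_scheme \<Rightarrow> bool" where
  "cartesian_closed C \<longleftrightarrow>
     category C \<and> has_finite_products C \<and>
     (\<forall>Y\<in>Obj C. \<forall>F. is_product_functor C Y F \<longrightarrow> has_right_adjoint C C F)"

definition slice :: "('o, 'm, 'z) cat_scheme \<Rightarrow> 'o \<Rightarrow> ('m, 'm \<times> 'm \<times> 'm) cat" where
  \<comment> \<open>an arrow from \<open>f\<close> to \<open>g\<close> is a triple \<open>(f, g, h)\<close> with \<open>g \<cdot> h = f\<close>\<close>
  "slice C B =
     \<lparr>Obj = {f \<in> Arr C. Cod C f = B},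
      Arr = {(f, g, h). f \<in> Arr C \<and> Cod C f = B \<and> g \<in> Arr C \<and> Cod C g = B \<and>
                        h \<in> Hom C (Dom C f) (Dom C g) \<and> g \<cdot>\<^bsub>C\<^esub> h = f},
      Dom = (\<lambda>(f, g, h). f),
      Cod = (\<lambda>(f, g, h). g),
      Ide = (\<lambda>f. (f, f, Ide C (Dom C f))),
      Comp = (\<lambda>(g', k, h') (f, g, h). (f, k, h' \<cdot>\<^bsub>C\<^esub> h))\<rparr>"

definition locally_cartesian_closed :: "('o, 'm, 'z) cat_scheme \<Rightarrow> bool" where
  "locally_cartesian_closed C \<longleftrightarrow> category C \<and> (\<forall>B\<in>Obj C. cartesian_closed (slice C B))"

definition is_mono :: "('o, 'm, 'z) cat_scheme \<Rightarrow> 'm \<Rightarrow> bool" where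
  "is_mono C i \<longleftrightarrow>
     i \<in> Arr C \<and>
     (\<forall>A\<in>Obj C. \<forall>f\<in>Hom C A (Dom C i). \<forall>g\<in>Hom C A (Dom C i).
        i \<cdot>\<^bsub>C\<^esub> f = i \<cdot>\<^bsub>C\<^esub> g \<longrightarrow> f = g)"

definition is_epi :: "('o, 'm, 'z) cat_scheme \<Rightarrow> 'm \<Rightarrow> bool" where
  "is_epi C p \<longleftrightarrow>
     p \<in> Arr C \<and>
     (\<forall>A\<in>Obj C. \<forall>f\<in>Hom C (Cod C p) A. \<forall>g\<in>Hom C (Cod C p) A.
        f \<cdot>\<^bsub>C\<^esub> p = g \<cdot>\<^bsub>C\<^esub> p \<longrightarrow> f = g)"

definition is_strong_mono :: "('o, 'm, 'z) cat_scheme \<Rightarrow> 'm \<Rightarrow> bool" where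
  "is_strong_mono C i \<longleftrightarrow>
     is_mono C i \<and>
     (\<forall>p f g. is_epi C p \<and> f \<in> Hom C (Dom C p) (Dom C i) \<and> g \<in> Hom C (Cod C p) (Cod C i) \<and>
        i \<cdot>\<^bsub>C\<^esub> f = g \<cdot>\<^bsub>C\<^esub> p \<longrightarrow>
        (\<exists>!t. t \<in> Hom C (Cod C p) (Dom C i) \<and> t \<cdot>\<^bsub>C\<^esub> p = f \<and> i \<cdot>\<^bsub>C\<^esub> t = g))"

definition is_weak_subobject_classifier ::
  "('o, 'm, 'z) cat_scheme \<Rightarrow> 'o \<Rightarrow> 'o \<Rightarrow> 'm \<Rightarrow> bool" where
  "is_weak_subobject_classifier C T \<Omega> tr \<longleftrightarrow>
     is_terminal C T \<and> \<Omega> \<in> Obj C \<and> tr \<in> Hom C T \<Omega> \<and>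
     (\<forall>i. is_strong_mono C i \<longrightarrow>
        (\<exists>!\<chi>. \<chi> \<in> Hom C (Cod C i) \<Omega> \<and>
              is_pullback C \<chi> tr i (THE b. b \<in> Hom C (Dom C i) T)))"

definition has_weak_subobject_classifier :: "('o, 'm, 'z) cat_scheme \<Rightarrow> bool" where
  "has_weak_subobject_classifier C \<longleftrightarrow>
     has_finite_limits C \<and> (\<exists>T \<Omega> tr. is_weak_subobject_classifier C T \<Omega> tr)"

definition quasitopos :: "('o, 'm, 'z) cat_scheme \<Rightarrow> bool" where
  "quasitopos C \<longleftrightarrow>
     locally_cartesian_closed C \<and> has_finite_colimits C \<and> has_weak_subobject_classifier C"


section \<open>Sites, presheaves and sheaves\<close>

text \<open>A family \<open>(f\<^sub>i | i \<in> I)\<close> is the pair \<open>(I, f)\<close>; \<open>Cov D A\<close> is the collection of covering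
  families of the object \<open>A\<close>.\<close>

record ('o, 'm, 'i) site = "('o, 'm) cat" +
  Cov :: "'o \<Rightarrow> ('i set \<times> ('i \<Rightarrow> 'm)) set"

definition is_site :: "('o, 'm, 'i, 'z) site_scheme \<Rightarrow> bool" where
  "is_site D \<longleftrightarrow>
     category D \<and>
     (\<forall>A\<in>Obj D. \<forall>(I, f)\<in>Cov D A. \<forall>i\<in>I. f i \<in> Arr D \<and> Cod D (f i) = A) \<and>
     (\<forall>A\<in>Obj D. \<forall>B\<in>Obj D. \<forall>(I, f)\<in>Cov D A. \<forall>g\<in>Hom D B A.
        \<exists>(J, h)\<in>Cov D B. \<forall>j\<in>J. \<exists>i\<in>I. \<exists>k\<in>Hom D (Dom D (h j)) (Dom D (f i)).
          g \<cdot>\<^bsub>D\<^esub> h j = f i \<cdot>\<^bsub>D\<^esub> k)"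

text \<open>Presheaves and natural transformations are extensional functions, so that equality of
  records is equality of functors and of transformations. The values are arbitrary sets here;
  smallness is imposed in \<open>DSpace\<close>.\<close>

record ('o, 'm, 'v) presheaf =
  Val :: "'o \<Rightarrow> 'v set"
  Res :: "'m \<Rightarrow> 'v \<Rightarrow> 'v"

definition is_presheaf :: "('o, 'm, 'z) cat_scheme \<Rightarrow> ('o, 'm, 'v) presheaf \<Rightarrow> bool" where
  "is_presheaf D X \<longleftrightarrow>
     Val X \<in> extensional (Obj D) \<and>
     Res X \<in> extensional (Arr D) \<and>
     (\<forall>f\<in>Arr D. Res X f \<in> Val X (Cod D f) \<rightarrow>\<^sub>E Val X (Dom D f)) \<and>
     (\<forall>A\<in>Obj D. \<forall>x\<in>Val X A. Res X (Ide D A) x = x) \<and>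
     (\<forall>A\<in>Obj D. \<forall>B\<in>Obj D. \<forall>E\<in>Obj D. \<forall>f\<in>Hom D A B. \<forall>g\<in>Hom D B E. \<forall>x\<in>Val X E.
        Res X (g \<cdot>\<^bsub>D\<^esub> f) x = Res X f (Res X g x))"

definition compatible ::
  "('o, 'm, 'z) cat_scheme \<Rightarrow> ('o, 'm, 'v) presheaf \<Rightarrow> 'i set \<Rightarrow> ('i \<Rightarrow> 'm) \<Rightarrow> ('i \<Rightarrow> 'v) \<Rightarrow> bool"
  where
  "compatible D X I f \<phi> \<longleftrightarrow>
     (\<forall>i\<in>I. \<phi> i \<in> Val X (Dom D (f i))) \<and>
     (\<forall>i\<in>I. \<forall>j\<in>I. \<forall>B\<in>Obj D. \<forall>g\<in>Hom D B (Dom D (f i)). \<forall>h\<in>Hom D B (Dom D (f j)).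
        f i \<cdot>\<^bsub>D\<^esub> g = f j \<cdot>\<^bsub>D\<^esub> h \<longrightarrow> Res X g (\<phi> i) = Res X h (\<phi> j))"

definition is_sheaf :: "('o, 'm, 'i, 'z) site_scheme \<Rightarrow> ('o, 'm, 'v) presheaf \<Rightarrow> bool" where
  "is_sheaf D X \<longleftrightarrow>
     is_presheaf D X \<and>
     (\<forall>A\<in>Obj D. \<forall>(I, f)\<in>Cov D A. \<forall>\<phi>. compatible D X I f \<phi> \<longrightarrow>
        (\<exists>!x. x \<in> Val X A \<and> (\<forall>i\<in>I. Res X (f i) x = \<phi> i)))"

definition representable :: "('o, 'm, 'z) cat_scheme \<Rightarrow> 'o \<Rightarrow> ('o, 'm, 'm) presheaf" where
  "representable D A =
     \<lparr>Val = (\<lambda>B\<in>Obj D. Hom D B A),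
      Res = (\<lambda>g\<in>Arr D. \<lambda>f\<in>Hom D (Cod D g) A. f \<cdot>\<^bsub>D\<^esub> g)\<rparr>"

definition subcanonical :: "('o, 'm, 'i, 'z) site_scheme \<Rightarrow> bool" where
  "subcanonical D \<longleftrightarrow> (\<forall>A\<in>Obj D. is_sheaf D (representable D A))"


section \<open>Concrete sites and D spaces\<close>

text \<open>A concrete site carries a chosen terminal object \<open>One\<close>.\<close>

record ('o, 'm, 'i) concrete_site = "('o, 'm, 'i) site" +
  One :: 'o

definition is_concrete_site :: "('o, 'm, 'i, 'z) concrete_site_scheme \<Rightarrow> bool" where
  "is_concrete_site D \<longleftrightarrow>
     is_site D \<and> subcanonical D \<and> is_terminal D (One D) \<and>
     (\<forall>A\<in>Obj D. \<forall>B\<in>Obj D. \<forall>f\<in>Hom D A B. \<forall>g\<in>Hom D A B.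
        (\<forall>a\<in>Hom D (One D) A. f \<cdot>\<^bsub>D\<^esub> a = g \<cdot>\<^bsub>D\<^esub> a) \<longrightarrow> f = g) \<and>
     (\<forall>A\<in>Obj D. \<forall>(I, f)\<in>Cov D A.
        (\<Union>i\<in>I. (\<lambda>d. f i \<cdot>\<^bsub>D\<^esub> d) ` Hom D (One D) (Dom D (f i))) = Hom D (One D) A)"

definition underlying ::
  "('o, 'm, 'i, 'z) concrete_site_scheme \<Rightarrow> ('o, 'm, 'v) presheaf \<Rightarrow> 'o \<Rightarrow> 'v \<Rightarrow> 'm \<Rightarrow> 'v" where
  "underlying D X A \<phi> = (\<lambda>d\<in>Hom D (One D) A. Res X d \<phi>)"

definition is_concrete_sheaf ::
  "('o, 'm, 'i, 'z) concrete_site_scheme \<Rightarrow> ('o, 'm, 'v) presheaf \<Rightarrow> bool" where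
  "is_concrete_sheaf D X \<longleftrightarrow>
     is_sheaf D X \<and> (\<forall>A\<in>Obj D. inj_on (underlying D X A) (Val X A))"

definition is_D_space ::
  "'u itself \<Rightarrow> ('o, 'm, 'i, 'z) concrete_site_scheme \<Rightarrow> ('o, 'm, 'u) presheaf \<Rightarrow> bool" where
  "is_D_space U D X \<longleftrightarrow> is_concrete_sheaf D X \<and> (\<forall>A\<in>Obj D. small U (Val X A))"

definition is_nat_trans ::
  "('o, 'm, 'z) cat_scheme \<Rightarrow> ('o, 'm, 'v) presheaf \<Rightarrow> ('o, 'm, 'v) presheaf \<Rightarrow>
   ('o \<Rightarrow> 'v \<Rightarrow> 'v) \<Rightarrow> bool" where
  "is_nat_trans D X Y \<alpha> \<longleftrightarrow>
     \<alpha> \<in> (\<Pi>\<^sub>E A\<in>Obj D. Val X A \<rightarrow>\<^sub>E Val Y A) \<and>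
     (\<forall>A\<in>Obj D. \<forall>B\<in>Obj D. \<forall>f\<in>Hom D A B. \<forall>x\<in>Val X B. \<alpha> A (Res X f x) = Res Y f (\<alpha> B x))"

type_synonym ('o, 'm, 'v) presheaf_arr =
  "('o, 'm, 'v) presheaf \<times> ('o, 'm, 'v) presheaf \<times> ('o \<Rightarrow> 'v \<Rightarrow> 'v)"

definition DSpace ::
  "'u itself \<Rightarrow> ('o, 'm, 'i, 'z) concrete_site_scheme \<Rightarrow>
   (('o, 'm, 'u) presheaf, ('o, 'm, 'u) presheaf_arr) cat" where
  "DSpace U D =
     \<lparr>Obj = {X. is_D_space U D X},
      Arr = {(X, Y, \<alpha>). is_D_space U D X \<and> is_D_space U D Y \<and> is_nat_trans D X Y \<alpha>},
      Dom = (\<lambda>(X, Y, \<alpha>). X),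
      Cod = (\<lambda>(X, Y, \<alpha>). Y),
      Ide = (\<lambda>X. (X, X, \<lambda>A\<in>Obj D. \<lambda>x\<in>Val X A. x)),
      Comp = (\<lambda>(Y', Z, \<beta>) (X, Y, \<alpha>). (X, Z, \<lambda>A\<in>Obj D. \<lambda>x\<in>Val X A. \<beta> A (\<alpha> A x)))\<rparr>"

end

theory Submission
  imports Defs
begin

text \<open>
  A concrete sheaf is determined by its set of points together with the functions from
  \<open>hom(1, A)\<close> to that set which are plots; conversely every small set with a family of such
  functions containing the constants and closed under precomposition and under gluing along covers
  comes from a D space. Morphisms are the functions on points that preserve plots. These families
  are stable under intersection and under pulling back along maps, so D spaces have initial and
  final structures, which give limits and colimits from those of sets. Over a base, the points of
  an exponential are the smooth maps between fibres, and a plot of it is a function whose evaluation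
  on plots of the source is a plot of the target; the refinement property of the coverage makes
  this local. A strong monomorphism is an injection whose source carries the subspace structure, and
  hence is classified by the two-point set on which every function is a plot.
\<close>


section \<open>Small sets\<close>

text \<open>The values of a presheaf must lie in \<open>'u\<close>, while the natural points of a
  limit, colimit or exponential are families, classes or pairs with partial functions. Constructions
  therefore start from a set \<open>S\<close> of arbitrary type, and \<open>ex_space\<close> alone
  encodes points and plots into \<open>'u\<close>; afterwards only the mutually inverse maps
  \<sigma> and \<tau> remain visible. This is where size matters: a plot on \<open>A\<close> is a
  function on \<open>Pt A\<close>, so local smallness of the site together with closure of small
  sets under dependent products bounds the set of plots. A second obstacle is that
  \<open>cartesian_closed\<close> quantifies over every product functor, whatever products it
  chooses. An arbitrary product in a slice is therefore first compared with a concrete fibre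
  product, so that its points and plots are known, and the right adjoint is assembled from universal
  arrows. The work is done over a base from the start: a point of an exponential has to remember its
  base point, because the fibres on which its map lives vary with it.\<close>

lemma small_lepoll: "small U B \<Longrightarrow> A \<lesssim> B \<Longrightarrow> small U A"
  unfolding small_def by (rule lesspoll_trans1)

lemma small_inj_on: "small U B \<Longrightarrow> inj_on f A \<Longrightarrow> f ` A \<subseteq> B \<Longrightarrow> small U A"
  using small_lepoll unfolding lepoll_def by blast

lemma small_subset: "small U B \<Longrightarrow> A \<subseteq> B \<Longrightarrow> small U A"
  using small_lepoll subset_imp_lepoll by blast

lemma small_image: "small U A \<Longrightarrow> small U (f ` A)"
  using small_lepoll image_lepoll by blast

lemma small_encode:
  fixes U :: "'u itself"
  assumes "small U A"
  obtains e :: "'a \<Rightarrow> 'u" where "inj_on e A"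
  using assms unfolding small_def lesspoll_def lepoll_def by blast

lemma small_finite: "universe U \<Longrightarrow> finite A \<Longrightarrow> small U A"
  unfolding universe_def small_def using finite_lesspoll_infinite by blast

text \<open>The power set clause of \<open>universe\<close> concerns subsets of \<open>'u\<close>
  only, so the set is first replaced by an injective copy in \<open>'u\<close>.\<close>

lemma small_Pow:
  fixes U :: "'u itself"
  assumes U: "universe U" and A: "small U A"
  shows "small U (Pow A)"
proof -
  obtain e :: "'a \<Rightarrow> 'u" where e: "inj_on e A" using small_encode[OF A] .
  have "small U (Pow (e ` A))"
    using U small_image[OF A] unfolding universe_def by blast
  moreover have "inj_on ((`) e) (Pow A)" "(`) e ` Pow A \<subseteq> Pow (e ` A)"
    using e by (auto simp: inj_on_image_Pow)
  ultimately show ?thesis by (rule small_inj_on)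
qed

text \<open>\<open>universe\<close> bounds unions of subsets of \<open>'u\<close> indexed by a
  subset of \<open>'u\<close>. The dependent sum is mapped injectively into such a union: the index
  is encoded by \<open>e\<close>, each fibre by its own \<open>f a\<close>, and the pair of codes by
  an injection \<open>p\<close> into \<open>'u\<close>.\<close>

lemma small_Sigma:
  fixes U :: "'u itself" and A :: "'a set" and F :: "'a \<Rightarrow> 'b set"
  assumes U: "universe U" and A: "small U A" and F: "\<And>a. a \<in> A \<Longrightarrow> small U (F a)"
  shows "small U (Sigma A F)"
proof -
  \<comment> \<open>An infinite type has the cardinality of its square.\<close>
  have "\<exists>p :: 'u \<times> 'u \<Rightarrow> 'u. inj p"
    using card_of_Times_same_infinite[of "UNIV :: 'u set"] U
    unfolding universe_def card_of_ordIso[symmetric] bij_betw_def by auto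
  then obtain p :: "'u \<times> 'u \<Rightarrow> 'u" where p: "inj p" by blast
  obtain e :: "'a \<Rightarrow> 'u" where e: "inj_on e A" using small_encode[OF A] .
  have "\<forall>a\<in>A. \<exists>f :: 'b \<Rightarrow> 'u. inj_on f (F a)"
    using F small_encode[where U = U] by metis
  then obtain f :: "'a \<Rightarrow> 'b \<Rightarrow> 'u" where f: "\<And>a. a \<in> A \<Longrightarrow> inj_on (f a) (F a)" by metis
  \<comment> \<open>\<open>G u\<close> is the encoded fibre over the index with code
    \<open>u\<close>, which is recovered by inverting \<open>e\<close>.\<close>
  define G where "G = (\<lambda>u. (\<lambda>b. p (u, f (inv_into A e u) b)) ` F (inv_into A e u))"
  have "\<forall>u\<in>e ` A. small U (G u)"
    unfolding G_def using F by (intro ballI small_image) (simp add: inv_into_into)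
  then have "small U (\<Union>u\<in>e ` A. G u)"
    using U small_image[OF A, of e] unfolding universe_def by blast
  moreover have "inj_on (\<lambda>(a, b). p (e a, f a b)) (Sigma A F)"
  proof (rule inj_onI, clarify)
    fix a b a' b' assume a: "a \<in> A" "b \<in> F a" "a' \<in> A" "b' \<in> F a'"
      and "p (e a, f a b) = p (e a', f a' b')"
    then have "e a = e a'" "f a b = f a' b'" using injD[OF p] by blast+
    then have "a = a'" using inj_onD[OF e] a by blast
    then show "a = a' \<and> b = b'" using inj_onD[OF f] a \<open>f a b = f a' b'\<close> by blast
  qed
  moreover have "(\<lambda>(a, b). p (e a, f a b)) ` Sigma A F \<subseteq> (\<Union>u\<in>e ` A. G u)"
    using e by (force simp: G_def)
  ultimately show ?thesis by (rule small_inj_on)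
qed

text \<open>A dependent function is determined by its graph, a subset of the dependent sum.
  Extensionality of \<open>PiE\<close> makes the passage to graphs injective.\<close>

lemma small_PiE:
  assumes U: "universe U" and A: "small U A" and F: "\<And>a. a \<in> A \<Longrightarrow> small U (F a)"
  shows "small U (PiE A F)"
proof -
  have S: "small U (Pow (Sigma A F))"
    by (intro small_Pow small_Sigma U A F)
  have "inj_on (\<lambda>f. (\<lambda>a. (a, f a)) ` A) (PiE A F)"
  proof (rule inj_onI)
    fix f g assume f: "f \<in> PiE A F" and g: "g \<in> PiE A F"
      and eq: "(\<lambda>a. (a, f a)) ` A = (\<lambda>a. (a, g a)) ` A"
    have "f a = g a" if "a \<in> A" for a
    proof -
      have "(a, f a) \<in> (\<lambda>a. (a, g a)) ` A" using that unfolding eq[symmetric] by blast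
      then show ?thesis by blast
    qed
    then show "f = g" using f g PiE_ext by metis
  qed
  moreover have "(\<lambda>f. (\<lambda>a. (a, f a)) ` A) ` PiE A F \<subseteq> Pow (Sigma A F)" by auto
  ultimately show ?thesis by (rule small_inj_on[OF S])
qed


section \<open>Adjoints and slices\<close>

lemma HomD:
  assumes "f \<in> Hom C A B"
  shows "f \<in> Arr C" "Dom C f = A" "Cod C f = B"
  using assms by (auto simp: Hom_def)

lemma (in category) Hom_Obj:
  assumes "f \<in> Hom C A B"
  shows "A \<in> Obj C" "B \<in> Obj C"
  using assms dom_closed cod_closed by (auto simp: Hom_def)

text \<open>A universal arrow \<epsilon> from \<open>F\<close> to each object already determines the
  right adjoint: its action on arrows and the bijection of hom sets are the unique factorisations
  through \<epsilon>, and every law follows from uniqueness.\<close>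

lemma has_right_adjointI:
  assumes F: "is_functor C D F"
    and ex: "\<And>Z. Z \<in> Obj D \<Longrightarrow> \<exists>E \<epsilon>. E \<in> Obj C \<and> \<epsilon> \<in> Hom D (OMap F E) Z \<and>
      (\<forall>X\<in>Obj C. \<forall>k\<in>Hom D (OMap F X) Z. \<exists>!m. m \<in> Hom C X E \<and> \<epsilon> \<cdot>\<^bsub>D\<^esub> AMap F m = k)"
  shows "has_right_adjoint C D F"
proof -
  interpret C: category C using F by (simp add: is_functor_def)
  interpret D: category D using F by (simp add: is_functor_def)
  have FO: "\<And>A. A \<in> Obj C \<Longrightarrow> OMap F A \<in> Obj D"
    and FA: "\<And>A B f. f \<in> Hom C A B \<Longrightarrow> AMap F f \<in> Hom D (OMap F A) (OMap F B)"
    and FI: "\<And>A. A \<in> Obj C \<Longrightarrow> AMap F (Ide C A) = Ide D (OMap F A)"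
    and FC: "\<And>A B E f g. f \<in> Hom C A B \<Longrightarrow> g \<in> Hom C B E \<Longrightarrow>
        AMap F (g \<cdot>\<^bsub>C\<^esub> f) = AMap F g \<cdot>\<^bsub>D\<^esub> AMap F f"
    using F unfolding is_functor_def using C.Hom_Obj by blast+
  \<comment> \<open>The object and its universal arrow are bundled in one predicate so that both can
    be chosen as functions of \<open>Z\<close>.\<close>
  define P where "P Z E \<epsilon> \<longleftrightarrow> E \<in> Obj C \<and> \<epsilon> \<in> Hom D (OMap F E) Z \<and>
      (\<forall>X\<in>Obj C. \<forall>k\<in>Hom D (OMap F X) Z. \<exists>!m. m \<in> Hom C X E \<and> \<epsilon> \<cdot>\<^bsub>D\<^esub> AMap F m = k)"
    for Z E \<epsilon>
  have "\<forall>Z\<in>Obj D. \<exists>E \<epsilon>. P Z E \<epsilon>" using ex by (simp add: P_def)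
  then obtain E \<epsilon> where P: "\<And>Z. Z \<in> Obj D \<Longrightarrow> P Z (E Z) (\<epsilon> Z)" by metis
  have E: "\<And>Z. Z \<in> Obj D \<Longrightarrow> E Z \<in> Obj C"
    and \<epsilon>: "\<And>Z. Z \<in> Obj D \<Longrightarrow> \<epsilon> Z \<in> Hom D (OMap F (E Z)) Z"
    and un: "\<And>X Z k. X \<in> Obj C \<Longrightarrow> Z \<in> Obj D \<Longrightarrow> k \<in> Hom D (OMap F X) Z \<Longrightarrow>
      \<exists>!m. m \<in> Hom C X (E Z) \<and> \<epsilon> Z \<cdot>\<^bsub>D\<^esub> AMap F m = k"
    using P unfolding P_def by blast+
  define \<Phi> where "\<Phi> X Z k = (THE m. m \<in> Hom C X (E Z) \<and> \<epsilon> Z \<cdot>\<^bsub>D\<^esub> AMap F m = k)" for X Z k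
  have \<Phi>: "\<Phi> X Z k \<in> Hom C X (E Z)" "\<epsilon> Z \<cdot>\<^bsub>D\<^esub> AMap F (\<Phi> X Z k) = k"
    if "X \<in> Obj C" "Z \<in> Obj D" "k \<in> Hom D (OMap F X) Z" for X Z k
    using theI'[OF un[OF that]] unfolding \<Phi>_def by blast+
  \<comment> \<open>Uniqueness as a cancellation rule: arrows into \<open>E Z\<close> are compared
    after applying \<open>F\<close> and composing with \<epsilon>. Functoriality and naturality
    below are proved by this test.\<close>
  have eqI: "m = m'"
    if "m \<in> Hom C X (E Z)" "m' \<in> Hom C X (E Z)" "Z \<in> Obj D"
      and "\<epsilon> Z \<cdot>\<^bsub>D\<^esub> AMap F m = \<epsilon> Z \<cdot>\<^bsub>D\<^esub> AMap F m'" for X Z m m'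
  proof -
    have "\<epsilon> Z \<cdot>\<^bsub>D\<^esub> AMap F m \<in> Hom D (OMap F X) Z"
      using that FA \<epsilon> D.comp_closed by blast
    then show ?thesis using un[of X Z] that C.Hom_Obj by metis
  qed
  define G where "G = \<lparr>OMap = E,
    AMap = (\<lambda>g. \<Phi> (E (Dom D g)) (Cod D g) (g \<cdot>\<^bsub>D\<^esub> \<epsilon> (Dom D g)))\<rparr>"
  have G: "AMap G g \<in> Hom C (E A) (E B)" "\<epsilon> B \<cdot>\<^bsub>D\<^esub> AMap F (AMap G g) = g \<cdot>\<^bsub>D\<^esub> \<epsilon> A"
    if g: "g \<in> Hom D A B" for g A B
  proof -
    have "A \<in> Obj D" "B \<in> Obj D" using g D.Hom_Obj by blast+
    moreover have "g \<cdot>\<^bsub>D\<^esub> \<epsilon> A \<in> Hom D (OMap F (E A)) B"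
      using g \<epsilon> D.comp_closed \<open>A \<in> Obj D\<close> by blast
    ultimately show "AMap G g \<in> Hom C (E A) (E B)" "\<epsilon> B \<cdot>\<^bsub>D\<^esub> AMap F (AMap G g) = g \<cdot>\<^bsub>D\<^esub> \<epsilon> A"
      unfolding G_def using \<Phi> E HomD[OF g] by auto
  qed
  have \<epsilon>F: "\<epsilon> Z \<cdot>\<^bsub>D\<^esub> AMap F (m \<cdot>\<^bsub>C\<^esub> n) = (\<epsilon> Z \<cdot>\<^bsub>D\<^esub> AMap F m) \<cdot>\<^bsub>D\<^esub> AMap F n"
    if "Z \<in> Obj D" "n \<in> Hom C X Y" "m \<in> Hom C Y (E Z)" for Z m n X Y
    using that FC[OF that(2,3)] D.comp_assoc[OF FA[OF that(2)] FA[OF that(3)] \<epsilon>] by simp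
  have GF: "is_functor D C G"
    unfolding is_functor_def
  proof (intro conjI ballI)
    fix A assume A: "A \<in> Obj D"
    show "OMap G A \<in> Obj C" using E A by (simp add: G_def)
    have 1: "Ide D A \<in> Hom D A A" "Ide C (E A) \<in> Hom C (E A) (E A)"
      using A E D.ide_closed C.ide_closed by blast+
    have "AMap G (Ide D A) = Ide C (E A)"
      using eqI[OF G(1)[OF 1(1)] 1(2) A] G(2)[OF 1(1)] FI[OF E[OF A]]
        D.comp_ide_left[OF \<epsilon>[OF A]] D.comp_ide_right[OF \<epsilon>[OF A]] by simp
    then show "AMap G (Ide D A) = Ide C (OMap G A)" by (simp add: G_def)
  next
    fix A B f assume "f \<in> Hom D A B"
    then show "AMap G f \<in> Hom C (OMap G A) (OMap G B)" using G(1) by (simp add: G_def)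
  next
    fix A B K f g assume A: "A \<in> Obj D" and K: "K \<in> Obj D"
      and f: "f \<in> Hom D A B" and g: "g \<in> Hom D B K"
    have B: "B \<in> Obj D" using f D.Hom_Obj by blast
    have gf: "g \<cdot>\<^bsub>D\<^esub> f \<in> Hom D A K" using f g D.comp_closed by blast
    \<comment> \<open>Composed with \<epsilon>, both sides of the composition law become
      \<open>g\<close> after \<open>f\<close> after the universal arrow at \<open>A\<close>.\<close>
    have "\<epsilon> K \<cdot>\<^bsub>D\<^esub> AMap F (AMap G g \<cdot>\<^bsub>C\<^esub> AMap G f) = (g \<cdot>\<^bsub>D\<^esub> \<epsilon> B) \<cdot>\<^bsub>D\<^esub> AMap F (AMap G f)"
      using \<epsilon>F[OF K G(1)[OF f] G(1)[OF g]] G(2)[OF g] by simp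
    also have "\<dots> = g \<cdot>\<^bsub>D\<^esub> (f \<cdot>\<^bsub>D\<^esub> \<epsilon> A)"
      using D.comp_assoc[OF FA[OF G(1)[OF f]] \<epsilon>[OF B] g] G(2)[OF f] by simp
    also have "\<dots> = \<epsilon> K \<cdot>\<^bsub>D\<^esub> AMap F (AMap G (g \<cdot>\<^bsub>D\<^esub> f))"
      using D.comp_assoc[OF \<epsilon>[OF A] f g] G(2)[OF gf] by simp
    finally show "AMap G (g \<cdot>\<^bsub>D\<^esub> f) = AMap G g \<cdot>\<^bsub>C\<^esub> AMap G f"
      using eqI[OF G(1)[OF gf] C.comp_closed[OF G(1)[OF f] G(1)[OF g]] K] by simp
  qed (use C.category_axioms D.category_axioms in auto)
  have bij: "bij_betw (\<Phi> X Z) (Hom D (OMap F X) Z) (Hom C X (E Z))"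
    if "X \<in> Obj C" "Z \<in> Obj D" for X Z
  proof (rule bij_betwI[where g = "\<lambda>m. \<epsilon> Z \<cdot>\<^bsub>D\<^esub> AMap F m"])
    show "\<Phi> X Z \<in> Hom D (OMap F X) Z \<rightarrow> Hom C X (E Z)" using \<Phi> that by blast
    show *: "(\<lambda>m. \<epsilon> Z \<cdot>\<^bsub>D\<^esub> AMap F m) \<in> Hom C X (E Z) \<rightarrow> Hom D (OMap F X) Z"
      using FA \<epsilon> D.comp_closed that by blast
    show "\<epsilon> Z \<cdot>\<^bsub>D\<^esub> AMap F (\<Phi> X Z k) = k" if "k \<in> Hom D (OMap F X) Z" for k
      using \<Phi> that \<open>X \<in> Obj C\<close> \<open>Z \<in> Obj D\<close> by blast
    show "\<Phi> X Z (\<epsilon> Z \<cdot>\<^bsub>D\<^esub> AMap F m) = m" if "m \<in> Hom C X (E Z)" for m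
      using eqI[OF \<Phi>(1) that] \<Phi>(2) * that \<open>X \<in> Obj C\<close> \<open>Z \<in> Obj D\<close> by blast
  qed
  have "is_adjunction C D F G \<Phi>"
    unfolding is_adjunction_def
  proof (intro conjI ballI)
    show "bij_betw (\<Phi> X Z) (Hom D (OMap F X) Z) (Hom C X (OMap G Z))"
      if "X \<in> Obj C" "Z \<in> Obj D" for X Z using bij[OF that] by (simp add: G_def)
    fix X X' Y Y' f g k
    assume X: "X \<in> Obj C" "X' \<in> Obj C" and Y: "Y \<in> Obj D" "Y' \<in> Obj D"
      and f: "f \<in> Hom C X' X" and g: "g \<in> Hom D Y Y'" and k: "k \<in> Hom D (OMap F X) Y"
    have k': "\<Phi> X Y k \<in> Hom C X (E Y)" using \<Phi>(1) X Y k by blast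
    have kf: "k \<cdot>\<^bsub>D\<^esub> AMap F f \<in> Hom D (OMap F X') Y"
      using FA[OF f] k by (rule D.comp_closed)
    have gkf: "g \<cdot>\<^bsub>D\<^esub> k \<cdot>\<^bsub>D\<^esub> AMap F f \<in> Hom D (OMap F X') Y'"
      using kf g by (rule D.comp_closed)
    have kf': "\<Phi> X Y k \<cdot>\<^bsub>C\<^esub> f \<in> Hom C X' (E Y)" using f k' by (rule C.comp_closed)
    have "\<epsilon> Y' \<cdot>\<^bsub>D\<^esub> AMap F (AMap G g \<cdot>\<^bsub>C\<^esub> \<Phi> X Y k \<cdot>\<^bsub>C\<^esub> f)
        = (g \<cdot>\<^bsub>D\<^esub> \<epsilon> Y) \<cdot>\<^bsub>D\<^esub> AMap F (\<Phi> X Y k \<cdot>\<^bsub>C\<^esub> f)"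
      using \<epsilon>F[OF Y(2) kf' G(1)[OF g]] G(2)[OF g] by simp
    also have "\<dots> = g \<cdot>\<^bsub>D\<^esub> (\<epsilon> Y \<cdot>\<^bsub>D\<^esub> AMap F (\<Phi> X Y k \<cdot>\<^bsub>C\<^esub> f))"
      by (rule D.comp_assoc[OF FA[OF kf'] \<epsilon>[OF Y(1)] g])
    also have "\<dots> = g \<cdot>\<^bsub>D\<^esub> k \<cdot>\<^bsub>D\<^esub> AMap F f"
      using \<epsilon>F[OF Y(1) f k'] \<Phi>(2)[OF X(1) Y(1) k] by simp
    finally show "\<Phi> X' Y' (g \<cdot>\<^bsub>D\<^esub> k \<cdot>\<^bsub>D\<^esub> AMap F f) = AMap G g \<cdot>\<^bsub>C\<^esub> \<Phi> X Y k \<cdot>\<^bsub>C\<^esub> f"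
      using eqI[OF \<Phi>(1)[OF X(2) Y(2) gkf] C.comp_closed[OF kf' G(1)[OF g]] Y(2)]
        \<Phi>(2)[OF X(2) Y(2) gkf] by simp
  qed (use F GF in auto)
  then show ?thesis unfolding has_right_adjoint_def by blast
qed

lemma functor_Hom:
  assumes "is_functor J C F" "u \<in> Arr J"
  shows "AMap F u \<in> Hom C (OMap F (Dom J u)) (OMap F (Cod J u))"
    and "OMap F (Dom J u) \<in> Obj C" and "OMap F (Cod J u) \<in> Obj C"
    and "Dom J u \<in> Obj J" and "Cod J u \<in> Obj J"
proof -
  interpret J: category J using assms(1) by (simp add: is_functor_def)
  show 1: "Dom J u \<in> Obj J" "Cod J u \<in> Obj J" using J.dom_closed J.cod_closed assms(2) by blast+
  have "u \<in> Hom J (Dom J u) (Cod J u)" using assms(2) by (simp add: Hom_def)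
  then show "AMap F u \<in> Hom C (OMap F (Dom J u)) (OMap F (Cod J u))"
    "OMap F (Dom J u) \<in> Obj C" "OMap F (Cod J u) \<in> Obj C"
    using assms(1) 1 unfolding is_functor_def by blast+
qed

section \<open>Slice categories\<close>

lemma slice_Obj: "f \<in> Obj (slice C B) \<longleftrightarrow> f \<in> Hom C (Dom C f) B"
  by (simp add: slice_def Hom_def)

lemma slice_Hom:
  "t \<in> Hom (slice C B) f g \<longleftrightarrow> f \<in> Hom C (Dom C f) B \<and> g \<in> Hom C (Dom C g) B \<and>
     (\<exists>h. t = (f, g, h) \<and> h \<in> Hom C (Dom C f) (Dom C g) \<and> g \<cdot>\<^bsub>C\<^esub> h = f)"
  by (auto simp: slice_def Hom_def)

lemma slice_Comp: "(g', k, h') \<cdot>\<^bsub>slice C B\<^esub> (f, g, h) = (f, k, h' \<cdot>\<^bsub>C\<^esub> h)"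
  by (simp add: slice_def)

text \<open>Slice arrows carry their endpoints. Once these are fixed, unique existence of a slice
  arrow is unique existence of the underlying arrow.\<close>

lemma ex1_triple: "(\<exists>!t. \<exists>h. t = (a, b, h) \<and> R h) \<longleftrightarrow> (\<exists>!h. R h)"
  by auto

lemma slice_Ide: "Ide (slice C B) f = (f, f, Ide C (Dom C f))"
  by (simp add: slice_def)

lemma (in category) category_slice: "category (slice C B)"
proof
  fix t f g s k
  assume t: "t \<in> Hom (slice C B) f g" and s: "s \<in> Hom (slice C B) g k"
  then obtain h h' where h: "t = (f, g, h)" "h \<in> Hom C (Dom C f) (Dom C g)" "g \<cdot> h = f"
      "s = (g, k, h')" "h' \<in> Hom C (Dom C g) (Dom C k)" "k \<cdot> h' = g"
      "k \<in> Hom C (Dom C k) B" "f \<in> Hom C (Dom C f) B"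
    by (auto simp: slice_Hom)
  have "k \<cdot> (h' \<cdot> h) = f" using comp_assoc[OF h(2,5,7)] h by simp
  then show "s \<cdot>\<^bsub>slice C B\<^esub> t \<in> Hom (slice C B) f k"
    using h comp_closed by (auto simp: slice_Hom slice_Comp)
next
  fix f assume "f \<in> Obj (slice C B)"
  then show "Ide (slice C B) f \<in> Hom (slice C B) f f"
    using Hom_Obj ide_closed comp_ide_right by (auto simp: slice_Obj slice_Hom slice_Ide)
next
  fix t f g s k r l
  assume "t \<in> Hom (slice C B) f g" "s \<in> Hom (slice C B) g k" "r \<in> Hom (slice C B) k l"
  then obtain h h' h'' where "t = (f, g, h)" "s = (g, k, h')" "r = (k, l, h'')"
    and "h \<in> Hom C (Dom C f) (Dom C g)" "h' \<in> Hom C (Dom C g) (Dom C k)"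
      "h'' \<in> Hom C (Dom C k) (Dom C l)"
    unfolding slice_Hom by blast
  then show "(r \<cdot>\<^bsub>slice C B\<^esub> s) \<cdot>\<^bsub>slice C B\<^esub> t = r \<cdot>\<^bsub>slice C B\<^esub> (s \<cdot>\<^bsub>slice C B\<^esub> t)"
    by (simp add: slice_Comp comp_assoc)
next
  fix f assume "f \<in> Arr (slice C B)"
  then show "Dom (slice C B) f \<in> Obj (slice C B)" "Cod (slice C B) f \<in> Obj (slice C B)"
    by (auto simp: slice_def)
next
  fix t f g assume "t \<in> Hom (slice C B) f g"
  then show "t \<cdot>\<^bsub>slice C B\<^esub> Ide (slice C B) f = t" "Ide (slice C B) g \<cdot>\<^bsub>slice C B\<^esub> t = t"
    using comp_ide_left comp_ide_right by (auto simp: slice_Hom slice_Comp slice_Ide)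
qed


section \<open>D spaces as sets with plots\<close>

locale d_spaces =
  fixes U :: "'u itself" and D :: "('o, 'm, 'i, 'z) concrete_site_scheme" (structure)
  assumes universe: "universe U"
    and concrete: "is_concrete_site D"
    and loc_small: "locally_small U D"
begin

abbreviation Sp :: "(('o, 'm, 'u) presheaf, ('o, 'm, 'u) presheaf_arr) cat" where
  "Sp \<equiv> DSpace U D"

abbreviation Pt :: "'o \<Rightarrow> 'm set" where
  "Pt A \<equiv> Hom D (One D) A"

sublocale D: category D
  using concrete by (simp add: is_concrete_site_def is_site_def)

section \<open>Points and covers of the site\<close>

lemma One_terminal: "is_terminal D (One D)"
  using concrete by (simp add: is_concrete_site_def)

lemma One_Obj: "One D \<in> Obj D"
  using One_terminal by (simp add: is_terminal_def)

lemma Ide_One: "Ide D (One D) \<in> Pt (One D)"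
  using One_Obj by (rule D.ide_closed)

lemma Pt_One: "d \<in> Pt (One D) \<Longrightarrow> d = Ide D (One D)"
  using One_terminal One_Obj Ide_One unfolding is_terminal_def by blast

lemma ex_to_One: "A \<in> Obj D \<Longrightarrow> \<exists>t. t \<in> Hom D A (One D)"
  using One_terminal unfolding is_terminal_def by blast

lemma small_Pt: "A \<in> Obj D \<Longrightarrow> small U (Pt A)"
  using loc_small One_Obj by (simp add: locally_small_def)

lemma cov_Hom:
  assumes "A \<in> Obj D" "(I, f) \<in> Cov D A" "i \<in> I"
  shows "f i \<in> Hom D (Dom D (f i)) A" "Dom D (f i) \<in> Obj D"
proof -
  have "\<forall>A\<in>Obj D. \<forall>(I, f)\<in>Cov D A. \<forall>i\<in>I. f i \<in> Arr D \<and> Cod D (f i) = A"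
    using concrete unfolding is_concrete_site_def is_site_def by (elim conjE)
  from bspec[OF bspec[OF this assms(1)] assms(2)] assms(3)
  have "f i \<in> Arr D \<and> Cod D (f i) = A" by simp
  then show "f i \<in> Hom D (Dom D (f i)) A" "Dom D (f i) \<in> Obj D"
    using D.dom_closed by (auto simp: Hom_def)
qed

lemma cov_refine:
  assumes "A \<in> Obj D" "(I, f) \<in> Cov D A" "g \<in> Hom D B A"
  obtains J h where "(J, h) \<in> Cov D B"
    and "\<And>j. j \<in> J \<Longrightarrow> \<exists>i\<in>I. \<exists>k\<in>Hom D (Dom D (h j)) (Dom D (f i)). g \<cdot> h j = f i \<cdot> k"
proof -
  have "B \<in> Obj D" using assms(3) D.Hom_Obj by blast
  have "\<forall>A\<in>Obj D. \<forall>B\<in>Obj D. \<forall>(I, f)\<in>Cov D A. \<forall>g\<in>Hom D B A.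
      \<exists>(J, h)\<in>Cov D B. \<forall>j\<in>J. \<exists>i\<in>I. \<exists>k\<in>Hom D (Dom D (h j)) (Dom D (f i)). g \<cdot> h j = f i \<cdot> k"
    using concrete unfolding is_concrete_site_def is_site_def by (elim conjE)
  from bspec[OF bspec[OF bspec[OF this assms(1)] \<open>B \<in> Obj D\<close>] assms(2)] assms(3)
  have "\<exists>(J, h)\<in>Cov D B. \<forall>j\<in>J. \<exists>i\<in>I. \<exists>k\<in>Hom D (Dom D (h j)) (Dom D (f i)). g \<cdot> h j = f i \<cdot> k"
    by simp
  then show ?thesis using that by blast
qed

lemma cov_surj:
  assumes "A \<in> Obj D" "(I, f) \<in> Cov D A" "d \<in> Pt A"
  obtains i e where "i \<in> I" "e \<in> Pt (Dom D (f i))" "d = f i \<cdot> e"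
proof -
  have "\<forall>A\<in>Obj D. \<forall>(I, f)\<in>Cov D A. (\<Union>i\<in>I. (\<lambda>d. f i \<cdot> d) ` Pt (Dom D (f i))) = Pt A"
    using concrete unfolding is_concrete_site_def by (elim conjE)
  from bspec[OF bspec[OF this assms(1)] assms(2)]
  have "(\<Union>i\<in>I. (\<lambda>d. f i \<cdot> d) ` Pt (Dom D (f i))) = Pt A" by simp
  then show ?thesis using that assms(3) by blast
qed

section \<open>Points, plots and smooth maps\<close>

definition pts :: "('o, 'm, 'u) presheaf \<Rightarrow> 'u set" where
  "pts X = Val X (One D)"

text \<open>Plots are kept as total functions on the arrow type, of which only the restriction to
  \<open>Pt A\<close> counts. This avoids carrying restrictions through composites, at the price of
  congruence arguments.\<close>

definition plot :: "('o, 'm, 'u) presheaf \<Rightarrow> 'o \<Rightarrow> ('m \<Rightarrow> 'u) \<Rightarrow> bool" where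
  "plot X A \<phi> \<longleftrightarrow> (\<exists>x\<in>Val X A. \<forall>d\<in>Pt A. \<phi> d = Res X d x)"

definition fn :: "('o, 'm, 'u) presheaf_arr \<Rightarrow> 'u \<Rightarrow> 'u" where
  "fn = (\<lambda>(X, Y, \<alpha>). \<alpha> (One D))"

text \<open>The carrier has an arbitrary type, so the structure can be put on tuples, classes or
  sections before anything is encoded into \<open>'u\<close>. The second clause expresses that a
  total function matters only on \<open>Pt A\<close>; the last one is gluing along a cover.\<close>

definition plot_structure :: "'a set \<Rightarrow> ('o \<Rightarrow> ('m \<Rightarrow> 'a) \<Rightarrow> bool) \<Rightarrow> bool" where
  "plot_structure S P \<longleftrightarrow>
     (\<forall>A\<in>Obj D. \<forall>\<phi>. P A \<phi> \<longrightarrow> \<phi> \<in> Pt A \<rightarrow> S) \<and>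
     (\<forall>A\<in>Obj D. \<forall>\<phi> \<psi>. P A \<phi> \<longrightarrow> (\<forall>d\<in>Pt A. \<phi> d = \<psi> d) \<longrightarrow> P A \<psi>) \<and>
     (\<forall>A\<in>Obj D. \<forall>s\<in>S. P A (\<lambda>_. s)) \<and>
     (\<forall>A B g \<phi>. g \<in> Hom D B A \<longrightarrow> P A \<phi> \<longrightarrow> P B (\<lambda>d. \<phi> (g \<cdot> d))) \<and>
     (\<forall>A\<in>Obj D. \<forall>I f \<phi>. (I, f) \<in> Cov D A \<longrightarrow> \<phi> \<in> Pt A \<rightarrow> S \<longrightarrow>
        (\<forall>i\<in>I. P (Dom D (f i)) (\<lambda>d. \<phi> (f i \<cdot> d))) \<longrightarrow> P A \<phi>)"

lemma plot_structureI:
  assumes "\<And>A \<phi>. A \<in> Obj D \<Longrightarrow> P A \<phi> \<Longrightarrow> \<phi> \<in> Pt A \<rightarrow> S"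
    and "\<And>A \<phi> \<psi>. A \<in> Obj D \<Longrightarrow> P A \<phi> \<Longrightarrow> (\<And>d. d \<in> Pt A \<Longrightarrow> \<phi> d = \<psi> d) \<Longrightarrow> P A \<psi>"
    and "\<And>A s. A \<in> Obj D \<Longrightarrow> s \<in> S \<Longrightarrow> P A (\<lambda>_. s)"
    and "\<And>A B g \<phi>. A \<in> Obj D \<Longrightarrow> B \<in> Obj D \<Longrightarrow> g \<in> Hom D B A \<Longrightarrow> P A \<phi> \<Longrightarrow> P B (\<lambda>d. \<phi> (g \<cdot> d))"
    and "\<And>A I f \<phi>. A \<in> Obj D \<Longrightarrow> (I, f) \<in> Cov D A \<Longrightarrow> \<phi> \<in> Pt A \<rightarrow> S \<Longrightarrow>
        (\<And>i. i \<in> I \<Longrightarrow> P (Dom D (f i)) (\<lambda>d. \<phi> (f i \<cdot> d))) \<Longrightarrow> P A \<phi>"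
  shows "plot_structure S P"
  unfolding plot_structure_def
proof (intro conjI ballI allI impI)
  show "\<phi> \<in> Pt A \<rightarrow> S" if "A \<in> Obj D" "P A \<phi>" for A \<phi> using that by (rule assms(1))
  show "P A \<psi>" if "A \<in> Obj D" "P A \<phi>" "\<forall>d\<in>Pt A. \<phi> d = \<psi> d" for A \<phi> \<psi>
    using that(1,2) by (rule assms(2)) (use that(3) in blast)
  show "P A (\<lambda>_. s)" if "A \<in> Obj D" "s \<in> S" for A s using that by (rule assms(3))
  show "P B (\<lambda>d. \<phi> (g \<cdot> d))" if "g \<in> Hom D B A" "P A \<phi>" for A B g \<phi>
    using D.Hom_Obj(2,1)[OF that(1)] that by (rule assms(4))
  show "P A \<phi>" if "A \<in> Obj D" "(I, f) \<in> Cov D A" "\<phi> \<in> Pt A \<rightarrow> S"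
      "\<forall>i\<in>I. P (Dom D (f i)) (\<lambda>d. \<phi> (f i \<cdot> d))" for A I f \<phi>
    using that(1-3) by (rule assms(5)) (use that(4) in blast)
qed

lemma plot_structureD:
  assumes "plot_structure S P"
  shows "A \<in> Obj D \<Longrightarrow> P A \<phi> \<Longrightarrow> \<phi> \<in> Pt A \<rightarrow> S"
    and "A \<in> Obj D \<Longrightarrow> P A \<phi> \<Longrightarrow> (\<And>d. d \<in> Pt A \<Longrightarrow> \<phi> d = \<psi> d) \<Longrightarrow> P A \<psi>"
    and "A \<in> Obj D \<Longrightarrow> s \<in> S \<Longrightarrow> P A (\<lambda>_. s)"
    and "g \<in> Hom D B A \<Longrightarrow> P A \<phi> \<Longrightarrow> P B (\<lambda>d. \<phi> (g \<cdot> d))"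
    and "A \<in> Obj D \<Longrightarrow> (I, f) \<in> Cov D A \<Longrightarrow> \<phi> \<in> Pt A \<rightarrow> S \<Longrightarrow>
        (\<And>i. i \<in> I \<Longrightarrow> P (Dom D (f i)) (\<lambda>d. \<phi> (f i \<cdot> d))) \<Longrightarrow> P A \<phi>"
proof -
  note P = assms[unfolded plot_structure_def]
  show "A \<in> Obj D \<Longrightarrow> P A \<phi> \<Longrightarrow> \<phi> \<in> Pt A \<rightarrow> S" using P[THEN conjunct1] by blast
  show "A \<in> Obj D \<Longrightarrow> P A \<phi> \<Longrightarrow> (\<And>d. d \<in> Pt A \<Longrightarrow> \<phi> d = \<psi> d) \<Longrightarrow> P A \<psi>"
    using P[THEN conjunct2, THEN conjunct1] by blast
  show "A \<in> Obj D \<Longrightarrow> s \<in> S \<Longrightarrow> P A (\<lambda>_. s)"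
    using P[THEN conjunct2, THEN conjunct2, THEN conjunct1] by blast
  show "g \<in> Hom D B A \<Longrightarrow> P A \<phi> \<Longrightarrow> P B (\<lambda>d. \<phi> (g \<cdot> d))"
    using P[THEN conjunct2, THEN conjunct2, THEN conjunct2, THEN conjunct1] by blast
  show "A \<in> Obj D \<Longrightarrow> (I, f) \<in> Cov D A \<Longrightarrow> \<phi> \<in> Pt A \<rightarrow> S \<Longrightarrow>
        (\<And>i. i \<in> I \<Longrightarrow> P (Dom D (f i)) (\<lambda>d. \<phi> (f i \<cdot> d))) \<Longrightarrow> P A \<phi>"
    using P[THEN conjunct2, THEN conjunct2, THEN conjunct2, THEN conjunct2] by blast
qed

definition smooth :: "('o, 'm, 'u) presheaf \<Rightarrow> ('o, 'm, 'u) presheaf \<Rightarrow> ('u \<Rightarrow> 'u) \<Rightarrow> bool" where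
  "smooth X Y u \<longleftrightarrow>
     u \<in> pts X \<rightarrow> pts Y \<and> (\<forall>A\<in>Obj D. \<forall>\<phi>. plot X A \<phi> \<longrightarrow> plot Y A (\<lambda>d. u (\<phi> d)))"

lemma Sp_Obj: "X \<in> Obj Sp \<longleftrightarrow> is_D_space U D X"
  by (simp add: DSpace_def)

lemma Sp_Hom: "f \<in> Hom Sp X Y \<longleftrightarrow>
    (\<exists>\<alpha>. f = (X, Y, \<alpha>) \<and> X \<in> Obj Sp \<and> Y \<in> Obj Sp \<and> is_nat_trans D X Y \<alpha>)"
  by (auto simp: DSpace_def Hom_def)

context
  fixes X :: "('o, 'm, 'u) presheaf"
  assumes X: "X \<in> Obj Sp"
begin

lemma is_sheaf: "is_sheaf D X"
  using X by (simp add: Sp_Obj is_D_space_def is_concrete_sheaf_def)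

lemma Res_closed:
  assumes "g \<in> Hom D B A" "x \<in> Val X A"
  shows "Res X g x \<in> Val X B"
  using is_sheaf assms unfolding is_sheaf_def is_presheaf_def by (auto simp: Hom_def)

lemma Res_Ide: "A \<in> Obj D \<Longrightarrow> x \<in> Val X A \<Longrightarrow> Res X (Ide D A) x = x"
  using is_sheaf unfolding is_sheaf_def is_presheaf_def by blast

lemma Res_comp:
  assumes "f \<in> Hom D A B" "g \<in> Hom D B E" "x \<in> Val X E"
  shows "Res X (g \<cdot> f) x = Res X f (Res X g x)"
  using is_sheaf assms D.Hom_Obj[OF assms(1)] D.Hom_Obj[OF assms(2)]
  unfolding is_sheaf_def is_presheaf_def by blast

text \<open>This is concreteness in the form in which it is used: equality of sections may be tested
  at the points of \<open>A\<close>.\<close>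

lemma Val_eqI:
  assumes "A \<in> Obj D" "x \<in> Val X A" "y \<in> Val X A" "\<And>d. d \<in> Pt A \<Longrightarrow> Res X d x = Res X d y"
  shows "x = y"
proof -
  have "inj_on (underlying D X A) (Val X A)"
    using X assms(1) by (simp add: Sp_Obj is_D_space_def is_concrete_sheaf_def)
  moreover have "underlying D X A x = underlying D X A y"
    using assms(4) by (auto simp: underlying_def)
  ultimately show ?thesis using assms inj_onD by metis
qed

lemma small_pts: "small U (pts X)"
  using X One_Obj by (simp add: Sp_Obj is_D_space_def pts_def)

text \<open>The one substantial clause is gluing. The sections representing the local plots form a
  compatible family, since compatibility may be tested at points, where both sides are values of
  \<phi>. The section obtained from the sheaf condition represents \<phi> because every point of
  \<open>A\<close> factors through a covering map.\<close>

lemma plot_structure_space: "plot_structure (pts X) (plot X)"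
proof (rule plot_structureI)
  fix A \<phi> assume "A \<in> Obj D" "plot X A \<phi>"
  then show "\<phi> \<in> Pt A \<rightarrow> pts X" using Res_closed by (auto simp: plot_def pts_def)
next
  fix A \<phi> \<psi> assume "plot X A \<phi>" "\<And>d. d \<in> Pt A \<Longrightarrow> \<phi> d = \<psi> d"
  then show "plot X A \<psi>" by (simp add: plot_def)
next
  fix A s assume A: "A \<in> Obj D" and s: "s \<in> pts X"
  \<comment> \<open>The constant plot is the restriction of \<open>s\<close> along the map from
    \<open>A\<close> to the terminal object; composed with any point of \<open>A\<close> that map is
    the identity of \<open>One D\<close>.\<close>
  obtain t where t: "t \<in> Hom D A (One D)" using ex_to_One A by blast
  have "Res X d (Res X t s) = s" if "d \<in> Pt A" for d
    using Res_comp[OF that t] s Pt_One[OF D.comp_closed[OF that t]] Res_Ide[OF One_Obj]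
    by (simp add: pts_def)
  moreover have "Res X t s \<in> Val X A" using Res_closed t s by (simp add: pts_def)
  ultimately show "plot X A (\<lambda>_. s)" unfolding plot_def by metis
next
  fix A B g \<phi> assume g: "g \<in> Hom D B A" and "plot X A \<phi>"
  then obtain x where x: "x \<in> Val X A" "\<And>d. d \<in> Pt A \<Longrightarrow> \<phi> d = Res X d x"
    by (auto simp: plot_def)
  have "\<phi> (g \<cdot> d) = Res X d (Res X g x)" if "d \<in> Pt B" for d
    using x(2) Res_comp[OF that g x(1)] D.comp_closed[OF that g] by simp
  then show "plot X B (\<lambda>d. \<phi> (g \<cdot> d))" unfolding plot_def using Res_closed[OF g x(1)] by blast
next
  fix A I f \<phi> assume A: "A \<in> Obj D" and If: "(I, f) \<in> Cov D A" and "\<phi> \<in> Pt A \<rightarrow> pts X"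
    and "\<And>i. i \<in> I \<Longrightarrow> plot X (Dom D (f i)) (\<lambda>d. \<phi> (f i \<cdot> d))"
  then obtain \<psi> where \<psi>: "\<And>i. i \<in> I \<Longrightarrow> \<psi> i \<in> Val X (Dom D (f i))"
    "\<And>i d. i \<in> I \<Longrightarrow> d \<in> Pt (Dom D (f i)) \<Longrightarrow> \<phi> (f i \<cdot> d) = Res X d (\<psi> i)"
    unfolding plot_def by metis
  note f = cov_Hom[OF A If]
  have "compatible D X I f \<psi>"
    unfolding compatible_def
  proof (intro conjI ballI impI)
    fix i j B g h
    assume ij: "i \<in> I" "j \<in> I" and B: "B \<in> Obj D" and g: "g \<in> Hom D B (Dom D (f i))"
      and h: "h \<in> Hom D B (Dom D (f j))" and eq: "f i \<cdot> g = f j \<cdot> h"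
    show "Res X g (\<psi> i) = Res X h (\<psi> j)"
    proof (rule Val_eqI[OF B])
      fix d assume d: "d \<in> Pt B"
      have "Res X d (Res X g (\<psi> i)) = \<phi> (f i \<cdot> (g \<cdot> d))"
        using Res_comp[OF d g \<psi>(1)] \<psi>(2) D.comp_closed[OF d g] ij by simp
      also have "\<dots> = \<phi> (f j \<cdot> (h \<cdot> d))"
        using D.comp_assoc[OF d g f(1)] D.comp_assoc[OF d h f(1)] eq ij by simp
      also have "\<dots> = Res X d (Res X h (\<psi> j))"
        using Res_comp[OF d h \<psi>(1)] \<psi>(2) D.comp_closed[OF d h] ij by simp
      finally show "Res X d (Res X g (\<psi> i)) = Res X d (Res X h (\<psi> j))" .
    qed (use Res_closed g h \<psi> ij in blast)+
  qed (use \<psi> in blast)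
  then obtain x where x: "x \<in> Val X A" "\<And>i. i \<in> I \<Longrightarrow> Res X (f i) x = \<psi> i"
    using is_sheaf A If unfolding is_sheaf_def by blast
  have "\<phi> d = Res X d x" if d: "d \<in> Pt A" for d
  proof -
    obtain i e where i: "i \<in> I" "e \<in> Pt (Dom D (f i))" "d = f i \<cdot> e"
      using cov_surj[OF A If d] .
    then show ?thesis using \<psi>(2) Res_comp[OF i(2) f(1) x(1)] x(2) by simp
  qed
  then show "plot X A \<phi>" using x(1) by (auto simp: plot_def)
qed

lemmas plotD = plot_structureD[OF plot_structure_space]

end

section \<open>Morphisms as maps of points\<close>

lemma nat_transD:
  assumes "is_nat_trans D X Y \<alpha>"
  shows "A \<in> Obj D \<Longrightarrow> x \<in> Val X A \<Longrightarrow> \<alpha> A x \<in> Val Y A"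
    and "f \<in> Hom D A B \<Longrightarrow> x \<in> Val X B \<Longrightarrow> \<alpha> A (Res X f x) = Res Y f (\<alpha> B x)"
  using assms D.Hom_Obj[of f A B] unfolding is_nat_trans_def by blast+

lemma nat_transI:
  assumes X: "X \<in> Obj Sp"
    and "\<And>A x. A \<in> Obj D \<Longrightarrow> x \<in> Val X A \<Longrightarrow> \<alpha> A x \<in> Val Y A"
    and "\<And>A B f x. f \<in> Hom D A B \<Longrightarrow> x \<in> Val X B \<Longrightarrow> \<alpha> A (Res X f x) = Res Y f (\<alpha> B x)"
  shows "is_nat_trans D X Y (\<lambda>A\<in>Obj D. \<lambda>x\<in>Val X A. \<alpha> A x)"
  using assms Res_closed[OF X] unfolding is_nat_trans_def by (auto simp: extensional_def)

lemma nat_trans_eqI: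
  assumes "is_nat_trans D X Y \<alpha>" "is_nat_trans D X Y \<beta>"
    and eq: "\<And>A x. A \<in> Obj D \<Longrightarrow> x \<in> Val X A \<Longrightarrow> \<alpha> A x = \<beta> A x"
  shows "\<alpha> = \<beta>"
proof -
  have E: "\<alpha> \<in> (\<Pi>\<^sub>E A\<in>Obj D. Val X A \<rightarrow>\<^sub>E Val Y A)" "\<beta> \<in> (\<Pi>\<^sub>E A\<in>Obj D. Val X A \<rightarrow>\<^sub>E Val Y A)"
    using assms(1,2) by (simp_all add: is_nat_trans_def)
  show ?thesis
  proof (rule PiE_ext[OF E])
    fix A assume A: "A \<in> Obj D"
    show "\<alpha> A = \<beta> A"
      by (rule PiE_ext[OF PiE_mem[OF E(1) A] PiE_mem[OF E(2) A]]) (rule eq[OF A])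
  qed
qed

text \<open>By naturality the restriction of \<alpha>\<open>A x\<close> to a point \<open>d\<close>
  is the component at \<open>One D\<close> applied to a point of \<open>X\<close>; concreteness of
  the target then determines \<alpha>\<open>A x\<close>. This reduces nearly all later equations
  between morphisms to equations between functions on points.\<close>

lemma Sp_arr_eqI:
  assumes f: "f \<in> Hom Sp X Y" and g: "g \<in> Hom Sp X Y"
    and eq: "\<And>x. x \<in> pts X \<Longrightarrow> fn f x = fn g x"
  shows "f = g"
proof -
  obtain \<alpha> \<beta> where a: "f = (X, Y, \<alpha>)" "is_nat_trans D X Y \<alpha>" "X \<in> Obj Sp" "Y \<in> Obj Sp"
    and b: "g = (X, Y, \<beta>)" "is_nat_trans D X Y \<beta>"
    using f g by (auto simp: Sp_Hom)
  note na = nat_transD[OF a(2)] and nb = nat_transD[OF b(2)]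
  have "\<alpha> A x = \<beta> A x" if A: "A \<in> Obj D" and x: "x \<in> Val X A" for A x
  proof (rule Val_eqI[OF a(4) A])
    fix d assume d: "d \<in> Pt A"
    have "Res X d x \<in> pts X" using Res_closed[OF a(3) d x] by (simp add: pts_def)
    then have "\<alpha> (One D) (Res X d x) = \<beta> (One D) (Res X d x)"
      using eq a(1) b(1) by (simp add: fn_def)
    then show "Res Y d (\<alpha> A x) = Res Y d (\<beta> A x)" using na(2) nb(2) d x by simp
  qed (use na nb A x in auto)
  with a(2) b(2) have "\<alpha> = \<beta>" by (rule nat_trans_eqI)
  then show ?thesis using a b by simp
qed

lemma category_Sp: "category Sp"
proof
  fix f assume "f \<in> Arr Sp"
  then show "Dom Sp f \<in> Obj Sp" "Cod Sp f \<in> Obj Sp" by (auto simp: DSpace_def)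
next
  fix X assume X: "X \<in> Obj Sp"
  have "is_nat_trans D X X (\<lambda>A\<in>Obj D. \<lambda>x\<in>Val X A. x)"
    by (rule nat_transI[OF X]) simp_all
  then show "Ide Sp X \<in> Hom Sp X X" using X by (simp add: Sp_Hom) (simp add: DSpace_def)
next
  fix f X Y g Z assume "f \<in> Hom Sp X Y" "g \<in> Hom Sp Y Z"
  then obtain \<alpha> \<beta> where a: "f = (X, Y, \<alpha>)" "is_nat_trans D X Y \<alpha>"
    and b: "g = (Y, Z, \<beta>)" "is_nat_trans D Y Z \<beta>" and O: "X \<in> Obj Sp" "Z \<in> Obj Sp"
    by (auto simp: Sp_Hom)
  note na = nat_transD[OF a(2)] and nb = nat_transD[OF b(2)]
  have "is_nat_trans D X Z (\<lambda>A\<in>Obj D. \<lambda>x\<in>Val X A. \<beta> A (\<alpha> A x))"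
    using na nb D.Hom_Obj by (intro nat_transI[OF O(1)]) simp_all
  then show "g \<cdot>\<^bsub>Sp\<^esub> f \<in> Hom Sp X Z" using O a b by (simp add: Sp_Hom) (simp add: DSpace_def)
next
  fix f X Y assume f: "f \<in> Hom Sp X Y"
  then obtain \<alpha> where a: "f = (X, Y, \<alpha>)" "is_nat_trans D X Y \<alpha>"
    by (auto simp: Sp_Hom)
  have "X \<in> Obj Sp" using f by (auto simp: Sp_Hom)
  then have "is_nat_trans D X Y (\<lambda>A\<in>Obj D. \<lambda>x\<in>Val X A. \<alpha> A x)"
    by (rule nat_transI) (use nat_transD[OF a(2)] in auto)
  \<comment> \<open>Composition restricts its result to the proper domains. The identity laws are
    equalities because the components of a natural transformation are already extensional.\<close>
  then have "(\<lambda>A\<in>Obj D. \<lambda>x\<in>Val X A. \<alpha> A x) = \<alpha>"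
    using a(2) by (rule nat_trans_eqI) simp
  moreover have "(\<lambda>A\<in>Obj D. \<lambda>x\<in>Val X A. (\<lambda>A\<in>Obj D. \<lambda>y\<in>Val Y A. y) A (\<alpha> A x))
      = (\<lambda>A\<in>Obj D. \<lambda>x\<in>Val X A. \<alpha> A x)"
    using nat_transD(1)[OF a(2)] by (auto simp: fun_eq_iff)
  moreover have "(\<lambda>A\<in>Obj D. \<lambda>x\<in>Val X A. \<alpha> A ((\<lambda>A\<in>Obj D. \<lambda>y\<in>Val X A. y) A x))
      = (\<lambda>A\<in>Obj D. \<lambda>x\<in>Val X A. \<alpha> A x)"
    by (auto simp: fun_eq_iff)
  ultimately show "f \<cdot>\<^bsub>Sp\<^esub> Ide Sp X = f" "Ide Sp Y \<cdot>\<^bsub>Sp\<^esub> f = f"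
    using a(1) by (simp_all add: DSpace_def)
next
  fix f X Y g Z h W assume "f \<in> Hom Sp X Y" "g \<in> Hom Sp Y Z" "h \<in> Hom Sp Z W"
  then obtain \<alpha> \<beta> \<gamma> where f: "f = (X, Y, \<alpha>)" "is_nat_trans D X Y \<alpha>" and g: "g = (Y, Z, \<beta>)"
    and h: "h = (Z, W, \<gamma>)"
    by (auto simp: Sp_Hom)
  show "(h \<cdot>\<^bsub>Sp\<^esub> g) \<cdot>\<^bsub>Sp\<^esub> f = h \<cdot>\<^bsub>Sp\<^esub> (g \<cdot>\<^bsub>Sp\<^esub> f)"
    using nat_transD(1)[OF f(2)] unfolding f(1) g h DSpace_def by (auto simp: fun_eq_iff)
qed

sublocale S: category "DSpace U D" by (fact category_Sp)

lemma fn_closed: "f \<in> Hom Sp X Y \<Longrightarrow> x \<in> pts X \<Longrightarrow> fn f x \<in> pts Y"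
  using nat_transD(1)[OF _ One_Obj] by (auto simp: Sp_Hom fn_def pts_def)

lemma fn_Ide: "x \<in> pts X \<Longrightarrow> fn (Ide Sp X) x = x"
  using One_Obj by (simp add: DSpace_def fn_def pts_def)

lemma fn_comp:
  assumes "f \<in> Hom Sp X Y" "g \<in> Hom Sp Y Z" "x \<in> pts X"
  shows "fn (g \<cdot>\<^bsub>Sp\<^esub> f) x = fn g (fn f x)"
  using assms One_Obj by (auto simp: Sp_Hom) (simp add: DSpace_def fn_def pts_def)

lemma fn_plot:
  assumes f: "f \<in> Hom Sp X Y" and A: "A \<in> Obj D" and \<phi>: "plot X A \<phi>"
  shows "plot Y A (\<lambda>d. fn f (\<phi> d))"
proof -
  obtain \<alpha> where a: "f = (X, Y, \<alpha>)" "is_nat_trans D X Y \<alpha>" using f by (auto simp: Sp_Hom)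
  obtain x where "x \<in> Val X A" "\<And>d. d \<in> Pt A \<Longrightarrow> \<phi> d = Res X d x"
    using \<phi> by (auto simp: plot_def)
  then have "\<alpha> A x \<in> Val Y A" "\<And>d. d \<in> Pt A \<Longrightarrow> fn f (\<phi> d) = Res Y d (\<alpha> A x)"
    using nat_transD[OF a(2)] A a(1) by (simp_all add: fn_def)
  then show ?thesis unfolding plot_def by blast
qed

text \<open>A section \<open>x\<close> over \<open>A\<close> is a plot, its image under
  \<open>u\<close> is a plot of \<open>Y\<close>, and a section representing that plot serves as the
  value of the transformation at \<open>x\<close>. Naturality is checked at points by concreteness
  of \<open>Y\<close>.\<close>

lemma ex_arr:
  assumes X: "X \<in> Obj Sp" and Y: "Y \<in> Obj Sp" and u: "smooth X Y u"
  obtains f where "f \<in> Hom Sp X Y" "\<And>x. x \<in> pts X \<Longrightarrow> fn f x = u x"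
proof -
  have "\<exists>y\<in>Val Y A. \<forall>d\<in>Pt A. Res Y d y = u (Res X d x)" if "A \<in> Obj D" "x \<in> Val X A" for A x
  proof -
    have "plot X A (\<lambda>d. Res X d x)" using that by (auto simp: plot_def)
    then have "plot Y A (\<lambda>d. u (Res X d x))" using u that(1) by (simp add: smooth_def)
    then show ?thesis by (simp add: plot_def) metis
  qed
  then obtain \<alpha> where a: "\<And>A x. A \<in> Obj D \<Longrightarrow> x \<in> Val X A \<Longrightarrow> \<alpha> A x \<in> Val Y A"
    "\<And>A x d. A \<in> Obj D \<Longrightarrow> x \<in> Val X A \<Longrightarrow> d \<in> Pt A \<Longrightarrow> Res Y d (\<alpha> A x) = u (Res X d x)"
    by metis
  have "is_nat_trans D X Y (\<lambda>A\<in>Obj D. \<lambda>x\<in>Val X A. \<alpha> A x)"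
  proof (rule nat_transI[OF X a(1)])
    fix A B f x assume f: "f \<in> Hom D A B" and x: "x \<in> Val X B"
    have A: "A \<in> Obj D" and B: "B \<in> Obj D" using f D.Hom_Obj by blast+
    show "\<alpha> A (Res X f x) = Res Y f (\<alpha> B x)"
    proof (rule Val_eqI[OF Y A])
      fix d assume d: "d \<in> Pt A"
      show "Res Y d (\<alpha> A (Res X f x)) = Res Y d (Res Y f (\<alpha> B x))"
        using a(2)[OF A Res_closed[OF X f x] d] a(2)[OF B x D.comp_closed[OF d f]]
          Res_comp[OF X d f x] Res_comp[OF Y d f a(1)[OF B x]] by simp
    qed (use a(1) A B f x Res_closed X Y in blast)+
  qed
  \<comment> \<open>Evaluation at the identity point of \<open>One D\<close>, along which
    restriction does nothing.\<close>
  moreover have "\<alpha> (One D) x = u x" if "x \<in> pts X" for x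
    using that a(2)[OF One_Obj _ Ide_One] Res_Ide[OF X One_Obj] Res_Ide[OF Y One_Obj] a(1)[OF One_Obj]
    by (simp add: pts_def)
  ultimately show ?thesis
    using that[of "(X, Y, \<lambda>A\<in>Obj D. \<lambda>x\<in>Val X A. \<alpha> A x)"] X Y One_Obj
    by (simp add: Sp_Hom fn_def pts_def)
qed

section \<open>Spaces from plot structures\<close>

text \<open>The sections over \<open>A\<close> are codes in \<open>'u\<close> of the plots on
  \<open>A\<close>, and restriction is precomposition between decoding and encoding. The sheaf
  condition is the gluing clause, and concreteness holds because a plot is determined by its values.
  \<sigma> encodes points and \<tau> decodes them.\<close>

lemma ex_space:
  fixes S :: "'a set"
  assumes S: "small U S" and P: "plot_structure S P"
  obtains X \<sigma> \<tau> where "X \<in> Obj Sp"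
    and "\<And>s. s \<in> S \<Longrightarrow> \<sigma> s \<in> pts X" and "\<And>s. s \<in> S \<Longrightarrow> \<tau> (\<sigma> s) = s"
    and "\<And>x. x \<in> pts X \<Longrightarrow> \<tau> x \<in> S" and "\<And>x. x \<in> pts X \<Longrightarrow> \<sigma> (\<tau> x) = x"
    and "\<And>A \<psi>. A \<in> Obj D \<Longrightarrow> plot X A \<psi> \<longleftrightarrow> \<psi> \<in> Pt A \<rightarrow> pts X \<and> P A (\<lambda>d. \<tau> (\<psi> d))"
proof -
  note PD = plot_structureD[OF P]
  obtain \<sigma> :: "'a \<Rightarrow> 'u" where \<sigma>: "inj_on \<sigma> S" using small_encode[OF S] .
  \<comment> \<open>Extensional representatives of the plots: they form a small set, and two of them
    are equal once they agree on \<open>Pt A\<close>.\<close>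
  define PF where "PF A = {\<phi> \<in> Pt A \<rightarrow>\<^sub>E S. P A \<phi>}" for A
  have PF_small: "small U (PF A)" if "A \<in> Obj D" for A
    by (rule small_subset[OF small_PiE[OF universe small_Pt[OF that] S]]) (auto simp: PF_def)
  have PF_eqI: "\<phi> = \<psi>" if "\<phi> \<in> PF A" "\<psi> \<in> PF A" "\<And>d. d \<in> Pt A \<Longrightarrow> \<phi> d = \<psi> d" for A \<phi> \<psi>
    by (rule PiE_ext[where k = "Pt A" and s = "\<lambda>_. S"]) (use that in \<open>auto simp: PF_def\<close>)
  have "\<forall>A\<in>Obj D. \<exists>e :: ('m \<Rightarrow> 'a) \<Rightarrow> 'u. inj_on e (PF A)"
    using small_encode[OF PF_small] by metis
  then obtain e :: "'o \<Rightarrow> ('m \<Rightarrow> 'a) \<Rightarrow> 'u" where e: "\<And>A. A \<in> Obj D \<Longrightarrow> inj_on (e A) (PF A)"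
    by metis
  \<comment> \<open>A plot on \<open>One D\<close> is a single value, since the identity is the only
    point. Its code is taken to be \<sigma> of that value, so that the points of the space are
    exactly the codes of elements of \<open>S\<close>; over other objects any injection will
    do.\<close>
  define enc where "enc A = (if A = One D then \<lambda>\<phi>. \<sigma> (\<phi> (Ide D (One D))) else e A)" for A
  have enc: "inj_on (enc A) (PF A)" if A: "A \<in> Obj D" for A
  proof (cases "A = One D")
    case True
    show ?thesis
    proof (rule inj_onI)
      fix \<phi> \<psi> assume \<phi>: "\<phi> \<in> PF A" and \<psi>: "\<psi> \<in> PF A" and "enc A \<phi> = enc A \<psi>"
      then have "\<phi> (Ide D (One D)) = \<psi> (Ide D (One D))"
        using \<sigma> Ide_One True by (auto simp: enc_def PF_def inj_on_def)
      then show "\<phi> = \<psi>" using PF_eqI[OF \<phi> \<psi>] Pt_One True by metis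
    qed
  qed (use e A in \<open>simp add: enc_def\<close>)
  define V where "V A = enc A ` PF A" for A
  define dec where "dec A = inv_into (PF A) (enc A)" for A
  have dec: "dec A v \<in> PF A" "enc A (dec A v) = v" if "v \<in> V A" for A v
    using that unfolding dec_def V_def by (simp_all add: inv_into_into f_inv_into_f)
  have dec_enc: "dec A (enc A \<phi>) = \<phi>" if "A \<in> Obj D" "\<phi> \<in> PF A" for A \<phi>
    unfolding dec_def by (rule inv_into_f_f[OF enc[OF that(1)] that(2)])
  have restr: "(\<lambda>d\<in>Pt A. \<phi> d) \<in> PF A" if "A \<in> Obj D" "P A \<phi>" for A \<phi>
    using PD(1)[OF that] PD(2)[OF that] unfolding PF_def by auto
  have pre: "(\<lambda>d\<in>Pt B. \<phi> (g \<cdot> d)) \<in> PF B" if "g \<in> Hom D B A" "\<phi> \<in> PF A" for A B g \<phi>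
    by (rule restr[OF D.Hom_Obj(1)[OF that(1)] PD(4)[OF that(1)]]) (use that(2) in \<open>simp add: PF_def\<close>)
  define X :: "('o, 'm, 'u) presheaf" where
    "X = \<lparr>Val = \<lambda>A\<in>Obj D. V A, Res = \<lambda>g\<in>Arr D. \<lambda>v\<in>V (Cod D g).
       enc (Dom D g) (\<lambda>d\<in>Pt (Dom D g). dec (Cod D g) v (g \<cdot> d))\<rparr>"
  have Val: "Val X A = V A" if "A \<in> Obj D" for A using that by (simp add: X_def)
  have Res: "Res X g v = enc B (\<lambda>d\<in>Pt B. dec A v (g \<cdot> d))" if "g \<in> Hom D B A" "v \<in> V A" for g A B v
    using that by (auto simp: X_def Hom_def)
  have Res_V: "Res X g v \<in> V B" if "g \<in> Hom D B A" "v \<in> V A" for g A B v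
    using Res[OF that] pre[OF that(1) dec(1)[OF that(2)]] by (simp add: V_def)
  have dec_Res: "dec B (Res X g v) = (\<lambda>d\<in>Pt B. dec A v (g \<cdot> d))"
    if "g \<in> Hom D B A" "v \<in> V A" for g A B v
    using Res[OF that] dec_enc[OF D.Hom_Obj(1)[OF that(1)] pre[OF that(1) dec(1)[OF that(2)]]] by simp
  \<comment> \<open>The choice of \<open>enc\<close> at \<open>One D\<close> pays off here:
    restricting a section to a point gives the code of the value of its plot at that point.\<close>
  have Res_pt: "Res X d v = \<sigma> (dec A v d)" if "d \<in> Pt A" "v \<in> V A" for A d v
    using Res[OF that] Ide_One D.comp_ide_right[OF that(1)] by (simp add: enc_def)
  have dec_S: "dec A v d \<in> S" if "d \<in> Pt A" "v \<in> V A" for A d v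
    using dec(1)[OF that(2)] that(1) by (auto simp: PF_def)
  have V_eqI: "v = w" if "A \<in> Obj D" "v \<in> V A" "w \<in> V A" "\<And>d. d \<in> Pt A \<Longrightarrow> Res X d v = Res X d w" for A v w
  proof -
    have "dec A v = dec A w"
      by (rule PF_eqI[OF dec(1)[OF that(2)] dec(1)[OF that(3)]])
        (use \<sigma> that dec_S Res_pt in \<open>metis inj_onD\<close>)
    then show ?thesis using dec(2) that by metis
  qed
  have presheaf: "is_presheaf D X"
    unfolding is_presheaf_def
  proof (intro conjI ballI)
    show "Val X \<in> extensional (Obj D)" "Res X \<in> extensional (Arr D)" by (simp_all add: X_def)
    fix f assume f: "f \<in> Arr D"
    then have "f \<in> Hom D (Dom D f) (Cod D f)" by (simp add: Hom_def)
    from Res_V[OF this] f show "Res X f \<in> Val X (Cod D f) \<rightarrow>\<^sub>E Val X (Dom D f)"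
      using Val D.dom_closed D.cod_closed by (auto simp: X_def)
  next
    fix A v assume A: "A \<in> Obj D" and "v \<in> Val X A"
    then have v: "v \<in> V A" by (simp add: Val)
    have "(\<lambda>d\<in>Pt A. dec A v (Ide D A \<cdot> d)) = dec A v"
      by (rule PF_eqI[OF pre[OF D.ide_closed[OF A] dec(1)[OF v]] dec(1)[OF v]])
        (simp add: D.comp_ide_left)
    then show "Res X (Ide D A) v = v" using Res[OF D.ide_closed[OF A] v] dec(2)[OF v] by simp
  next
    fix A B E f g v
    assume A: "A \<in> Obj D" and B: "B \<in> Obj D" and E: "E \<in> Obj D" and f: "f \<in> Hom D A B"
      and g: "g \<in> Hom D B E" and "v \<in> Val X E"
    then have v: "v \<in> V E" by (simp add: Val)
    note gf = D.comp_closed[OF f g]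
    have "(\<lambda>d\<in>Pt A. dec E v ((g \<cdot> f) \<cdot> d)) = (\<lambda>d\<in>Pt A. dec B (Res X g v) (f \<cdot> d))"
      using dec_Res[OF g v] D.comp_assoc[OF _ f g] D.comp_closed[OF _ f] by (auto simp: fun_eq_iff)
    then show "Res X (g \<cdot> f) v = Res X f (Res X g v)"
      using Res[OF gf v] Res[OF f Res_V[OF g v]] by simp
  qed
  have sheaf: "is_sheaf D X"
    unfolding is_sheaf_def
  proof (intro conjI ballI, rule presheaf, clarify)
    fix A I f \<phi> assume A: "A \<in> Obj D" and If: "(I, f) \<in> Cov D A" and c: "compatible D X I f \<phi>"
    note f = cov_Hom[OF A If]
    have \<phi>: "\<phi> i \<in> V (Dom D (f i))" if "i \<in> I" for i
      using c that Val f(2) unfolding compatible_def by blast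
    have eq: "Res X g (\<phi> i) = Res X h (\<phi> j)" if "i \<in> I" "j \<in> I" "g \<in> Hom D B (Dom D (f i))"
      "h \<in> Hom D B (Dom D (f j))" "f i \<cdot> g = f j \<cdot> h" for i j g h B
      using c that D.Hom_Obj(1)[OF that(3)] unfolding compatible_def by blast
    \<comment> \<open>The glued function is well defined: if \<open>d\<close> factors through two
      covering maps, compatibility applied to these factorisations, with \<open>One D\<close> as
      test object, shows that the two values agree.\<close>
    have "\<exists>s. \<forall>i\<in>I. \<forall>k\<in>Pt (Dom D (f i)). d = f i \<cdot> k \<longrightarrow> dec (Dom D (f i)) (\<phi> i) k = s"
      if "d \<in> Pt A" for d
    proof -
      obtain i k where i: "i \<in> I" "k \<in> Pt (Dom D (f i))" "d = f i \<cdot> k" using cov_surj[OF A If \<open>d \<in> Pt A\<close>] .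
      have "dec (Dom D (f j)) (\<phi> j) k' = dec (Dom D (f i)) (\<phi> i) k"
        if "j \<in> I" "k' \<in> Pt (Dom D (f j))" "d = f j \<cdot> k'" for j k'
        using eq[OF that(1) i(1) that(2) i(2)] that i Res_pt[OF that(2) \<phi>[OF that(1)]]
          Res_pt[OF i(2) \<phi>[OF i(1)]] inj_onD[OF \<sigma> _ dec_S[OF that(2) \<phi>[OF that(1)]] dec_S[OF i(2) \<phi>[OF i(1)]]]
        by simp
      then show ?thesis by blast
    qed
    then obtain s where s: "\<And>i k. i \<in> I \<Longrightarrow> k \<in> Pt (Dom D (f i)) \<Longrightarrow>
        s (f i \<cdot> k) = dec (Dom D (f i)) (\<phi> i) k"
      using D.comp_closed f(1) by metis
    have "s d \<in> S" if "d \<in> Pt A" for d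
      using s dec_S \<phi> cov_surj[OF A If that] by metis
    moreover have "P (Dom D (f i)) (\<lambda>k. s (f i \<cdot> k))" if "i \<in> I" for i
      by (rule PD(2)[OF f(2)[OF that], where \<phi> = "dec (Dom D (f i)) (\<phi> i)"])
        (use dec(1)[OF \<phi>[OF that]] s[OF that] in \<open>auto simp: PF_def\<close>)
    ultimately have "P A s" by (intro PD(5)[OF A If]) auto
    then have sP: "(\<lambda>d\<in>Pt A. s d) \<in> PF A" by (rule restr[OF A])
    define x where "x = enc A (\<lambda>d\<in>Pt A. s d)"
    have x: "x \<in> V A" using sP by (simp add: x_def V_def)
    have "Res X (f i) x = \<phi> i" if "i \<in> I" for i
    proof -
      have "(\<lambda>d\<in>Pt (Dom D (f i)). dec A x (f i \<cdot> d)) = dec (Dom D (f i)) (\<phi> i)"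
        by (rule PF_eqI[OF pre[OF f(1)[OF that] dec(1)[OF x]] dec(1)[OF \<phi>[OF that]]])
          (use dec_enc[OF A sP] s[OF that] D.comp_closed[OF _ f(1)[OF that]] in \<open>simp add: x_def\<close>)
      then show ?thesis using Res[OF f(1)[OF that] x] dec(2)[OF \<phi>[OF that]] by simp
    qed
    \<comment> \<open>Any other amalgamation has the same restriction to every point, because each
      point factors through the cover.\<close>
    moreover have "y = x" if y: "y \<in> V A" "\<forall>i\<in>I. Res X (f i) y = \<phi> i" for y
    proof (rule V_eqI[OF A y(1) x])
      fix d assume "d \<in> Pt A"
      then obtain i k where i: "i \<in> I" "k \<in> Pt (Dom D (f i))" "d = f i \<cdot> k" using cov_surj[OF A If] by metis
      have "Res X d z = Res X k (Res X (f i) z)" if "z \<in> V A" for z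
        using presheaf i f[OF i(1)] that A Val[OF A] One_Obj unfolding is_presheaf_def by blast
      then show "Res X d y = Res X d x" using y x \<open>\<And>i. i \<in> I \<Longrightarrow> Res X (f i) x = \<phi> i\<close> i(1) by simp
    qed
    ultimately show "\<exists>!x. x \<in> Val X A \<and> (\<forall>i\<in>I. Res X (f i) x = \<phi> i)"
      using x unfolding Val[OF A] by blast
  qed
  have "inj_on (underlying D X A) (Val X A)" if A: "A \<in> Obj D" for A
  proof (rule inj_onI)
    fix v w assume v: "v \<in> Val X A" and w: "w \<in> Val X A" and eq: "underlying D X A v = underlying D X A w"
    have "Res X d v = Res X d w" if "d \<in> Pt A" for d
      using fun_cong[OF eq, of d] that by (simp add: underlying_def)
    then show "v = w" using V_eqI[OF A] v w unfolding Val[OF A] by blast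
  qed
  moreover have "small U (Val X A)" if "A \<in> Obj D" for A
    using small_image[OF PF_small[OF that]] by (simp add: Val[OF that] V_def)
  ultimately have X: "X \<in> Obj Sp"
    using sheaf by (simp add: Sp_Obj is_D_space_def is_concrete_sheaf_def)
  have pts: "pts X = \<sigma> ` S"
  proof
    show "pts X \<subseteq> \<sigma> ` S" using Ide_One by (auto simp: pts_def Val[OF One_Obj] V_def enc_def PF_def)
    show "\<sigma> ` S \<subseteq> pts X"
    proof
      fix y assume "y \<in> \<sigma> ` S"
      then obtain s where s: "s \<in> S" "y = \<sigma> s" by blast
      have "y = enc (One D) (\<lambda>d\<in>Pt (One D). s)" using s Ide_One by (simp add: enc_def)
      then show "y \<in> pts X" using restr[OF One_Obj PD(3)[OF One_Obj s(1)]]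
        by (simp add: pts_def Val[OF One_Obj] V_def)
    qed
  qed
  define \<tau> where "\<tau> = inv_into S \<sigma>"
  have \<tau>: "\<tau> (\<sigma> s) = s" if "s \<in> S" for s using \<sigma> that by (simp add: \<tau>_def)
  have plot: "plot X A \<psi> \<longleftrightarrow> \<psi> \<in> Pt A \<rightarrow> pts X \<and> P A (\<lambda>d. \<tau> (\<psi> d))" if A: "A \<in> Obj D" for A \<psi>
  proof
    assume "plot X A \<psi>"
    then obtain v where v: "v \<in> V A" and \<psi>: "\<And>d. d \<in> Pt A \<Longrightarrow> \<psi> d = \<sigma> (dec A v d)"
      using Res_pt by (auto simp: plot_def Val[OF A])
    have "P A (\<lambda>d. \<tau> (\<psi> d))"
      by (rule PD(2)[OF A, where \<phi> = "dec A v"])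
        (use \<psi> dec_S[OF _ v] \<tau> dec(1)[OF v] in \<open>auto simp: PF_def\<close>)
    then show "\<psi> \<in> Pt A \<rightarrow> pts X \<and> P A (\<lambda>d. \<tau> (\<psi> d))" using \<psi> dec_S[OF _ v] pts by auto
  next
    assume a: "\<psi> \<in> Pt A \<rightarrow> pts X \<and> P A (\<lambda>d. \<tau> (\<psi> d))"
    let ?\<phi> = "\<lambda>d\<in>Pt A. \<tau> (\<psi> d)"
    have \<phi>: "?\<phi> \<in> PF A" using restr[OF A] a by blast
    have "\<psi> d = Res X d (enc A ?\<phi>)" if "d \<in> Pt A" for d
    proof -
      have "\<psi> d \<in> \<sigma> ` S" using a that pts by auto
      then have "\<sigma> (\<tau> (\<psi> d)) = \<psi> d" using \<tau> by auto
      then show ?thesis using Res_pt[OF that, of "enc A ?\<phi>"] \<phi> dec_enc[OF A \<phi>] that by (simp add: V_def)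
    qed
    then show "plot X A \<psi>" using \<phi> unfolding plot_def Val[OF A] V_def by blast
  qed
  show ?thesis
    by (rule that[OF X, of \<sigma> \<tau>]) (use pts \<tau> plot in auto)
qed

text \<open>Functions that agree on \<open>Pt A\<close> need not be equal in HOL, so a plot is
  rewritten with this rule instead of by substitution.\<close>

lemma plot_cong:
  assumes "A \<in> Obj D" "X \<in> Obj Sp" "plot X A \<phi>" "\<And>d. d \<in> Pt A \<Longrightarrow> \<phi> d = \<psi> d"
  shows "plot X A \<psi>"
  using plotD(2)[OF assms(2,1,3,4)] .


section \<open>Limits\<close>

text \<open>Composition with the fixed maps \<open>g k\<close> respects each closure condition, so
  all of them are inherited from the spaces \<open>X k\<close>. Besides limits, this supplies the
  competing structure in the universal property of final structures.\<close>

lemma initial_structure: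
  fixes S :: "'a set" and g :: "'k \<Rightarrow> 'a \<Rightarrow> 'u"
  assumes X: "\<And>k. k \<in> K \<Longrightarrow> X k \<in> Obj Sp"
    and g: "\<And>k s. k \<in> K \<Longrightarrow> s \<in> S \<Longrightarrow> g k s \<in> pts (X k)"
  shows "plot_structure S (\<lambda>A \<phi>. \<phi> \<in> Pt A \<rightarrow> S \<and> (\<forall>k\<in>K. plot (X k) A (\<lambda>d. g k (\<phi> d))))"
proof -
  define P where "P A \<phi> \<longleftrightarrow> \<phi> \<in> Pt A \<rightarrow> S \<and> (\<forall>k\<in>K. plot (X k) A (\<lambda>d. g k (\<phi> d)))" for A \<phi>
  have "plot_structure S P"
  proof (rule plot_structureI)
    fix A \<phi> \<psi> assume A: "A \<in> Obj D" and P: "P A \<phi>" and eq: "\<And>d. d \<in> Pt A \<Longrightarrow> \<phi> d = \<psi> d"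
    have "plot (X k) A (\<lambda>d. g k (\<psi> d))" if "k \<in> K" for k
      by (rule plotD(2)[OF X[OF that] A, where \<phi> = "\<lambda>d. g k (\<phi> d)"]) (use P eq that in \<open>auto simp: P_def\<close>)
    moreover have "\<psi> \<in> Pt A \<rightarrow> S" using P by (auto simp: P_def eq[symmetric])
    ultimately show "P A \<psi>" by (simp add: P_def)
  next
    fix A s assume "A \<in> Obj D" "s \<in> S"
    then show "P A (\<lambda>_. s)" using plotD(3)[OF X] g by (auto simp: P_def)
  next
    fix A B h \<phi> assume h: "h \<in> Hom D B A" and P: "P A \<phi>"
    have "plot (X k) B (\<lambda>d. g k (\<phi> (h \<cdot> d)))" if "k \<in> K" for k
      by (rule plotD(4)[OF X[OF that] h, where \<phi> = "\<lambda>d. g k (\<phi> d)"]) (use P that in \<open>simp add: P_def\<close>)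
    then show "P B (\<lambda>d. \<phi> (h \<cdot> d))" using P D.comp_closed[OF _ h] by (auto simp: P_def)
  next
    fix A I f \<phi> assume A: "A \<in> Obj D" "(I, f) \<in> Cov D A" and \<phi>: "\<phi> \<in> Pt A \<rightarrow> S"
      and P: "\<And>i. i \<in> I \<Longrightarrow> P (Dom D (f i)) (\<lambda>d. \<phi> (f i \<cdot> d))"
    have "plot (X k) A (\<lambda>d. g k (\<phi> d))" if "k \<in> K" for k
      by (rule plotD(5)[OF X[OF that] A]) (use P g[OF that] Pi_mem[OF \<phi>] that in \<open>simp_all add: P_def\<close>)
    then show "P A \<phi>" using \<phi> by (simp add: P_def)
  qed (simp add: P_def)
  then show ?thesis unfolding P_def .
qed

text \<open>A single source for limits, fibre products, images and the terminal object: a set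
  \<open>S\<close> on which the maps \<open>g k\<close> jointly separate points, with the initial
  structure. Separation makes a factorisation unique; it exists as soon as every point of
  \<open>Q\<close> is sent to a family realised in \<open>S\<close>, and it is smooth because
  smoothness into \<open>L\<close> is tested by the maps \<open>p k\<close>.\<close>

lemma joint_lift:
  fixes S :: "'a set" and g :: "'k \<Rightarrow> 'a \<Rightarrow> 'u"
  assumes S: "small U S" and X: "\<And>k. k \<in> K \<Longrightarrow> X k \<in> Obj Sp"
    and g: "\<And>k s. k \<in> K \<Longrightarrow> s \<in> S \<Longrightarrow> g k s \<in> pts (X k)"
    and inj: "\<And>s s'. s \<in> S \<Longrightarrow> s' \<in> S \<Longrightarrow> (\<And>k. k \<in> K \<Longrightarrow> g k s = g k s') \<Longrightarrow> s = s'"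
  obtains L p where "L \<in> Obj Sp" and "\<And>k. k \<in> K \<Longrightarrow> p k \<in> Hom Sp L (X k)"
    and "\<And>x. x \<in> pts L \<Longrightarrow> \<exists>s\<in>S. \<forall>k\<in>K. fn (p k) x = g k s"
    and "\<And>s. s \<in> S \<Longrightarrow> \<exists>x\<in>pts L. \<forall>k\<in>K. fn (p k) x = g k s"
    and "\<And>x y. x \<in> pts L \<Longrightarrow> y \<in> pts L \<Longrightarrow> (\<And>k. k \<in> K \<Longrightarrow> fn (p k) x = fn (p k) y) \<Longrightarrow> x = y"
    and "\<And>A \<psi>. A \<in> Obj D \<Longrightarrow>
      plot L A \<psi> \<longleftrightarrow> \<psi> \<in> Pt A \<rightarrow> pts L \<and> (\<forall>k\<in>K. plot (X k) A (\<lambda>d. fn (p k) (\<psi> d)))"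
    and "\<And>Q q. Q \<in> Obj Sp \<Longrightarrow> (\<And>k. k \<in> K \<Longrightarrow> q k \<in> Hom Sp Q (X k)) \<Longrightarrow>
      (\<And>z. z \<in> pts Q \<Longrightarrow> \<exists>s\<in>S. \<forall>k\<in>K. fn (q k) z = g k s) \<Longrightarrow>
      \<exists>!h. h \<in> Hom Sp Q L \<and> (\<forall>k\<in>K. p k \<cdot>\<^bsub>Sp\<^esub> h = q k)"
proof -
  define P where "P A \<phi> \<longleftrightarrow> \<phi> \<in> Pt A \<rightarrow> S \<and> (\<forall>k\<in>K. plot (X k) A (\<lambda>d. g k (\<phi> d)))" for A \<phi>
  have "plot_structure S P"
    using initial_structure[of K X S g, OF X g] unfolding P_def by blast
  from ex_space[OF S this] obtain L \<sigma> \<tau> where L: "L \<in> Obj Sp"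
    and \<sigma>: "\<And>s. s \<in> S \<Longrightarrow> \<sigma> s \<in> pts L" "\<And>s. s \<in> S \<Longrightarrow> \<tau> (\<sigma> s) = s"
    and \<tau>: "\<And>x. x \<in> pts L \<Longrightarrow> \<tau> x \<in> S" "\<And>x. x \<in> pts L \<Longrightarrow> \<sigma> (\<tau> x) = x"
    and pl: "\<And>A \<psi>. A \<in> Obj D \<Longrightarrow> plot L A \<psi> \<longleftrightarrow> \<psi> \<in> Pt A \<rightarrow> pts L \<and> P A (\<lambda>d. \<tau> (\<psi> d))"
    by blast
  have sm: "smooth L (X k) (\<lambda>x. g k (\<tau> x))" if "k \<in> K" for k
    using that g \<tau>(1) pl by (auto simp: smooth_def P_def)
  have "\<forall>k\<in>K. \<exists>p. p \<in> Hom Sp L (X k) \<and> (\<forall>x\<in>pts L. fn p x = g k (\<tau> x))"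
    using ex_arr[OF L X sm] by metis
  then obtain p where p: "\<And>k. k \<in> K \<Longrightarrow> p k \<in> Hom Sp L (X k)"
    and fp: "\<And>k x. k \<in> K \<Longrightarrow> x \<in> pts L \<Longrightarrow> fn (p k) x = g k (\<tau> x)" by metis
  have plL: "plot L A \<psi> \<longleftrightarrow> \<psi> \<in> Pt A \<rightarrow> pts L \<and> (\<forall>k\<in>K. plot (X k) A (\<lambda>d. fn (p k) (\<psi> d)))"
    if A: "A \<in> Obj D" for A \<psi>
  proof -
    \<comment> \<open>The two functions agree on \<open>Pt A\<close> only, hence congruence in both
      directions.\<close>
    have "plot (X k) A (\<lambda>d. g k (\<tau> (\<psi> d))) \<longleftrightarrow> plot (X k) A (\<lambda>d. fn (p k) (\<psi> d))"
      if "\<psi> \<in> Pt A \<rightarrow> pts L" "k \<in> K" for k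
    proof -
      have "g k (\<tau> (\<psi> d)) = fn (p k) (\<psi> d)" if "d \<in> Pt A" for d
        using fp[OF \<open>k \<in> K\<close> Pi_mem[OF \<open>\<psi> \<in> Pt A \<rightarrow> pts L\<close> that]] by simp
      then show ?thesis
        using plot_cong[OF A X[OF that(2)], of "\<lambda>d. g k (\<tau> (\<psi> d))" "\<lambda>d. fn (p k) (\<psi> d)"]
          plot_cong[OF A X[OF that(2)], of "\<lambda>d. fn (p k) (\<psi> d)" "\<lambda>d. g k (\<tau> (\<psi> d))"] by auto
    qed
    then show ?thesis using pl[OF A, of \<psi>] \<tau>(1) by (auto simp: P_def)
  qed
  have injL: "x = y" if "x \<in> pts L" "y \<in> pts L" "\<And>k. k \<in> K \<Longrightarrow> fn (p k) x = fn (p k) y" for x y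
    using inj[OF \<tau>(1)[OF that(1)] \<tau>(1)[OF that(2)]] fp that \<tau>(2) by metis
  have uni: "\<exists>!h. h \<in> Hom Sp Q L \<and> (\<forall>k\<in>K. p k \<cdot>\<^bsub>Sp\<^esub> h = q k)"
    if Q: "Q \<in> Obj Sp" and q: "\<And>k. k \<in> K \<Longrightarrow> q k \<in> Hom Sp Q (X k)"
      and ex: "\<And>z. z \<in> pts Q \<Longrightarrow> \<exists>s\<in>S. \<forall>k\<in>K. fn (q k) z = g k s" for Q q
  proof -
    obtain u where u: "\<And>z. z \<in> pts Q \<Longrightarrow> u z \<in> S" "\<And>z k. z \<in> pts Q \<Longrightarrow> k \<in> K \<Longrightarrow> fn (q k) z = g k (u z)"
      using ex by metis
    have fu: "fn (p k) (\<sigma> (u z)) = fn (q k) z" if "z \<in> pts Q" "k \<in> K" for z k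
      using fp[OF that(2) \<sigma>(1)[OF u(1)[OF that(1)]]] \<sigma>(2)[OF u(1)[OF that(1)]] u(2)[OF that] by simp
    have "smooth Q L (\<lambda>z. \<sigma> (u z))"
      unfolding smooth_def
    proof (intro conjI ballI allI impI)
      show "(\<lambda>z. \<sigma> (u z)) \<in> pts Q \<rightarrow> pts L" using \<sigma>(1) u(1) by blast
      fix A \<phi> assume A: "A \<in> Obj D" and \<phi>: "plot Q A \<phi>"
      note \<phi>Q = plotD(1)[OF Q A \<phi>]
      have "plot (X k) A (\<lambda>d. fn (p k) (\<sigma> (u (\<phi> d))))" if "k \<in> K" for k
        by (rule plot_cong[OF A X[OF that] fn_plot[OF q[OF that] A \<phi>]]) (use fu that Pi_mem[OF \<phi>Q] in simp)
      then show "plot L A (\<lambda>d. \<sigma> (u (\<phi> d)))" using \<phi>Q \<sigma>(1) u(1) by (auto simp: plL[OF A])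
    qed
    then obtain h where h: "h \<in> Hom Sp Q L" "\<And>z. z \<in> pts Q \<Longrightarrow> fn h z = \<sigma> (u z)"
      using ex_arr[OF Q L] by blast
    have "p k \<cdot>\<^bsub>Sp\<^esub> h = q k" if "k \<in> K" for k
      by (rule Sp_arr_eqI[OF S.comp_closed[OF h(1) p[OF that]] q[OF that]])
        (use fn_comp[OF h(1) p[OF that]] h(2) fu that in simp)
    moreover have "h' = h" if h': "h' \<in> Hom Sp Q L" "\<forall>k\<in>K. p k \<cdot>\<^bsub>Sp\<^esub> h' = q k" for h'
    proof (rule Sp_arr_eqI[OF h'(1) h(1)])
      fix z assume z: "z \<in> pts Q"
      have "fn (p k) (fn h' z) = fn (p k) (fn h z)" if "k \<in> K" for k
        using fn_comp[OF h'(1) p[OF that] z] h'(2) that h(2)[OF z] fu[OF z that] by simp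
      then show "fn h' z = fn h z" using injL fn_closed h(1) h'(1) z by metis
    qed
    ultimately show ?thesis using h(1) by blast
  qed
  have "\<exists>s\<in>S. \<forall>k\<in>K. fn (p k) x = g k s" if "x \<in> pts L" for x using that fp \<tau>(1) by metis
  moreover have "\<exists>x\<in>pts L. \<forall>k\<in>K. fn (p k) x = g k s" if "s \<in> S" for s using that fp \<sigma> by metis
  ultimately show ?thesis using that[of L p] L p injL plL uni by blast
qed

text \<open>The points are the compatible families, that is, the limit of the diagram of point sets.
  A cone sends each of its points to such a family, which is the condition for factoring in
  \<open>joint_lift\<close>.\<close>

lemma limits:
  fixes J :: "('j, 'k, 'y) cat_scheme"
  assumes small: "small U (Obj J)"
  shows "has_limits_of_shape J Sp"
  unfolding has_limits_of_shape_def
proof (intro allI impI)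
  fix F :: "('j, 'k, ('o, 'm, 'u) presheaf, ('o, 'm, 'u) presheaf_arr) fctr"
  assume F: "is_functor J Sp F"
  note FH = functor_Hom[OF F]
  have FO: "OMap F j \<in> Obj Sp" if "j \<in> Obj J" for j using F that by (simp add: is_functor_def)
  define S where "S = {x \<in> \<Pi>\<^sub>E j\<in>Obj J. pts (OMap F j). \<forall>u\<in>Arr J. fn (AMap F u) (x (Dom J u)) = x (Cod J u)}"
  have sm: "small U S"
    by (rule small_subset[OF small_PiE[OF universe small small_pts[OF FO]]]) (auto simp: S_def)
  have inj: "s = s'" if "s \<in> S" "s' \<in> S" "\<And>j. j \<in> Obj J \<Longrightarrow> s j = s' j" for s s'
    by (rule PiE_ext[where k = "Obj J" and s = "\<lambda>j. pts (OMap F j)"]) (use that in \<open>auto simp: S_def\<close>)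
  define g where "g j s = s j" for j :: 'j and s :: "'j \<Rightarrow> 'u"
  have g: "g j s \<in> pts (OMap F j)" if "j \<in> Obj J" "s \<in> S" for j s
    using that by (auto simp: S_def g_def)
  have inj': "s = s'" if "s \<in> S" "s' \<in> S" "\<And>j. j \<in> Obj J \<Longrightarrow> g j s = g j s'" for s s'
    using inj that by (simp add: g_def)
  obtain L p where L: "L \<in> Obj Sp" and p: "\<And>j. j \<in> Obj J \<Longrightarrow> p j \<in> Hom Sp L (OMap F j)"
    and ps: "\<And>x. x \<in> pts L \<Longrightarrow> \<exists>s\<in>S. \<forall>j\<in>Obj J. fn (p j) x = g j s"
    and uni: "\<And>Q q. Q \<in> Obj Sp \<Longrightarrow> (\<And>k. k \<in> Obj J \<Longrightarrow> q k \<in> Hom Sp Q (OMap F k)) \<Longrightarrow>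
      (\<And>z. z \<in> pts Q \<Longrightarrow> \<exists>s\<in>S. \<forall>k\<in>Obj J. fn (q k) z = g k s) \<Longrightarrow>
      \<exists>!h. h \<in> Hom Sp Q L \<and> (\<forall>k\<in>Obj J. p k \<cdot>\<^bsub>Sp\<^esub> h = q k)"
    by (rule joint_lift[OF sm FO g inj']) blast+
  have "AMap F u \<cdot>\<^bsub>Sp\<^esub> p (Dom J u) = p (Cod J u)" if u: "u \<in> Arr J" for u
  proof (rule Sp_arr_eqI[OF S.comp_closed[OF p FH(1)] p])
    fix x assume x: "x \<in> pts L"
    show "fn (AMap F u \<cdot>\<^bsub>Sp\<^esub> p (Dom J u)) x = fn (p (Cod J u)) x"
      using ps[OF x] fn_comp[OF p FH(1) x] FH[OF u] u by (auto simp: S_def g_def)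
  qed (use u FH in auto)
  then have "is_cone J Sp F L p" using L p by (simp add: is_cone_def)
  moreover have "\<exists>!h. h \<in> Hom Sp M L \<and> (\<forall>j\<in>Obj J. p j \<cdot>\<^bsub>Sp\<^esub> h = \<mu> j)"
    if c: "is_cone J Sp F M \<mu>" for M \<mu>
  proof (rule uni)
    show M: "M \<in> Obj Sp" and m: "\<And>j. j \<in> Obj J \<Longrightarrow> \<mu> j \<in> Hom Sp M (OMap F j)"
      using c by (simp_all add: is_cone_def)
    fix z assume z: "z \<in> pts M"
    have "fn (AMap F u) (fn (\<mu> (Dom J u)) z) = fn (\<mu> (Cod J u)) z" if u: "u \<in> Arr J" for u
      using fn_comp[OF m FH(1) z] FH[OF u] u c by (simp add: is_cone_def)
    then have "(\<lambda>j\<in>Obj J. fn (\<mu> j) z) \<in> S"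
      using fn_closed[OF m z] FH by (auto simp: S_def)
    then show "\<exists>s\<in>S. \<forall>k\<in>Obj J. fn (\<mu> k) z = g k s" by (rule bexI[rotated]) (simp add: g_def)
  qed
  ultimately show "\<exists>L \<pi>. is_limit J Sp F L \<pi>" unfolding is_limit_def by blast
qed

section \<open>Fibre products over a base\<close>

text \<open>A product in the slice is a fibre product over \<open>B\<close>. The index
  \<open>None\<close> stands for the base itself and points carry their base coordinate, so that the
  empty family gives \<open>B\<close> and no separate treatment of the terminal object is
  required.\<close>

lemma slice_products:
  assumes B: "B \<in> Obj Sp"
  shows "has_finite_products (slice Sp B)"
  unfolding has_finite_products_def
proof (intro allI impI, elim conjE)
  fix I :: "nat set" and A
  assume I: "finite I" and "\<forall>i\<in>I. A i \<in> Obj (slice Sp B)"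
  then have A: "A i \<in> Hom Sp (Dom Sp (A i)) B" if "i \<in> I" for i using that by (simp add: slice_Obj)
  define X where "X k = (case k of None \<Rightarrow> B | Some i \<Rightarrow> Dom Sp (A i))" for k
  define g where "g k s = (case k of None \<Rightarrow> fst s | Some i \<Rightarrow> snd s i)"
    for k :: "nat option" and s :: "'u \<times> (nat \<Rightarrow> 'u)"
  define K where "K = insert None (Some ` I)"
  define S where "S = {(b, x). b \<in> pts B \<and> x \<in> (\<Pi>\<^sub>E i\<in>I. pts (Dom Sp (A i))) \<and> (\<forall>i\<in>I. fn (A i) (x i) = b)}"
  have X: "X k \<in> Obj Sp" if "k \<in> K" for k
    using that B S.Hom_Obj(1)[OF A] by (auto simp: K_def X_def)
  have "small U (pts B \<times> (\<Pi>\<^sub>E i\<in>I. pts (Dom Sp (A i))))"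
    by (rule small_Sigma[OF universe small_pts[OF B]
          small_PiE[OF universe small_finite[OF universe I] small_pts[OF S.Hom_Obj(1)[OF A]]]])
  then have sm: "small U S" by (rule small_subset) (auto simp: S_def)
  have g: "g k s \<in> pts (X k)" if "k \<in> K" "s \<in> S" for k s
    using that by (auto simp: K_def S_def g_def X_def)
  have inj: "s = s'" if s: "s \<in> S" "s' \<in> S" and "\<And>k. k \<in> K \<Longrightarrow> g k s = g k s'" for s s'
  proof (rule prod_eqI)
    have eq: "\<And>k. k \<in> K \<Longrightarrow> g k s = g k s'" by fact
    from eq[of None] show "fst s = fst s'" by (simp add: g_def K_def)
    have "snd s i = snd s' i" if "i \<in> I" for i using eq[of "Some i"] that by (simp add: g_def K_def)
    then show "snd s = snd s'"
      by (intro PiE_ext[where k = I and s = "\<lambda>i. pts (Dom Sp (A i))"]) (use s in \<open>auto simp: S_def\<close>)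
  qed
  obtain L p where L: "L \<in> Obj Sp" and p: "\<And>k. k \<in> K \<Longrightarrow> p k \<in> Hom Sp L (X k)"
    and ps: "\<And>x. x \<in> pts L \<Longrightarrow> \<exists>s\<in>S. \<forall>k\<in>K. fn (p k) x = g k s"
    and uni: "\<And>Q q. Q \<in> Obj Sp \<Longrightarrow> (\<And>k. k \<in> K \<Longrightarrow> q k \<in> Hom Sp Q (X k)) \<Longrightarrow>
      (\<And>z. z \<in> pts Q \<Longrightarrow> \<exists>s\<in>S. \<forall>k\<in>K. fn (q k) z = g k s) \<Longrightarrow>
      \<exists>!h. h \<in> Hom Sp Q L \<and> (\<forall>k\<in>K. p k \<cdot>\<^bsub>Sp\<^esub> h = q k)"
    by (rule joint_lift[OF sm X g inj]) blast+
  define P where "P = p None"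
  have P: "P \<in> Hom Sp L B" using p[of None] by (simp add: P_def K_def X_def)
  then have DP: "Dom Sp P = L" by (simp add: Hom_def)
  have pS: "p (Some i) \<in> Hom Sp L (Dom Sp (A i))" if "i \<in> I" for i
    using p[of "Some i"] that by (simp add: K_def X_def)
  have comm: "A i \<cdot>\<^bsub>Sp\<^esub> p (Some i) = P" if i: "i \<in> I" for i
  proof (rule Sp_arr_eqI[OF S.comp_closed[OF pS[OF i] A[OF i]] P])
    fix x assume x: "x \<in> pts L"
    obtain s where "s \<in> S" "\<forall>k\<in>K. fn (p k) x = g k s" using ps[OF x] by blast
    then show "fn (A i \<cdot>\<^bsub>Sp\<^esub> p (Some i)) x = fn P x"
      using fn_comp[OF pS[OF i] A[OF i] x] i by (auto simp: K_def S_def g_def P_def)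
  qed
  have "is_product (slice Sp B) I A P (\<lambda>i. (P, A i, p (Some i)))"
    unfolding is_product_def
  proof (intro conjI ballI allI impI)
    show "P \<in> Obj (slice Sp B)" using P DP by (simp add: slice_Obj)
    show "(P, A i, p (Some i)) \<in> Hom (slice Sp B) P (A i)" if "i \<in> I" for i
      using P DP pS A comm that by (simp add: slice_Hom)
    fix Q q assume "Q \<in> Obj (slice Sp B)" and "\<forall>i\<in>I. q i \<in> Hom (slice Sp B) Q (A i)"
    then have Q: "Q \<in> Hom Sp (Dom Sp Q) B" and "\<forall>i\<in>I. \<exists>r. q i = (Q, A i, r) \<and>
        r \<in> Hom Sp (Dom Sp Q) (Dom Sp (A i)) \<and> A i \<cdot>\<^bsub>Sp\<^esub> r = Q"
      by (auto simp: slice_Obj slice_Hom)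
    then obtain r where q: "\<And>i. i \<in> I \<Longrightarrow> q i = (Q, A i, r i)"
      and r: "\<And>i. i \<in> I \<Longrightarrow> r i \<in> Hom Sp (Dom Sp Q) (Dom Sp (A i))"
      and Ar: "\<And>i. i \<in> I \<Longrightarrow> A i \<cdot>\<^bsub>Sp\<^esub> r i = Q" by metis
    define r' where "r' k = (case k of None \<Rightarrow> Q | Some i \<Rightarrow> r i)" for k
    have "\<exists>!h. h \<in> Hom Sp (Dom Sp Q) L \<and> (\<forall>k\<in>K. p k \<cdot>\<^bsub>Sp\<^esub> h = r' k)"
    proof (rule uni)
      show "Dom Sp Q \<in> Obj Sp" using Q S.Hom_Obj by blast
      show "r' k \<in> Hom Sp (Dom Sp Q) (X k)" if "k \<in> K" for k
        using that r Q by (auto simp: r'_def K_def X_def)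
      fix z assume z: "z \<in> pts (Dom Sp Q)"
      have "fn (A i) (fn (r i) z) = fn Q z" if "i \<in> I" for i
        using fn_comp[OF r[OF that] A[OF that] z] Ar[OF that] by simp
      then have "(fn Q z, \<lambda>i\<in>I. fn (r i) z) \<in> S"
        using fn_closed[OF Q z] fn_closed[OF r z] by (auto simp: S_def)
      then show "\<exists>s\<in>S. \<forall>k\<in>K. fn (r' k) z = g k s"
        by (rule bexI[rotated]) (auto simp: K_def r'_def g_def)
    qed
    moreover have char: "t \<in> Hom (slice Sp B) Q P \<and> (\<forall>i\<in>I. (P, A i, p (Some i)) \<cdot>\<^bsub>slice Sp B\<^esub> t = q i) \<longleftrightarrow>
      (\<exists>h. t = (Q, P, h) \<and> h \<in> Hom Sp (Dom Sp Q) L \<and> (\<forall>k\<in>K. p k \<cdot>\<^bsub>Sp\<^esub> h = r' k))" for t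
      using Q P DP q by (auto simp: slice_Hom slice_Comp K_def r'_def P_def)
    ultimately show "\<exists>!t. t \<in> Hom (slice Sp B) Q P \<and>
        (\<forall>i\<in>I. (P, A i, p (Some i)) \<cdot>\<^bsub>slice Sp B\<^esub> t = q i)"
      unfolding char ex1_triple by blast
  qed
  then show "\<exists>P p. is_product (slice Sp B) I A P p" by blast
qed

text \<open>A categorical product is given only up to isomorphism, so \<open>P\<close> is compared
  with a concrete fibre product \<open>L\<close>. The universal properties give \<open>h\<close>
  from \<open>L\<close> to \<open>P\<close> and \<open>k\<close> back, both compatible with the
  projections, and uniqueness makes \<open>h\<close> after \<open>k\<close> the identity. Points
  over a given pair are found through \<open>h\<close>, points are separated through
  \<open>k\<close>, and a function into \<open>P\<close> is shown to be a plot by passing to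
  \<open>L\<close> and returning.\<close>

lemma binary_product_slice:
  assumes pr: "is_binary_product (slice Sp B) x y P p q"
    and p: "p = (P, x, p')" and q: "q = (P, y, q')"
  shows "\<And>a b. a \<in> pts (Dom Sp x) \<Longrightarrow> b \<in> pts (Dom Sp y) \<Longrightarrow> fn x a = fn y b \<Longrightarrow>
      \<exists>c\<in>pts (Dom Sp P). fn p' c = a \<and> fn q' c = b"
    and "\<And>c c'. c \<in> pts (Dom Sp P) \<Longrightarrow> c' \<in> pts (Dom Sp P) \<Longrightarrow> fn p' c = fn p' c' \<Longrightarrow>
      fn q' c = fn q' c' \<Longrightarrow> c = c'"
    and "\<And>A \<psi>. A \<in> Obj D \<Longrightarrow> \<psi> \<in> Pt A \<rightarrow> pts (Dom Sp P) \<Longrightarrow>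
      plot (Dom Sp x) A (\<lambda>d. fn p' (\<psi> d)) \<Longrightarrow> plot (Dom Sp y) A (\<lambda>d. fn q' (\<psi> d)) \<Longrightarrow>
      plot (Dom Sp P) A \<psi>"
proof -
  let ?X = "Dom Sp x" and ?Y = "Dom Sp y" and ?P = "Dom Sp P"
  from pr have "p \<in> Hom (slice Sp B) P x" "q \<in> Hom (slice Sp B) P y"
    by (simp_all add: is_binary_product_def)
  then have P: "P \<in> Hom Sp ?P B" and x: "x \<in> Hom Sp ?X B" and y: "y \<in> Hom Sp ?Y B"
    and p': "p' \<in> Hom Sp ?P ?X" "x \<cdot>\<^bsub>Sp\<^esub> p' = P" and q': "q' \<in> Hom Sp ?P ?Y" "y \<cdot>\<^bsub>Sp\<^esub> q' = P"
    by (auto simp: slice_Hom p q)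
  have PO: "?P \<in> Obj Sp" "?X \<in> Obj Sp" "?Y \<in> Obj Sp" using P x y S.Hom_Obj by blast+
  define S where "S = {(a, b). a \<in> pts ?X \<and> b \<in> pts ?Y \<and> fn x a = fn y b}"
  define X where "X k = (if k then ?X else ?Y)" for k
  define g where "g k s = (if k then fst s else snd s)" for k and s :: "'u \<times> 'u"
  have "small U (pts ?X \<times> pts ?Y)"
    by (rule small_Sigma[OF universe small_pts[OF PO(2)] small_pts[OF PO(3)]])
  then have sm: "small U S" by (rule small_subset) (auto simp: S_def)
  have X: "X k \<in> Obj Sp" for k using PO by (simp add: X_def)
  have g: "g k s \<in> pts (X k)" if "s \<in> S" for k s using that by (auto simp: g_def X_def S_def)
  have inj: "s = s'" if "\<And>k. k \<in> UNIV \<Longrightarrow> g k s = g k s'" for s s'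
    using that[of True] that[of False] by (simp add: g_def prod_eq_iff)
  obtain L r where L: "L \<in> Obj Sp" and r: "\<And>k. k \<in> UNIV \<Longrightarrow> r k \<in> Hom Sp L (X k)"
    and ps: "\<And>x. x \<in> pts L \<Longrightarrow> \<exists>s\<in>S. \<forall>k\<in>UNIV. fn (r k) x = g k s"
    and sp: "\<And>s. s \<in> S \<Longrightarrow> \<exists>x\<in>pts L. \<forall>k\<in>UNIV. fn (r k) x = g k s"
    and injL: "\<And>x y. x \<in> pts L \<Longrightarrow> y \<in> pts L \<Longrightarrow> (\<And>k. k \<in> UNIV \<Longrightarrow> fn (r k) x = fn (r k) y) \<Longrightarrow> x = y"
    and plL: "\<And>A \<psi>. A \<in> Obj D \<Longrightarrow>
      plot L A \<psi> \<longleftrightarrow> \<psi> \<in> Pt A \<rightarrow> pts L \<and> (\<forall>k\<in>UNIV. plot (X k) A (\<lambda>d. fn (r k) (\<psi> d)))"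
    and uni: "\<And>Q q. Q \<in> Obj Sp \<Longrightarrow> (\<And>k. k \<in> UNIV \<Longrightarrow> q k \<in> Hom Sp Q (X k)) \<Longrightarrow>
      (\<And>z. z \<in> pts Q \<Longrightarrow> \<exists>s\<in>S. \<forall>k\<in>UNIV. fn (q k) z = g k s) \<Longrightarrow>
      \<exists>!h. h \<in> Hom Sp Q L \<and> (\<forall>k\<in>UNIV. r k \<cdot>\<^bsub>Sp\<^esub> h = q k)"
    by (rule joint_lift[of S UNIV X g, OF sm X g inj]) blast+
  have r1: "r True \<in> Hom Sp L ?X" and r2: "r False \<in> Hom Sp L ?Y"
    using r[of True] r[of False] by (simp_all add: X_def)
  have xr: "x \<cdot>\<^bsub>Sp\<^esub> r True = y \<cdot>\<^bsub>Sp\<^esub> r False"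
  proof (rule Sp_arr_eqI[OF S.comp_closed[OF r1 x] S.comp_closed[OF r2 y]])
    fix z assume z: "z \<in> pts L"
    obtain s where "s \<in> S" "\<And>k. fn (r k) z = g k s" using ps[OF z] by blast
    then show "fn (x \<cdot>\<^bsub>Sp\<^esub> r True) z = fn (y \<cdot>\<^bsub>Sp\<^esub> r False) z"
      using fn_comp[OF r1 x z] fn_comp[OF r2 y z] by (auto simp: S_def g_def)
  qed
  define R where "R = x \<cdot>\<^bsub>Sp\<^esub> r True"
  have R: "R \<in> Hom Sp L B" using S.comp_closed[OF r1 x] by (simp add: R_def)
  then have DR: "Dom Sp R = L" by (simp add: Hom_def)
  have uniP: "\<exists>!t. t \<in> Hom (slice Sp B) Q P \<and> p \<cdot>\<^bsub>slice Sp B\<^esub> t = f \<and> q \<cdot>\<^bsub>slice Sp B\<^esub> t = f'"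
    if "f \<in> Hom (slice Sp B) Q x" "f' \<in> Hom (slice Sp B) Q y" "Q \<in> Obj (slice Sp B)" for Q f f'
    using pr that unfolding is_binary_product_def by blast
  have "(R, x, r True) \<in> Hom (slice Sp B) R x" "(R, y, r False) \<in> Hom (slice Sp B) R y"
      "R \<in> Obj (slice Sp B)"
    using R DR x y r1 r2 xr by (simp_all add: slice_Hom slice_Obj R_def[symmetric])
  from uniP[OF this] obtain h where h: "h \<in> Hom Sp L ?P" "p' \<cdot>\<^bsub>Sp\<^esub> h = r True" "q' \<cdot>\<^bsub>Sp\<^esub> h = r False"
    "P \<cdot>\<^bsub>Sp\<^esub> h = R"
    by (auto simp: slice_Hom p q slice_Comp DR)
  have "\<exists>!k. k \<in> Hom Sp ?P L \<and> (\<forall>i\<in>UNIV. r i \<cdot>\<^bsub>Sp\<^esub> k = (if i then p' else q'))"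
  proof (rule uni[OF PO(1)])
    show "(if i then p' else q') \<in> Hom Sp ?P (X i)" for i using p' q' by (simp add: X_def)
    fix z assume z: "z \<in> pts ?P"
    have "fn x (fn p' z) = fn y (fn q' z)"
      using fn_comp[OF p'(1) x z] fn_comp[OF q'(1) y z] p'(2) q'(2) by simp
    then have "(fn p' z, fn q' z) \<in> S" using fn_closed p'(1) q'(1) z by (auto simp: S_def)
    then show "\<exists>s\<in>S. \<forall>k\<in>UNIV. fn (if k then p' else q') z = g k s"
      by (rule bexI[rotated]) (auto simp: g_def)
  qed
  then obtain k where k: "k \<in> Hom Sp ?P L" "\<And>i. r i \<cdot>\<^bsub>Sp\<^esub> k = (if i then p' else q')" by blast
  have rk: "r True \<cdot>\<^bsub>Sp\<^esub> k = p'" "r False \<cdot>\<^bsub>Sp\<^esub> k = q'" using k(2) by simp_all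
  \<comment> \<open>Both endomorphisms of \<open>P\<close> have the same composites with the two
    projections.\<close>
  have hk: "h \<cdot>\<^bsub>Sp\<^esub> k = Ide Sp ?P"
  proof -
    have 1: "h \<cdot>\<^bsub>Sp\<^esub> k \<in> Hom Sp ?P ?P" "Ide Sp ?P \<in> Hom Sp ?P ?P"
      using S.comp_closed[OF k(1) h(1)] S.ide_closed[OF PO(1)] by auto
    have 2: "p' \<cdot>\<^bsub>Sp\<^esub> (h \<cdot>\<^bsub>Sp\<^esub> k) = p'" "q' \<cdot>\<^bsub>Sp\<^esub> (h \<cdot>\<^bsub>Sp\<^esub> k) = q'"
      using S.comp_assoc[OF k(1) h(1) p'(1)] S.comp_assoc[OF k(1) h(1) q'(1)] h rk by simp_all
    have "P \<cdot>\<^bsub>Sp\<^esub> (h \<cdot>\<^bsub>Sp\<^esub> k) = P"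
      using S.comp_assoc[OF 1(1) p'(1) x] p'(2) 2(1) by simp
    then have "(P, P, h \<cdot>\<^bsub>Sp\<^esub> k) \<in> Hom (slice Sp B) P P" "(P, P, Ide Sp ?P) \<in> Hom (slice Sp B) P P"
      using 1 P S.comp_ide_right[OF P] by (simp_all add: slice_Hom)
    moreover have "p \<cdot>\<^bsub>slice Sp B\<^esub> (P, P, h \<cdot>\<^bsub>Sp\<^esub> k) = p" "q \<cdot>\<^bsub>slice Sp B\<^esub> (P, P, h \<cdot>\<^bsub>Sp\<^esub> k) = q"
      "p \<cdot>\<^bsub>slice Sp B\<^esub> (P, P, Ide Sp ?P) = p" "q \<cdot>\<^bsub>slice Sp B\<^esub> (P, P, Ide Sp ?P) = q"
      using 2 S.comp_ide_right[OF p'(1)] S.comp_ide_right[OF q'(1)] by (simp_all add: p q slice_Comp)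
    moreover have "P \<in> Obj (slice Sp B)" "p \<in> Hom (slice Sp B) P x" "q \<in> Hom (slice Sp B) P y"
      using pr by (simp_all add: is_binary_product_def)
    ultimately have "(P, P, h \<cdot>\<^bsub>Sp\<^esub> k) = (P, P, Ide Sp ?P)" using uniP[of p P q] by blast
    then show ?thesis by simp
  qed
  have hk_pt: "fn h (fn k c) = c" if "c \<in> pts ?P" for c
    using fn_comp[OF k(1) h(1) that] hk fn_Ide[OF that] by simp
  have rk_pt: "fn (r True) (fn k c) = fn p' c" "fn (r False) (fn k c) = fn q' c" if "c \<in> pts ?P" for c
    using fn_comp[OF k(1) r1 that] fn_comp[OF k(1) r2 that] rk by simp_all
  show "\<exists>c\<in>pts ?P. fn p' c = a \<and> fn q' c = b"
    if "a \<in> pts ?X" "b \<in> pts ?Y" "fn x a = fn y b" for a b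
  proof -
    have "(a, b) \<in> S" using that by (simp add: S_def)
    then obtain l where l: "l \<in> pts L" "\<And>i. fn (r i) l = g i (a, b)" using sp by blast
    have "fn p' (fn h l) = a" "fn q' (fn h l) = b"
      using fn_comp[OF h(1) p'(1) l(1)] fn_comp[OF h(1) q'(1) l(1)] h l(2) by (simp_all add: g_def)
    then show ?thesis using fn_closed[OF h(1) l(1)] by blast
  qed
  show "c = c'" if c: "c \<in> pts ?P" "c' \<in> pts ?P" "fn p' c = fn p' c'" "fn q' c = fn q' c'" for c c'
  proof -
    have "fn (r i) (fn k c) = fn (r i) (fn k c')" for i
      using rk_pt c by (cases i) simp_all
    then have "fn k c = fn k c'" using injL fn_closed[OF k(1)] c by blast
    then show ?thesis using hk_pt c by metis
  qed
  show "plot ?P A \<psi>" if A: "A \<in> Obj D" and \<psi>: "\<psi> \<in> Pt A \<rightarrow> pts ?P"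
    and pl: "plot ?X A (\<lambda>d. fn p' (\<psi> d))" "plot ?Y A (\<lambda>d. fn q' (\<psi> d))" for A \<psi>
  proof -
    have "plot ?X A (\<lambda>d. fn (r True) (fn k (\<psi> d)))"
      by (rule plot_cong[OF A PO(2) pl(1)]) (use rk_pt Pi_mem[OF \<psi>] in simp)
    moreover have "plot ?Y A (\<lambda>d. fn (r False) (fn k (\<psi> d)))"
      by (rule plot_cong[OF A PO(3) pl(2)]) (use rk_pt Pi_mem[OF \<psi>] in simp)
    ultimately have "plot L A (\<lambda>d. fn k (\<psi> d))"
      using fn_closed[OF k(1)] \<psi> by (auto simp: plL[OF A] X_def)
    then have "plot ?P A (\<lambda>d. fn h (fn k (\<psi> d)))" by (rule fn_plot[OF h(1) A])
    then show ?thesis by (rule plot_cong[OF A PO(1)]) (use hk_pt Pi_mem[OF \<psi>] in simp)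
  qed
qed


section \<open>Colimits\<close>

text \<open>The final structure is the intersection of all plot structures on \<open>S\<close> that
  contain the images of the plots of every \<open>X k\<close>. This avoids describing its plots
  explicitly, say as functions that lift locally: a map out of \<open>L\<close> is smooth as soon as
  its inverse image structure is one of those intersected.\<close>

lemma final_lift:
  fixes S :: "'a set" and g :: "'k \<Rightarrow> 'u \<Rightarrow> 'a"
  assumes S: "small U S" and X: "\<And>k. k \<in> K \<Longrightarrow> X k \<in> Obj Sp"
    and g: "\<And>k x. k \<in> K \<Longrightarrow> x \<in> pts (X k) \<Longrightarrow> g k x \<in> S"
  obtains L \<sigma> \<tau> p where "L \<in> Obj Sp"
    and "\<And>s. s \<in> S \<Longrightarrow> \<sigma> s \<in> pts L" and "\<And>s. s \<in> S \<Longrightarrow> \<tau> (\<sigma> s) = s"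
    and "\<And>x. x \<in> pts L \<Longrightarrow> \<tau> x \<in> S" and "\<And>x. x \<in> pts L \<Longrightarrow> \<sigma> (\<tau> x) = x"
    and "\<And>k. k \<in> K \<Longrightarrow> p k \<in> Hom Sp (X k) L"
    and "\<And>k x. k \<in> K \<Longrightarrow> x \<in> pts (X k) \<Longrightarrow> fn (p k) x = \<sigma> (g k x)"
    and "\<And>Z u. Z \<in> Obj Sp \<Longrightarrow> (\<And>s. s \<in> S \<Longrightarrow> u s \<in> pts Z) \<Longrightarrow>
      (\<And>k. k \<in> K \<Longrightarrow> smooth (X k) Z (\<lambda>x. u (g k x))) \<Longrightarrow> smooth L Z (\<lambda>x. u (\<tau> x))"
proof -
  define ok where "ok Q \<longleftrightarrow> plot_structure S Q \<and>
    (\<forall>k\<in>K. \<forall>A\<in>Obj D. \<forall>\<phi>. plot (X k) A \<phi> \<longrightarrow> Q A (\<lambda>d. g k (\<phi> d)))" for Q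
  define P where "P A \<phi> \<longleftrightarrow> \<phi> \<in> Pt A \<rightarrow> S \<and> (\<forall>Q. ok Q \<longrightarrow> Q A \<phi>)" for A \<phi>
  have PQ: "Q A \<phi>" if "ok Q" "P A \<phi>" for Q A \<phi> using that unfolding P_def by blast
  have PI: "P A \<phi>" if "\<phi> \<in> Pt A \<rightarrow> S" "\<And>Q. ok Q \<Longrightarrow> Q A \<phi>" for A \<phi>
    using that unfolding P_def by blast
  have PS: "\<phi> \<in> Pt A \<rightarrow> S" if "P A \<phi>" for A \<phi> using that by (simp add: P_def)
  have okD: "plot_structure S Q" if "ok Q" for Q using that by (simp add: ok_def)
  have "plot_structure S P"
  proof (rule plot_structureI)
    fix A \<phi> \<psi> assume A: "A \<in> Obj D" and P: "P A \<phi>" and eq: "\<And>d. d \<in> Pt A \<Longrightarrow> \<phi> d = \<psi> d"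
    have "Q A \<psi>" if "ok Q" for Q
      by (rule plot_structureD(2)[OF okD[OF that] A PQ[OF that P] eq])
    moreover have "\<psi> \<in> Pt A \<rightarrow> S" using PS[OF P] by (auto simp: eq[symmetric])
    ultimately show "P A \<psi>" by (rule PI[rotated])
  next
    fix A s assume A: "A \<in> Obj D" "s \<in> S"
    have "Q A (\<lambda>_. s)" if "ok Q" for Q by (rule plot_structureD(3)[OF okD[OF that] A])
    then show "P A (\<lambda>_. s)" using A by (intro PI) simp_all
  next
    fix A B h \<phi> assume h: "h \<in> Hom D B A" and P: "P A \<phi>"
    have "Q B (\<lambda>d. \<phi> (h \<cdot> d))" if "ok Q" for Q
      by (rule plot_structureD(4)[OF okD[OF that] h, where \<phi> = \<phi>, OF PQ[OF that P]])
    moreover have "(\<lambda>d. \<phi> (h \<cdot> d)) \<in> Pt B \<rightarrow> S"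
      using PS[OF P] D.comp_closed[OF _ h] by blast
    ultimately show "P B (\<lambda>d. \<phi> (h \<cdot> d))" by (rule PI[rotated])
  next
    fix A I f \<phi> assume A: "A \<in> Obj D" "(I, f) \<in> Cov D A" and \<phi>: "\<phi> \<in> Pt A \<rightarrow> S"
      and P: "\<And>i. i \<in> I \<Longrightarrow> P (Dom D (f i)) (\<lambda>d. \<phi> (f i \<cdot> d))"
    have "Q A \<phi>" if "ok Q" for Q
      by (rule plot_structureD(5)[OF okD[OF that] A \<phi> PQ[OF that P]])
    with \<phi> show "P A \<phi>" by (rule PI)
  qed (simp add: P_def)
  from ex_space[OF S this] obtain L \<sigma> \<tau> where L: "L \<in> Obj Sp"
    and \<sigma>: "\<And>s. s \<in> S \<Longrightarrow> \<sigma> s \<in> pts L" "\<And>s. s \<in> S \<Longrightarrow> \<tau> (\<sigma> s) = s"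
    and \<tau>: "\<And>x. x \<in> pts L \<Longrightarrow> \<tau> x \<in> S" "\<And>x. x \<in> pts L \<Longrightarrow> \<sigma> (\<tau> x) = x"
    and pl: "\<And>A \<psi>. A \<in> Obj D \<Longrightarrow> plot L A \<psi> \<longleftrightarrow> \<psi> \<in> Pt A \<rightarrow> pts L \<and> P A (\<lambda>d. \<tau> (\<psi> d))"
    by blast
  have sm: "smooth (X k) L (\<lambda>x. \<sigma> (g k x))" if k: "k \<in> K" for k
    unfolding smooth_def
  proof (intro conjI ballI allI impI)
    show "(\<lambda>x. \<sigma> (g k x)) \<in> pts (X k) \<rightarrow> pts L" using \<sigma>(1) g k by blast
    fix A \<phi> assume A: "A \<in> Obj D" and \<phi>: "plot (X k) A \<phi>"
    have g\<phi>: "g k (\<phi> d) \<in> S" if "d \<in> Pt A" for d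
      using g[OF k] Pi_mem[OF plotD(1)[OF X[OF k] A \<phi>] that] by simp
    have "Q A (\<lambda>d. \<tau> (\<sigma> (g k (\<phi> d))))" if "ok Q" for Q
      by (rule plot_structureD(2)[OF okD[OF that] A, where \<phi> = "\<lambda>d. g k (\<phi> d)"])
        (use that k A \<phi> \<sigma>(2)[OF g\<phi>] in \<open>auto simp: ok_def\<close>)
    moreover have "(\<lambda>d. \<tau> (\<sigma> (g k (\<phi> d)))) \<in> Pt A \<rightarrow> S" using \<tau>(1) \<sigma>(1) g\<phi> by simp
    ultimately have "P A (\<lambda>d. \<tau> (\<sigma> (g k (\<phi> d))))" by (rule PI[rotated])
    then show "plot L A (\<lambda>d. \<sigma> (g k (\<phi> d)))" using pl[OF A] \<sigma>(1) g\<phi> by simp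
  qed
  have "\<forall>k\<in>K. \<exists>p. p \<in> Hom Sp (X k) L \<and> (\<forall>x\<in>pts (X k). fn p x = \<sigma> (g k x))"
    using ex_arr[OF X L sm] by metis
  then obtain p where p: "\<And>k. k \<in> K \<Longrightarrow> p k \<in> Hom Sp (X k) L"
    "\<And>k x. k \<in> K \<Longrightarrow> x \<in> pts (X k) \<Longrightarrow> fn (p k) x = \<sigma> (g k x)" by metis
  have fin: "smooth L Z (\<lambda>x. u (\<tau> x))"
    if Z: "Z \<in> Obj Sp" and u: "\<And>s. s \<in> S \<Longrightarrow> u s \<in> pts Z"
      and ug: "\<And>k. k \<in> K \<Longrightarrow> smooth (X k) Z (\<lambda>x. u (g k x))" for Z u
  proof -
    \<comment> \<open>The functions that \<open>u\<close> turns into plots of \<open>Z\<close>. This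
      structure satisfies \<open>ok\<close>, hence contains \<open>P\<close>.\<close>
    define Q where "Q A \<phi> \<longleftrightarrow> \<phi> \<in> Pt A \<rightarrow> S \<and> plot Z A (\<lambda>d. u (\<phi> d))" for A \<phi>
    have "plot_structure S Q"
      using initial_structure[of "{()}" "\<lambda>_. Z" S "\<lambda>_. u"] Z u by (simp add: Q_def[abs_def])
    moreover have "Q A (\<lambda>d. g k (\<phi> d))" if "k \<in> K" "A \<in> Obj D" "plot (X k) A \<phi>" for k A \<phi>
      using ug[OF that(1)] that(2,3) g[OF that(1)] Pi_mem[OF plotD(1)[OF X[OF that(1)] that(2,3)]]
      by (simp add: Q_def smooth_def)
    ultimately have ok: "ok Q" by (simp add: ok_def)
    have "plot Z A (\<lambda>d. u (\<tau> (\<psi> d)))" if "A \<in> Obj D" "plot L A \<psi>" for A \<psi>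
      using PQ[OF ok conjunct2[OF iffD1[OF pl[OF that(1)] that(2)]]] by (simp add: Q_def)
    then show ?thesis using u \<tau>(1) by (simp add: smooth_def)
  qed
  show ?thesis by (rule that[OF L \<sigma> \<tau> p fin])
qed

lemma colimits:
  fixes J :: "('j, 'k, 'y) cat_scheme"
  assumes small: "small U (Obj J)"
  shows "has_colimits_of_shape J Sp"
  unfolding has_colimits_of_shape_def
proof (intro allI impI)
  fix F :: "('j, 'k, ('o, 'm, 'u) presheaf, ('o, 'm, 'u) presheaf_arr) fctr"
  assume F: "is_functor J Sp F"
  note FH = functor_Hom[OF F]
  have FO: "OMap F j \<in> Obj Sp" if "j \<in> Obj J" for j using F that by (simp add: is_functor_def)
  define Sig where "Sig = (SIGMA j:Obj J. pts (OMap F j))"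
  have Sig: "(j, x) \<in> Sig \<longleftrightarrow> j \<in> Obj J \<and> x \<in> pts (OMap F j)" for j x by (simp add: Sig_def)
  \<comment> \<open>The equivalence relation generated by \<open>(j, x) \<sim> (j', F u x)\<close> identifies two points if
    they lie in the same saturated sets.\<close>
  define sat where "sat T \<longleftrightarrow> (\<forall>u\<in>Arr J. \<forall>x\<in>pts (OMap F (Dom J u)).
      (Dom J u, x) \<in> T \<longleftrightarrow> (Cod J u, fn (AMap F u) x) \<in> T)" for T
  define cls where "cls s = {t \<in> Sig. \<forall>T. sat T \<longrightarrow> (s \<in> T \<longleftrightarrow> t \<in> T)}" for s
  have cls_self: "s \<in> cls s" if "s \<in> Sig" for s using that by (simp add: cls_def)
  have glue: "cls (Dom J u, x) = cls (Cod J u, fn (AMap F u) x)"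
    if "u \<in> Arr J" "x \<in> pts (OMap F (Dom J u))" for u x
    using that unfolding cls_def sat_def by blast
  define S where "S = cls ` Sig"
  have "small U Sig" unfolding Sig_def by (rule small_Sigma[OF universe small small_pts[OF FO]])
  then have sm: "small U S" unfolding S_def by (rule small_image)
  define g where "g j x = cls (j, x)" for j x
  have g: "g j x \<in> S" if "j \<in> Obj J" "x \<in> pts (OMap F j)" for j x
    using that by (simp add: g_def S_def Sig)
  obtain L \<sigma> \<tau> p where L: "L \<in> Obj Sp"
    and \<sigma>: "\<And>s. s \<in> S \<Longrightarrow> \<sigma> s \<in> pts L" "\<And>s. s \<in> S \<Longrightarrow> \<tau> (\<sigma> s) = s"
    and \<tau>: "\<And>x. x \<in> pts L \<Longrightarrow> \<tau> x \<in> S" "\<And>x. x \<in> pts L \<Longrightarrow> \<sigma> (\<tau> x) = x"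
    and p: "\<And>j. j \<in> Obj J \<Longrightarrow> p j \<in> Hom Sp (OMap F j) L"
      "\<And>j x. j \<in> Obj J \<Longrightarrow> x \<in> pts (OMap F j) \<Longrightarrow> fn (p j) x = \<sigma> (g j x)"
    and fin: "\<And>Z u. Z \<in> Obj Sp \<Longrightarrow> (\<And>s. s \<in> S \<Longrightarrow> u s \<in> pts Z) \<Longrightarrow>
      (\<And>j. j \<in> Obj J \<Longrightarrow> smooth (OMap F j) Z (\<lambda>x. u (g j x))) \<Longrightarrow> smooth L Z (\<lambda>x. u (\<tau> x))"
    by (rule final_lift[of S "Obj J" "OMap F" g, OF sm FO g]) blast+
  have "p (Cod J u) \<cdot>\<^bsub>Sp\<^esub> AMap F u = p (Dom J u)" if u: "u \<in> Arr J" for u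
  proof (rule Sp_arr_eqI[OF S.comp_closed[OF FH(1)[OF u] p(1)[OF FH(5)[OF u]]] p(1)[OF FH(4)[OF u]]])
    fix x assume x: "x \<in> pts (OMap F (Dom J u))"
    show "fn (p (Cod J u) \<cdot>\<^bsub>Sp\<^esub> AMap F u) x = fn (p (Dom J u)) x"
      using fn_comp[OF FH(1)[OF u] p(1)[OF FH(5)[OF u]] x] p(2)[OF FH(4)[OF u] x]
        p(2)[OF FH(5)[OF u] fn_closed[OF FH(1)[OF u] x]] glue[OF u x]
      by (simp add: g_def)
  qed
  then have "is_cocone J Sp F L p" using L p(1) by (simp add: is_cocone_def)
  moreover have "\<exists>!h. h \<in> Hom Sp L M \<and> (\<forall>j\<in>Obj J. h \<cdot>\<^bsub>Sp\<^esub> p j = \<mu> j)"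
    if c: "is_cocone J Sp F M \<mu>" for M \<mu>
  proof -
    from c have M: "M \<in> Obj Sp" and m: "\<And>j. j \<in> Obj J \<Longrightarrow> \<mu> j \<in> Hom Sp (OMap F j) M"
      and mu: "\<And>u. u \<in> Arr J \<Longrightarrow> \<mu> (Cod J u) \<cdot>\<^bsub>Sp\<^esub> AMap F u = \<mu> (Dom J u)"
      by (simp_all add: is_cocone_def)
    define f where "f s = fn (\<mu> (fst s)) (snd s)" for s
    have f_cls: "f s = f t" if "s \<in> Sig" "t \<in> Sig" "cls s = cls t" for s t
    proof -
      \<comment> \<open>The cocone equations make each level set of \<open>f\<close> saturated, so
        \<open>f\<close> is constant on classes.\<close>
      have sat: "sat {r. f r = f s}"
        unfolding sat_def
      proof (intro ballI)
        fix u x assume u: "u \<in> Arr J" and x: "x \<in> pts (OMap F (Dom J u))"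
        have "f (Dom J u, x) = f (Cod J u, fn (AMap F u) x)"
          using fn_comp[OF FH(1)[OF u] m[OF FH(5)[OF u]] x] mu[OF u] by (simp add: f_def)
        then show "(Dom J u, x) \<in> {r. f r = f s} \<longleftrightarrow> (Cod J u, fn (AMap F u) x) \<in> {r. f r = f s}"
          by simp
      qed
      have "t \<in> cls s" using cls_self[OF that(2)] that(3) by simp
      then have "\<forall>T. sat T \<longrightarrow> (s \<in> T \<longleftrightarrow> t \<in> T)" unfolding cls_def by simp
      with sat have "s \<in> {r. f r = f s} \<longleftrightarrow> t \<in> {r. f r = f s}" by blast
      then show ?thesis by simp
    qed
    define u where "u c = f (inv_into Sig cls c)" for c
    have u: "u (cls s) = f s" if "s \<in> Sig" for s
      using f_cls[of "inv_into Sig cls (cls s)" s] that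
      by (simp add: u_def inv_into_into f_inv_into_f)
    have ug: "u (g j x) = fn (\<mu> j) x" if "j \<in> Obj J" "x \<in> pts (OMap F j)" for j x
      using u[of "(j, x)"] that by (simp add: Sig g_def f_def)
    have "smooth L M (\<lambda>x. u (\<tau> x))"
    proof (rule fin[OF M])
      show "u s \<in> pts M" if "s \<in> S" for s
        using that ug fn_closed[OF m] by (auto simp: S_def Sig_def g_def)
      fix j assume j: "j \<in> Obj J"
      have "plot M A (\<lambda>d. u (g j (\<phi> d)))" if A: "A \<in> Obj D" and \<phi>: "plot (OMap F j) A \<phi>" for A \<phi>
        by (rule plot_cong[OF A M fn_plot[OF m[OF j] A \<phi>]])
          (use ug[OF j] Pi_mem[OF plotD(1)[OF FO[OF j] A \<phi>]] in simp)
      then show "smooth (OMap F j) M (\<lambda>x. u (g j x))"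
        using ug[OF j] fn_closed[OF m[OF j]] by (simp add: smooth_def)
    qed
    then obtain h where h: "h \<in> Hom Sp L M" "\<And>x. x \<in> pts L \<Longrightarrow> fn h x = u (\<tau> x)"
      using ex_arr[OF L M] by blast
    have "h \<cdot>\<^bsub>Sp\<^esub> p j = \<mu> j" if j: "j \<in> Obj J" for j
      by (rule Sp_arr_eqI[OF S.comp_closed[OF p(1)[OF j] h(1)] m[OF j]])
        (simp add: fn_comp[OF p(1)[OF j] h(1)] p(2)[OF j] h(2) \<sigma> g[OF j] ug[OF j])
    \<comment> \<open>Every point of \<open>L\<close> is the class of some \<open>(j, y)\<close>, so
      the maps \<open>p j\<close> jointly cover the points and determine the morphism.\<close>
    moreover have "h' = h" if h': "h' \<in> Hom Sp L M" "\<forall>j\<in>Obj J. h' \<cdot>\<^bsub>Sp\<^esub> p j = \<mu> j" for h'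
    proof (rule Sp_arr_eqI[OF h'(1) h(1)])
      fix x assume x: "x \<in> pts L"
      then obtain j y where j: "j \<in> Obj J" "y \<in> pts (OMap F j)" "\<tau> x = g j y"
        using \<tau>(1)[OF x] by (auto simp: S_def Sig_def g_def)
      then have "x = fn (p j) y" using p(2) \<tau>(2)[OF x] by simp
      then show "fn h' x = fn h x"
        using fn_comp[OF p(1)[OF j(1)] h'(1) j(2)] h'(2) j h(2)[OF x] ug by simp
    qed
    ultimately show ?thesis using h(1) by blast
  qed
  ultimately show "\<exists>L \<iota>. is_colimit J Sp F L \<iota>" unfolding is_colimit_def by blast
qed


section \<open>The weak subobject classifier\<close>

lemma ex_terminal:
  obtains T t where "is_terminal Sp T" "pts T = {t}"
proof -
  have sm: "small U {()}" by (rule small_finite[OF universe]) simp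
  \<comment> \<open>A one-element carrier with an empty family of maps; each
    \<open>undefined\<close> stands in for data indexed by the empty set.\<close>
  obtain T and p :: "unit \<Rightarrow> ('o, 'm, 'u) presheaf_arr" where T: "T \<in> Obj Sp"
    and ex: "\<And>s. s \<in> {()} \<Longrightarrow> \<exists>x\<in>pts T. \<forall>k\<in>{}. fn (p k) x = undefined"
    and inj: "\<And>x y. x \<in> pts T \<Longrightarrow> y \<in> pts T \<Longrightarrow> (\<And>k. k \<in> {} \<Longrightarrow> fn (p k) x = fn (p k) y) \<Longrightarrow> x = y"
    and uni: "\<And>Q q. Q \<in> Obj Sp \<Longrightarrow> (\<And>k. k \<in> {} \<Longrightarrow> q k \<in> Hom Sp Q undefined) \<Longrightarrow>
      (\<And>z. z \<in> pts Q \<Longrightarrow> \<exists>s\<in>{()}. \<forall>k\<in>{}. fn (q k) z = undefined) \<Longrightarrow>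
      \<exists>!h. h \<in> Hom Sp Q T \<and> (\<forall>k\<in>{}. p k \<cdot>\<^bsub>Sp\<^esub> h = q k)"
    by (rule joint_lift[of "{()}" "{} :: unit set" "\<lambda>_. undefined" "\<lambda>_ _. undefined", OF sm]) blast+
  obtain t where "t \<in> pts T" using ex[of "()"] by blast
  then have "pts T = {t}" using inj by blast
  moreover have "is_terminal Sp T"
    unfolding is_terminal_def using T uni[of _ undefined] by simp
  ultimately show ?thesis using that by blast
qed

text \<open>With \<open>Z\<close> terminal this turns a point into a morphism. It yields
  \<open>tr\<close> and the test maps for uniqueness of the classifying morphism.\<close>

lemma ex_const:
  assumes "Z \<in> Obj Sp" "X \<in> Obj Sp" "x \<in> pts X"
  obtains f where "f \<in> Hom Sp Z X" "\<And>z. z \<in> pts Z \<Longrightarrow> fn f z = x"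
  using ex_arr[OF assms(1,2), of "\<lambda>_. x"] assms(3) plotD(3)[OF assms(2)]
  by (auto simp: smooth_def)

lemma surj_epi:
  assumes h: "h \<in> Hom Sp X Y" and surj: "\<And>y. y \<in> pts Y \<Longrightarrow> \<exists>x\<in>pts X. fn h x = y"
  shows "is_epi Sp h"
  unfolding is_epi_def
proof (intro conjI ballI impI)
  show "h \<in> Arr Sp" using h by (simp add: Hom_def)
  fix Z f g assume "f \<in> Hom Sp (Cod Sp h) Z" "g \<in> Hom Sp (Cod Sp h) Z" and eq: "f \<cdot>\<^bsub>Sp\<^esub> h = g \<cdot>\<^bsub>Sp\<^esub> h"
  then have f: "f \<in> Hom Sp Y Z" and g: "g \<in> Hom Sp Y Z" using HomD(3)[OF h] by simp_all
  show "f = g"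
  proof (rule Sp_arr_eqI[OF f g])
    fix y assume "y \<in> pts Y"
    then obtain x where "x \<in> pts X" "fn h x = y" using surj by blast
    then show "fn f y = fn g y" using fn_comp[OF h f] fn_comp[OF h g] eq by metis
  qed
qed

text \<open>Lift the surjection of \<open>X\<close> onto its image, which carries the subspace structure, against
  the strong monomorphism.\<close>

lemma strong_mono_plot:
  assumes sm: "is_strong_mono Sp i" and i: "i \<in> Hom Sp X Y"
    and A: "A \<in> Obj D" and \<psi>: "\<psi> \<in> Pt A \<rightarrow> pts X" and i\<psi>: "plot Y A (\<lambda>d. fn i (\<psi> d))"
  shows "plot X A \<psi>"
proof -
  have X: "X \<in> Obj Sp" and Y: "Y \<in> Obj Sp" using i S.Hom_Obj by blast+
  define S where "S = fn i ` pts X"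
  have S: "small U S" unfolding S_def by (rule small_image[OF small_pts[OF X]])
  have SY: "s \<in> pts Y" if "s \<in> S" for s using that fn_closed[OF i] by (auto simp: S_def)
  obtain L p where L: "L \<in> Obj Sp" and "\<And>k. k \<in> {()} \<Longrightarrow> p k \<in> Hom Sp L Y"
    and pS: "\<And>x. x \<in> pts L \<Longrightarrow> \<exists>s\<in>S. \<forall>k\<in>{()}. fn (p k) x = s"
    and inj: "\<And>x y. x \<in> pts L \<Longrightarrow> y \<in> pts L \<Longrightarrow> (\<And>k. k \<in> {()} \<Longrightarrow> fn (p k) x = fn (p k) y) \<Longrightarrow> x = y"
    and plL: "\<And>A \<psi>. A \<in> Obj D \<Longrightarrow>
      plot L A \<psi> \<longleftrightarrow> \<psi> \<in> Pt A \<rightarrow> pts L \<and> (\<forall>k\<in>{()}. plot Y A (\<lambda>d. fn (p k) (\<psi> d)))"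
    and uni: "\<And>Q q. Q \<in> Obj Sp \<Longrightarrow> (\<And>k. k \<in> {()} \<Longrightarrow> q k \<in> Hom Sp Q Y) \<Longrightarrow>
      (\<And>z. z \<in> pts Q \<Longrightarrow> \<exists>s\<in>S. \<forall>k\<in>{()}. fn (q k) z = s) \<Longrightarrow>
      \<exists>!h. h \<in> Hom Sp Q L \<and> (\<forall>k\<in>{()}. p k \<cdot>\<^bsub>Sp\<^esub> h = q k)"
    by (rule joint_lift[of S "{()}" "\<lambda>_. Y" "\<lambda>_ s. s", OF S Y SY]) blast+
  then have p: "p () \<in> Hom Sp L Y" by simp
  have "\<exists>!h. h \<in> Hom Sp X L \<and> (\<forall>k\<in>{()}. p k \<cdot>\<^bsub>Sp\<^esub> h = i)"
    using i by (intro uni X) (simp_all add: S_def)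
  then obtain h where h: "h \<in> Hom Sp X L" "p () \<cdot>\<^bsub>Sp\<^esub> h = i" by blast
  have ph: "fn (p ()) (fn h x) = fn i x" if "x \<in> pts X" for x
    using fn_comp[OF h(1) p that] h(2) by simp
  have "is_epi Sp h"
  proof (rule surj_epi[OF h(1)])
    fix y assume y: "y \<in> pts L"
    then obtain x where x: "x \<in> pts X" "fn (p ()) y = fn i x" using pS by (auto simp: S_def)
    then have "fn h x = y" using inj[OF fn_closed[OF h(1) x(1)] y] ph by simp
    then show "\<exists>x\<in>pts X. fn h x = y" using x by blast
  qed
  moreover have "Ide Sp X \<in> Hom Sp X X" by (rule S.ide_closed[OF X])
  moreover have "i \<cdot>\<^bsub>Sp\<^esub> Ide Sp X = p () \<cdot>\<^bsub>Sp\<^esub> h" using S.comp_ide_right[OF i] h(2) by simp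
  ultimately have "\<exists>t. t \<in> Hom Sp L X \<and> t \<cdot>\<^bsub>Sp\<^esub> h = Ide Sp X"
    using sm p HomD[OF h(1)] HomD[OF i] unfolding is_strong_mono_def by metis
  then obtain t where t: "t \<in> Hom Sp L X" "t \<cdot>\<^bsub>Sp\<^esub> h = Ide Sp X" by blast
  \<comment> \<open>The diagonal \<open>t\<close> is a left inverse of \<open>h\<close>. Hence it
    suffices that \<open>h\<close> after \<psi> is a plot of the image, and this is tested in
    \<open>Y\<close>; applying \<open>t\<close> gives \<psi> back.\<close>
  have "plot Y A (\<lambda>d. fn (p ()) (fn h (\<psi> d)))"
    by (rule plot_cong[OF A Y i\<psi>]) (use ph Pi_mem[OF \<psi>] in simp)
  then have "plot L A (\<lambda>d. fn h (\<psi> d))"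
    using plL[OF A] fn_closed[OF h(1)] Pi_mem[OF \<psi>] by simp
  then have "plot X A (\<lambda>d. fn t (fn h (\<psi> d)))" by (rule fn_plot[OF t(1) A])
  then show ?thesis
    by (rule plot_cong[OF A X]) (use fn_comp[OF h(1) t(1)] t(2) fn_Ide Pi_mem[OF \<psi>] in metis)
qed

text \<open>Every predicate on points is smooth as a map to \<Omega>, so the characteristic function
  of the image of \<open>i\<close> is a morphism. A test map landing in the image lifts on points,
  and \<open>strong_mono_plot\<close> makes the lift smooth. For uniqueness, the pullback property
  tested on the terminal object identifies the points sent to truth.\<close>

lemma weak_subobject_classifier:
  "\<exists>T \<Omega> tr. is_weak_subobject_classifier Sp T \<Omega> tr"
proof -
  obtain T t where T: "is_terminal Sp T" and t: "pts T = {t}" using ex_terminal .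
  have TO: "T \<in> Obj Sp" using T by (simp add: is_terminal_def)
  have T1: "\<exists>!f. f \<in> Hom Sp Z T" if "Z \<in> Obj Sp" for Z using T that by (simp add: is_terminal_def)
  have "plot_structure (UNIV :: bool set) (\<lambda>A \<phi>. True)" by (rule plot_structureI) simp_all
  then obtain \<Omega> and \<sigma> :: "bool \<Rightarrow> 'u" and \<tau> where O: "\<Omega> \<in> Obj Sp"
    and "\<And>s. s \<in> UNIV \<Longrightarrow> \<sigma> s \<in> pts \<Omega>" "\<And>s. s \<in> UNIV \<Longrightarrow> \<tau> (\<sigma> s) = s"
    and "\<And>x. x \<in> pts \<Omega> \<Longrightarrow> \<tau> x \<in> UNIV"
    and \<tau>: "\<And>x. x \<in> pts \<Omega> \<Longrightarrow> \<sigma> (\<tau> x) = x"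
    and "\<And>A \<psi>. A \<in> Obj D \<Longrightarrow> plot \<Omega> A \<psi> \<longleftrightarrow> \<psi> \<in> Pt A \<rightarrow> pts \<Omega> \<and> True"
    by (rule ex_space[OF small_finite[OF universe finite]]) blast
  then have \<sigma>: "\<And>s. \<sigma> s \<in> pts \<Omega>" "\<And>s :: bool. \<tau> (\<sigma> s) = s"
    and pl: "\<And>A \<psi>. A \<in> Obj D \<Longrightarrow> plot \<Omega> A \<psi> \<longleftrightarrow> \<psi> \<in> Pt A \<rightarrow> pts \<Omega>"
    by blast+
  obtain tr where tr: "tr \<in> Hom Sp T \<Omega>" "fn tr t = \<sigma> True"
    using ex_const[OF TO O \<sigma>(1)] t by blast
  have "\<exists>!\<chi>. \<chi> \<in> Hom Sp (Cod Sp i) \<Omega> \<and>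
      is_pullback Sp \<chi> tr i (THE b. b \<in> Hom Sp (Dom Sp i) T)" if sm: "is_strong_mono Sp i" for i
  proof -
    define X Y where "X = Dom Sp i" and "Y = Cod Sp i"
    have mono: "is_mono Sp i" using sm by (simp add: is_strong_mono_def)
    then have i: "i \<in> Hom Sp X Y" by (simp add: is_mono_def X_def Y_def Hom_def)
    have X: "X \<in> Obj Sp" and Y: "Y \<in> Obj Sp" using i S.Hom_Obj by blast+
    define b where "b = (THE b. b \<in> Hom Sp X T)"
    have b: "b \<in> Hom Sp X T" unfolding b_def by (rule theI'[OF T1[OF X]])
    \<comment> \<open>The truth value is encoded by \<sigma>, since \<Omega> has its points in
      \<open>'u\<close>.\<close>
    have "smooth Y \<Omega> (\<lambda>y. \<sigma> (y \<in> fn i ` pts X))" using \<sigma>(1) pl by (simp add: smooth_def)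
    then obtain \<chi> where \<chi>: "\<chi> \<in> Hom Sp Y \<Omega>"
      and f\<chi>: "\<And>y. y \<in> pts Y \<Longrightarrow> fn \<chi> y = \<sigma> (y \<in> fn i ` pts X)"
      using ex_arr[OF Y O] by blast
    have ftr: "fn tr z = \<sigma> True" if "z \<in> pts T" for z using tr(2) t that by simp
    have comm: "\<chi> \<cdot>\<^bsub>Sp\<^esub> i = tr \<cdot>\<^bsub>Sp\<^esub> b"
      by (rule Sp_arr_eqI[OF S.comp_closed[OF i \<chi>] S.comp_closed[OF b tr(1)]])
        (use fn_comp[OF i \<chi>] fn_comp[OF b tr(1)] f\<chi> fn_closed[OF i] fn_closed[OF b] ftr in simp)
    have "\<exists>!h. h \<in> Hom Sp Q X \<and> i \<cdot>\<^bsub>Sp\<^esub> h = a \<and> b \<cdot>\<^bsub>Sp\<^esub> h = c"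
      if Q: "Q \<in> Obj Sp" and a: "a \<in> Hom Sp Q Y" and c: "c \<in> Hom Sp Q T"
        and eq: "\<chi> \<cdot>\<^bsub>Sp\<^esub> a = tr \<cdot>\<^bsub>Sp\<^esub> c" for Q a c
    proof -
      have "fn a z \<in> fn i ` pts X" if z: "z \<in> pts Q" for z
      proof -
        have "\<sigma> (fn a z \<in> fn i ` pts X) = \<sigma> True"
          using fn_comp[OF a \<chi> z] fn_comp[OF c tr(1) z] eq f\<chi>[OF fn_closed[OF a z]]
            ftr[OF fn_closed[OF c z]] by simp
        then show ?thesis using \<sigma>(2) by metis
      qed
      then have "\<forall>z\<in>pts Q. \<exists>x. x \<in> pts X \<and> fn i x = fn a z" by fastforce
      then obtain v where v: "\<And>z. z \<in> pts Q \<Longrightarrow> v z \<in> pts X" "\<And>z. z \<in> pts Q \<Longrightarrow> fn i (v z) = fn a z"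
        by metis
      have "smooth Q X v"
        unfolding smooth_def
      proof (intro conjI ballI allI impI)
        show "v \<in> pts Q \<rightarrow> pts X" using v by blast
        fix A \<phi> assume A: "A \<in> Obj D" and \<phi>: "plot Q A \<phi>"
        note \<phi>Q = Pi_mem[OF plotD(1)[OF Q A \<phi>]]
        have "plot Y A (\<lambda>d. fn i (v (\<phi> d)))"
          by (rule plot_cong[OF A Y fn_plot[OF a A \<phi>]]) (use v \<phi>Q in simp)
        then show "plot X A (\<lambda>d. v (\<phi> d))"
          using strong_mono_plot[OF sm i A] v \<phi>Q by simp
      qed
      then obtain h where h: "h \<in> Hom Sp Q X" "\<And>z. z \<in> pts Q \<Longrightarrow> fn h z = v z"
        using ex_arr[OF Q X] by blast
      have "i \<cdot>\<^bsub>Sp\<^esub> h = a"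
        by (rule Sp_arr_eqI[OF S.comp_closed[OF h(1) i] a]) (use fn_comp[OF h(1) i] h v in simp)
      moreover have "b \<cdot>\<^bsub>Sp\<^esub> h = c" using T1[OF Q] S.comp_closed[OF h(1) b] c by blast
      moreover have "h' = h" if h': "h' \<in> Hom Sp Q X" "i \<cdot>\<^bsub>Sp\<^esub> h' = a" for h'
        using mono h(1) h' \<open>i \<cdot>\<^bsub>Sp\<^esub> h = a\<close> Q unfolding is_mono_def X_def by metis
      ultimately show ?thesis using h(1) by blast
    qed
    then have "is_pullback Sp \<chi> tr i b"
      using HomD[OF \<chi>] HomD[OF tr(1)] HomD[OF i] HomD[OF b] comm by (simp add: is_pullback_def)
    \<comment> \<open>As \<Omega> has only two points, it is enough to show that
      \<chi>\<open>'\<close> takes the value \<sigma>\<open>True\<close> precisely on the image of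
      \<open>i\<close>.\<close>
    moreover have "\<chi>' = \<chi>" if \<chi>': "\<chi>' \<in> Hom Sp Y \<Omega>" and pb: "is_pullback Sp \<chi>' tr i b" for \<chi>'
    proof (rule Sp_arr_eqI[OF \<chi>' \<chi>])
      fix y assume y: "y \<in> pts Y"
      have "fn \<chi>' y = \<sigma> True" if img: "y \<in> fn i ` pts X"
      proof -
        obtain x where x: "x \<in> pts X" "y = fn i x" using img by blast
        have "\<chi>' \<cdot>\<^bsub>Sp\<^esub> i = tr \<cdot>\<^bsub>Sp\<^esub> b" using pb by (simp add: is_pullback_def)
        then show ?thesis
          using fn_comp[OF i \<chi>' x(1)] fn_comp[OF b tr(1) x(1)] ftr[OF fn_closed[OF b x(1)]] x(2) by simp
      qed
      moreover have "y \<in> fn i ` pts X" if tru: "fn \<chi>' y = \<sigma> True"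
      proof -
        \<comment> \<open>The point \<open>y\<close> as a morphism from \<open>T\<close>; the
          pullback lifts it to a point of \<open>X\<close> above \<open>y\<close>.\<close>
        obtain a where a: "a \<in> Hom Sp T Y" "\<And>z. z \<in> pts T \<Longrightarrow> fn a z = y" using ex_const[OF TO Y y] by blast
        have I: "Ide Sp T \<in> Hom Sp T T" by (rule S.ide_closed[OF TO])
        have "\<chi>' \<cdot>\<^bsub>Sp\<^esub> a = tr \<cdot>\<^bsub>Sp\<^esub> Ide Sp T"
          by (rule Sp_arr_eqI[OF S.comp_closed[OF a(1) \<chi>'] S.comp_closed[OF I tr(1)]])
            (use fn_comp[OF a(1) \<chi>'] fn_comp[OF I tr(1)] a(2) tru ftr fn_Ide in simp)
        then obtain h where h: "h \<in> Hom Sp T X" "i \<cdot>\<^bsub>Sp\<^esub> h = a"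
          using pb TO a(1) I HomD[OF \<chi>'] HomD[OF tr(1)] HomD[OF i] unfolding is_pullback_def by metis
        have "y = fn i (fn h t)" using fn_comp[OF h(1) i, of t] h(2) a(2) t by simp
        then show ?thesis using fn_closed[OF h(1)] t by blast
      qed
      ultimately show "fn \<chi>' y = fn \<chi> y"
        using f\<chi>[OF y] \<tau>[OF fn_closed[OF \<chi>' y]] by (metis (full_types))
    qed
    ultimately show ?thesis using \<chi> unfolding X_def Y_def b_def by blast
  qed
  then show ?thesis using T O tr(1) unfolding is_weak_subobject_classifier_def by blast
qed


section \<open>Exponentials over a base\<close>

text \<open>\<open>k\<close> is a smooth map from the fibre product of \<open>r\<close> and \<open>y\<close> to \<open>Z\<close> over the common base, in
  curried form.\<close>

definition smooth_over ::
  "('o, 'm, 'u) presheaf \<Rightarrow> ('o, 'm, 'u) presheaf_arr \<Rightarrow> ('o, 'm, 'u) presheaf \<Rightarrow>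
   ('o, 'm, 'u) presheaf_arr \<Rightarrow> ('o, 'm, 'u) presheaf \<Rightarrow> ('o, 'm, 'u) presheaf_arr \<Rightarrow>
   ('u \<Rightarrow> 'u \<Rightarrow> 'u) \<Rightarrow> bool" where
  "smooth_over X r Y y Z z k \<longleftrightarrow>
     (\<forall>a\<in>pts X. \<forall>c\<in>pts Y. fn y c = fn r a \<longrightarrow> k a c \<in> pts Z \<and> fn z (k a c) = fn r a) \<and>
     (\<forall>A\<in>Obj D. \<forall>\<phi> \<psi>. plot X A \<phi> \<longrightarrow> plot Y A \<psi> \<longrightarrow>
        (\<forall>d\<in>Pt A. fn y (\<psi> d) = fn r (\<phi> d)) \<longrightarrow> plot Z A (\<lambda>d. k (\<phi> d) (\<psi> d)))"

lemma smooth_overI: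
  assumes "\<And>a c. a \<in> pts X \<Longrightarrow> c \<in> pts Y \<Longrightarrow> fn y c = fn r a \<Longrightarrow>
      k a c \<in> pts Z \<and> fn z (k a c) = fn r a"
    and "\<And>A \<phi> \<psi>. A \<in> Obj D \<Longrightarrow> plot X A \<phi> \<Longrightarrow> plot Y A \<psi> \<Longrightarrow>
      (\<And>d. d \<in> Pt A \<Longrightarrow> fn y (\<psi> d) = fn r (\<phi> d)) \<Longrightarrow> plot Z A (\<lambda>d. k (\<phi> d) (\<psi> d))"
  shows "smooth_over X r Y y Z z k"
  unfolding smooth_over_def using assms by blast

lemma smooth_overD:
  assumes "smooth_over X r Y y Z z k"
  shows "a \<in> pts X \<Longrightarrow> c \<in> pts Y \<Longrightarrow> fn y c = fn r a \<Longrightarrow> k a c \<in> pts Z \<and> fn z (k a c) = fn r a"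
    and "A \<in> Obj D \<Longrightarrow> plot X A \<phi> \<Longrightarrow> plot Y A \<psi> \<Longrightarrow>
      (\<And>d. d \<in> Pt A \<Longrightarrow> fn y (\<psi> d) = fn r (\<phi> d)) \<Longrightarrow> plot Z A (\<lambda>d. k (\<phi> d) (\<psi> d))"
  using assms unfolding smooth_over_def by blast+

text \<open>A point of the exponential over \<open>b\<close> is a smooth map from the fibre of \<open>Y\<close> over \<open>b\<close> to the
  fibre of \<open>Z\<close> over \<open>b\<close>; \<open>app\<close> is its evaluation.\<close>

lemma ex_exponential:
  assumes y: "y \<in> Hom Sp Y B" and z: "z \<in> Hom Sp Z B"
  obtains E e app where "e \<in> Hom Sp E B"
    and "smooth_over E e Y y Z z app"
    and "\<And>x x'. x \<in> pts E \<Longrightarrow> x' \<in> pts E \<Longrightarrow> fn e x = fn e x' \<Longrightarrow>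
      (\<And>c. c \<in> pts Y \<Longrightarrow> fn y c = fn e x \<Longrightarrow> app x c = app x' c) \<Longrightarrow> x = x'"
    and "\<And>X r k. r \<in> Hom Sp X B \<Longrightarrow> smooth_over X r Y y Z z k \<Longrightarrow>
      \<exists>m. m \<in> Hom Sp X E \<and> e \<cdot>\<^bsub>Sp\<^esub> m = r \<and>
        (\<forall>a\<in>pts X. \<forall>c\<in>pts Y. fn y c = fn r a \<longrightarrow> app (fn m a) c = k a c)"
proof -
  have B: "B \<in> Obj Sp" and Y: "Y \<in> Obj Sp" and Z: "Z \<in> Obj Sp" using y z S.Hom_Obj by blast+
  define fib where "fib b = {c \<in> pts Y. fn y c = b}" for b
  \<comment> \<open>A plot of the fibre is a plot of \<open>Y\<close> lying over the constant
    \<open>b\<close>, so smoothness on the fibre is stated without building the fibre as a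
    space.\<close>
  define sec where "sec b u \<longleftrightarrow> (\<forall>c\<in>fib b. fn z (u c) = b) \<and>
    (\<forall>A\<in>Obj D. \<forall>\<psi>. plot Y A \<psi> \<longrightarrow> (\<forall>d\<in>Pt A. fn y (\<psi> d) = b) \<longrightarrow> plot Z A (\<lambda>d. u (\<psi> d)))" for b u
  \<comment> \<open>The base point is stored with the map, since fibres over different points may be
    equal as sets, for instance empty. Extensionality makes the map determined by its values on the
    fibre.\<close>
  define S where "S = {(b, u). b \<in> pts B \<and> u \<in> fib b \<rightarrow>\<^sub>E pts Z \<and> sec b u}"
  have S_Z: "snd s c \<in> pts Z" "fn z (snd s c) = fst s" if "s \<in> S" "c \<in> fib (fst s)" for s c
    using that by (auto simp: S_def sec_def)
  have "small U (fib b)" for b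
    by (rule small_subset[OF small_pts[OF Y]]) (auto simp: fib_def)
  then have "small U (SIGMA b:pts B. fib b \<rightarrow>\<^sub>E pts Z)"
    by (rule small_Sigma[OF universe small_pts[OF B] small_PiE[OF universe _ small_pts[OF Z]]])
  then have sm: "small U S" by (rule small_subset) (auto simp: S_def)
  \<comment> \<open>Evaluation is tested after every change of domain \<open>g\<close>, not just on
    \<open>A\<close>: a plot of \<open>Y\<close> on \<open>C\<close> need not come from one on
    \<open>A\<close>. The quantifier over \<open>g\<close> also makes the condition stable under
    precomposition.\<close>
  define Q where "Q A \<phi> \<longleftrightarrow> (\<forall>C g \<psi>. g \<in> Hom D C A \<longrightarrow> plot Y C \<psi> \<longrightarrow>
      (\<forall>d\<in>Pt C. fn y (\<psi> d) = fst (\<phi> (g \<cdot> d))) \<longrightarrow> plot Z C (\<lambda>d. snd (\<phi> (g \<cdot> d)) (\<psi> d)))"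
    for A and \<phi> :: "'m \<Rightarrow> 'u \<times> ('u \<Rightarrow> 'u)"
  define P where "P A \<phi> \<longleftrightarrow> \<phi> \<in> Pt A \<rightarrow> S \<and> plot B A (\<lambda>d. fst (\<phi> d)) \<and> Q A \<phi>" for A \<phi>
  have QD: "plot Z C (\<lambda>d. snd (\<phi> (g \<cdot> d)) (\<psi> d))"
    if "Q A \<phi>" "g \<in> Hom D C A" "plot Y C \<psi>" "\<And>d. d \<in> Pt C \<Longrightarrow> fn y (\<psi> d) = fst (\<phi> (g \<cdot> d))"
    for A \<phi> C g \<psi> using that unfolding Q_def by blast
  have QI: "Q A \<phi>"
    if "\<And>C g \<psi>. C \<in> Obj D \<Longrightarrow> g \<in> Hom D C A \<Longrightarrow> plot Y C \<psi> \<Longrightarrow>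
        (\<And>d. d \<in> Pt C \<Longrightarrow> fn y (\<psi> d) = fst (\<phi> (g \<cdot> d))) \<Longrightarrow> plot Z C (\<lambda>d. snd (\<phi> (g \<cdot> d)) (\<psi> d))"
    for A \<phi>
    unfolding Q_def
  proof (intro allI impI)
    fix C g \<psi> assume g: "g \<in> Hom D C A" and \<psi>: "plot Y C \<psi>"
      and eq: "\<forall>d\<in>Pt C. fn y (\<psi> d) = fst (\<phi> (g \<cdot> d))"
    show "plot Z C (\<lambda>d. snd (\<phi> (g \<cdot> d)) (\<psi> d))"
      by (rule that[OF D.Hom_Obj(1)[OF g] g \<psi>]) (use eq in blast)
  qed
  have "plot_structure S P"
  proof (rule plot_structureI)
    fix A \<phi> \<phi>' assume A: "A \<in> Obj D" and P: "P A \<phi>" and eq: "\<And>d. d \<in> Pt A \<Longrightarrow> \<phi> d = \<phi>' d"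
    have "\<phi>' \<in> Pt A \<rightarrow> S" using P by (auto simp: P_def eq[symmetric])
    moreover have "plot B A (\<lambda>d. fst (\<phi>' d))"
      by (rule plot_cong[OF A B, where \<phi> = "\<lambda>d. fst (\<phi> d)"]) (use P eq in \<open>simp_all add: P_def\<close>)
    moreover have "Q A \<phi>'"
    proof (rule QI)
      fix C g \<psi> assume C: "C \<in> Obj D" and g: "g \<in> Hom D C A" and \<psi>: "plot Y C \<psi>"
        and e: "\<And>d. d \<in> Pt C \<Longrightarrow> fn y (\<psi> d) = fst (\<phi>' (g \<cdot> d))"
      have eq': "\<phi> (g \<cdot> d) = \<phi>' (g \<cdot> d)" if "d \<in> Pt C" for d using eq D.comp_closed[OF that g] .
      have "plot Z C (\<lambda>d. snd (\<phi> (g \<cdot> d)) (\<psi> d))"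
        by (rule QD[OF _ g \<psi>]) (use P e eq' in \<open>simp_all add: P_def\<close>)
      then show "plot Z C (\<lambda>d. snd (\<phi>' (g \<cdot> d)) (\<psi> d))"
        by (rule plot_cong[OF C Z]) (simp add: eq')
    qed
    ultimately show "P A \<phi>'" by (simp add: P_def)
  next
    fix A s assume A: "A \<in> Obj D" and s: "s \<in> S"
    have "plot B A (\<lambda>_. fst s)" using s plotD(3)[OF B A] by (auto simp: S_def)
    moreover have "Q A (\<lambda>_. s)" by (rule QI) (use s in \<open>auto simp: S_def sec_def\<close>)
    ultimately show "P A (\<lambda>_. s)" using s by (simp add: P_def)
  next
    fix A A' h \<phi> assume h: "h \<in> Hom D A' A" and P: "P A \<phi>"
    have "(\<lambda>d. \<phi> (h \<cdot> d)) \<in> Pt A' \<rightarrow> S" using P D.comp_closed[OF _ h] by (auto simp: P_def)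
    moreover have "plot B A' (\<lambda>d. fst (\<phi> (h \<cdot> d)))"
      using plotD(4)[OF B h, where \<phi> = "\<lambda>d. fst (\<phi> d)"] P by (simp add: P_def)
    moreover have "Q A' (\<lambda>d. \<phi> (h \<cdot> d))"
    proof (rule QI)
      fix C g \<psi> assume C: "C \<in> Obj D" and g: "g \<in> Hom D C A'" and \<psi>: "plot Y C \<psi>"
        and e: "\<And>d. d \<in> Pt C \<Longrightarrow> fn y (\<psi> d) = fst (\<phi> (h \<cdot> g \<cdot> d))"
      have eq: "(h \<cdot> g) \<cdot> d = h \<cdot> g \<cdot> d" if "d \<in> Pt C" for d using D.comp_assoc[OF that g h] .
      have "plot Z C (\<lambda>d. snd (\<phi> ((h \<cdot> g) \<cdot> d)) (\<psi> d))"
        by (rule QD[OF _ D.comp_closed[OF g h] \<psi>]) (use P e eq in \<open>simp_all add: P_def\<close>)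
      then show "plot Z C (\<lambda>d. snd (\<phi> (h \<cdot> g \<cdot> d)) (\<psi> d))"
        by (rule plot_cong[OF C Z]) (simp add: eq)
    qed
    ultimately show "P A' (\<lambda>d. \<phi> (h \<cdot> d))" by (simp add: P_def)
  next
    fix A I f \<phi> assume A: "A \<in> Obj D" "(I, f) \<in> Cov D A" and \<phi>: "\<phi> \<in> Pt A \<rightarrow> S"
      and P: "\<And>i. i \<in> I \<Longrightarrow> P (Dom D (f i)) (\<lambda>d. \<phi> (f i \<cdot> d))"
    note f = cov_Hom[OF A]
    have "fst s \<in> pts B" if "s \<in> S" for s using that by (auto simp: S_def)
    then have "(\<lambda>d. fst (\<phi> d)) \<in> Pt A \<rightarrow> pts B" using \<phi> by blast
    then have "plot B A (\<lambda>d. fst (\<phi> d))"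
      by (rule plotD(5)[OF B A]) (use P in \<open>simp add: P_def\<close>)
    moreover have "Q A \<phi>"
    proof (rule QI)
      fix C g \<psi> assume C: "C \<in> Obj D" and g: "g \<in> Hom D C A" and \<psi>: "plot Y C \<psi>"
        and e: "\<And>d. d \<in> Pt C \<Longrightarrow> fn y (\<psi> d) = fst (\<phi> (g \<cdot> d))"
      \<comment> \<open>The test takes place on \<open>C\<close>, while the hypothesis is local on
        \<open>A\<close>. Refinement gives a cover of \<open>C\<close> each of whose pieces maps
        into a piece of the cover of \<open>A\<close>; the condition holds there and is glued in
        \<open>Z\<close>.\<close>
      obtain J h where J: "(J, h) \<in> Cov D C"
        and ref: "\<And>j. j \<in> J \<Longrightarrow> \<exists>i\<in>I. \<exists>k\<in>Hom D (Dom D (h j)) (Dom D (f i)). g \<cdot> h j = f i \<cdot> k"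
        by (rule cov_refine[OF A g]) blast
      show "plot Z C (\<lambda>d. snd (\<phi> (g \<cdot> d)) (\<psi> d))"
      proof (rule plotD(5)[OF Z C J])
        show "(\<lambda>d. snd (\<phi> (g \<cdot> d)) (\<psi> d)) \<in> Pt C \<rightarrow> pts Z"
        proof
          fix d assume d: "d \<in> Pt C"
          have "\<psi> d \<in> fib (fst (\<phi> (g \<cdot> d)))"
            using e[OF d] Pi_mem[OF plotD(1)[OF Y C \<psi>] d] by (simp add: fib_def)
          then show "snd (\<phi> (g \<cdot> d)) (\<psi> d) \<in> pts Z"
            using S_Z(1) Pi_mem[OF \<phi> D.comp_closed[OF d g]] by blast
        qed
        fix j assume j: "j \<in> J"
        note h = cov_Hom[OF C J j]
        obtain i k where i: "i \<in> I" and k: "k \<in> Hom D (Dom D (h j)) (Dom D (f i))"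
          and gh: "g \<cdot> h j = f i \<cdot> k" using ref[OF j] by blast
        have eq: "g \<cdot> h j \<cdot> d = f i \<cdot> k \<cdot> d" if "d \<in> Pt (Dom D (h j))" for d
          using D.comp_assoc[OF that h(1) g] D.comp_assoc[OF that k f(1)[OF i]] gh by simp
        have "plot Z (Dom D (h j)) (\<lambda>d. snd (\<phi> (f i \<cdot> k \<cdot> d)) (\<psi> (h j \<cdot> d)))"
        proof (rule QD[of _ "\<lambda>d. \<phi> (f i \<cdot> d)", OF _ k])
          show "Q (Dom D (f i)) (\<lambda>d. \<phi> (f i \<cdot> d))" using P[OF i] by (simp add: P_def)
          show "plot Y (Dom D (h j)) (\<lambda>d. \<psi> (h j \<cdot> d))" by (rule plotD(4)[OF Y h(1) \<psi>])
          show "fn y (\<psi> (h j \<cdot> d)) = fst (\<phi> (f i \<cdot> k \<cdot> d))" if "d \<in> Pt (Dom D (h j))" for d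
            using e[OF D.comp_closed[OF that h(1)]] eq[OF that] by simp
        qed
        then show "plot Z (Dom D (h j)) (\<lambda>d. snd (\<phi> (g \<cdot> h j \<cdot> d)) (\<psi> (h j \<cdot> d)))"
          by (rule plot_cong[OF h(2) Z]) (simp add: eq)
      qed
    qed
    ultimately show "P A \<phi>" using \<phi> by (simp add: P_def)
  qed (simp add: P_def)
  from ex_space[OF sm this] obtain E \<sigma> \<tau> where E: "E \<in> Obj Sp"
    and \<sigma>: "\<And>s. s \<in> S \<Longrightarrow> \<sigma> s \<in> pts E" "\<And>s. s \<in> S \<Longrightarrow> \<tau> (\<sigma> s) = s"
    and \<tau>: "\<And>x. x \<in> pts E \<Longrightarrow> \<tau> x \<in> S" "\<And>x. x \<in> pts E \<Longrightarrow> \<sigma> (\<tau> x) = x"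
    and pl: "\<And>A \<psi>. A \<in> Obj D \<Longrightarrow> plot E A \<psi> \<longleftrightarrow> \<psi> \<in> Pt A \<rightarrow> pts E \<and> P A (\<lambda>d. \<tau> (\<psi> d))"
    by blast
  have "fst s \<in> pts B" if "s \<in> S" for s using that by (auto simp: S_def)
  then have "smooth E B (\<lambda>x. fst (\<tau> x))"
    using \<tau>(1) pl by (simp add: smooth_def P_def)
  then obtain e where e: "e \<in> Hom Sp E B" and fe: "\<And>x. x \<in> pts E \<Longrightarrow> fn e x = fst (\<tau> x)"
    using ex_arr[OF E B] by blast
  define app where "app x c = snd (\<tau> x) c" for x c
  have app1: "app x c \<in> pts Z \<and> fn z (app x c) = fn e x"
    if "x \<in> pts E" "c \<in> pts Y" "fn y c = fn e x" for x c
    using S_Z[OF \<tau>(1)[OF that(1)], of c] that fe by (simp add: fib_def app_def)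
  have app2: "plot Z A (\<lambda>d. app (\<phi> d) (\<psi> d))"
    if A: "A \<in> Obj D" and \<phi>: "plot E A \<phi>" and \<psi>: "plot Y A \<psi>"
      and eq: "\<And>d. d \<in> Pt A \<Longrightarrow> fn y (\<psi> d) = fn e (\<phi> d)" for A \<phi> \<psi>
  proof -
    \<comment> \<open>The condition \<open>Q\<close> is applied to the identity of
      \<open>A\<close>.\<close>
    have "plot Z A (\<lambda>d. snd (\<tau> (\<phi> (Ide D A \<cdot> d))) (\<psi> d))"
    proof (rule QD[of _ "\<lambda>d. \<tau> (\<phi> d)", OF _ D.ide_closed[OF A] \<psi>])
      show "Q A (\<lambda>d. \<tau> (\<phi> d))" using \<phi> pl[OF A] by (simp add: P_def)
      show "fn y (\<psi> d) = fst (\<tau> (\<phi> (Ide D A \<cdot> d)))" if "d \<in> Pt A" for d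
        using eq[OF that] fe Pi_mem[OF plotD(1)[OF E A \<phi>] that] D.comp_ide_left[OF that] by simp
    qed
    then show ?thesis
      by (rule plot_cong[OF A Z]) (simp add: D.comp_ide_left app_def)
  qed
  have pair_eq: "s = s'" if s: "s \<in> S" "s' \<in> S" "fst s = fst s'"
      and eq: "\<And>c. c \<in> fib (fst s) \<Longrightarrow> snd s c = snd s' c" for s s'
  proof (rule prod_eqI[OF s(3)])
    show "snd s = snd s'"
      by (rule PiE_ext[where k = "fib (fst s)" and s = "\<lambda>_. pts Z"])
        (use s eq in \<open>auto simp: S_def\<close>)
  qed
  have app3: "x = x'" if x: "x \<in> pts E" "x' \<in> pts E" "fn e x = fn e x'"
      and eq: "\<And>c. c \<in> pts Y \<Longrightarrow> fn y c = fn e x \<Longrightarrow> app x c = app x' c" for x x'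
  proof -
    have "\<tau> x = \<tau> x'"
      by (rule pair_eq[OF \<tau>(1)[OF x(1)] \<tau>(1)[OF x(2)]])
        (use x(3) fe[OF x(1)] fe[OF x(2)] eq in \<open>simp_all add: app_def fib_def\<close>)
    then show ?thesis using \<tau>(2) x by metis
  qed
  have app4: "\<exists>m. m \<in> Hom Sp X E \<and> e \<cdot>\<^bsub>Sp\<^esub> m = r \<and>
        (\<forall>a\<in>pts X. \<forall>c\<in>pts Y. fn y c = fn r a \<longrightarrow> app (fn m a) c = k a c)"
    if r: "r \<in> Hom Sp X B"
      and so: "smooth_over X r Y y Z z k" for X r k
  proof -
    have X: "X \<in> Obj Sp" using r S.Hom_Obj by blast
    note k = smooth_overD(1)[OF so] and kp = smooth_overD(2)[OF so]
    \<comment> \<open>The transpose of \<open>k\<close>: the point \<open>a\<close> goes to its base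
      point with the partial application of \<open>k\<close>, cut down to the fibre so as to be
      extensional.\<close>
    define n where "n a = (fn r a, \<lambda>c\<in>fib (fn r a). k a c)" for a
    have nS: "n a \<in> S" if a: "a \<in> pts X" for a
    proof -
      have "plot Z A (\<lambda>d. (\<lambda>c\<in>fib (fn r a). k a c) (\<psi> d))"
        if A: "A \<in> Obj D" and \<psi>: "plot Y A \<psi>" and eq: "\<forall>d\<in>Pt A. fn y (\<psi> d) = fn r a" for A \<psi>
      proof (rule plot_cong[OF A Z])
        \<comment> \<open>Smoothness in the second argument alone is joint smoothness with a
          constant plot in the first.\<close>
        show "plot Z A (\<lambda>d. k a (\<psi> d))"
          by (rule kp[OF A plotD(3)[OF X A a] \<psi>]) (use eq in blast)
        show "k a (\<psi> d) = (\<lambda>c\<in>fib (fn r a). k a c) (\<psi> d)" if "d \<in> Pt A" for d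
          using that eq Pi_mem[OF plotD(1)[OF Y A \<psi>] that] by (simp add: fib_def)
      qed
      then show ?thesis using k[OF a] fn_closed[OF r a] by (auto simp: n_def S_def sec_def fib_def)
    qed
    have "smooth X E (\<lambda>a. \<sigma> (n a))"
      unfolding smooth_def
    proof (intro conjI ballI allI impI)
      show "(\<lambda>a. \<sigma> (n a)) \<in> pts X \<rightarrow> pts E" using \<sigma>(1) nS by blast
      fix A \<phi> assume A: "A \<in> Obj D" and \<phi>: "plot X A \<phi>"
      note \<phi>X = Pi_mem[OF plotD(1)[OF X A \<phi>]]
      have \<tau>n: "\<tau> (\<sigma> (n (\<phi> d))) = n (\<phi> d)" if "d \<in> Pt A" for d by (rule \<sigma>(2)[OF nS[OF \<phi>X[OF that]]])
      have "plot B A (\<lambda>d. fst (\<tau> (\<sigma> (n (\<phi> d)))))"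
        by (rule plot_cong[OF A B fn_plot[OF r A \<phi>]]) (simp add: \<tau>n, simp add: n_def)
      moreover have "Q A (\<lambda>d. \<tau> (\<sigma> (n (\<phi> d))))"
      proof (rule QI)
        fix C g \<psi> assume C: "C \<in> Obj D" and g: "g \<in> Hom D C A" and \<psi>: "plot Y C \<psi>"
          and eq: "\<And>d. d \<in> Pt C \<Longrightarrow> fn y (\<psi> d) = fst (\<tau> (\<sigma> (n (\<phi> (g \<cdot> d)))))"
        have \<tau>n': "\<tau> (\<sigma> (n (\<phi> (g \<cdot> d)))) = n (\<phi> (g \<cdot> d))" if "d \<in> Pt C" for d
          by (rule \<tau>n[OF D.comp_closed[OF that g]])
        have eq': "fn y (\<psi> d) = fn r (\<phi> (g \<cdot> d))" if "d \<in> Pt C" for d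
          using eq[OF that] \<tau>n'[OF that] by (simp add: n_def)
        show "plot Z C (\<lambda>d. snd (\<tau> (\<sigma> (n (\<phi> (g \<cdot> d))))) (\<psi> d))"
        proof (rule plot_cong[OF C Z])
          show "plot Z C (\<lambda>d. k (\<phi> (g \<cdot> d)) (\<psi> d))"
            by (rule kp[OF C plotD(4)[OF X g \<phi>] \<psi> eq'])
          show "k (\<phi> (g \<cdot> d)) (\<psi> d) = snd (\<tau> (\<sigma> (n (\<phi> (g \<cdot> d))))) (\<psi> d)" if "d \<in> Pt C" for d
            unfolding \<tau>n'[OF that] using eq'[OF that] Pi_mem[OF plotD(1)[OF Y C \<psi>] that]
            by (simp add: n_def fib_def)
        qed
      qed
      ultimately show "plot E A (\<lambda>d. \<sigma> (n (\<phi> d)))"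
        unfolding pl[OF A] P_def using \<tau>n \<phi>X nS \<sigma>(1) by simp
    qed
    then obtain m where m: "m \<in> Hom Sp X E" and fm: "\<And>a. a \<in> pts X \<Longrightarrow> fn m a = \<sigma> (n a)"
      using ex_arr[OF X E] by blast
    have "e \<cdot>\<^bsub>Sp\<^esub> m = r"
      by (rule Sp_arr_eqI[OF S.comp_closed[OF m e] r])
        (simp add: fn_comp[OF m e] fm fe \<sigma> nS, simp add: n_def)
    moreover have "app (fn m a) c = k a c" if "a \<in> pts X" "c \<in> pts Y" "fn y c = fn r a" for a c
      unfolding app_def fm[OF that(1)] \<sigma>(2)[OF nS[OF that(1)]] using that by (simp add: n_def fib_def)
    ultimately show ?thesis using m by blast
  qed
  have "smooth_over E e Y y Z z app" using app1 app2 by (rule smooth_overI)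
  from that[OF e this app3 app4] show ?thesis .
qed

section \<open>Right adjoints of product functors in slices\<close>

text \<open>The universal arrow from \<open>F\<close> to \<open>z\<close> is evaluation on
  \<open>F e\<close>, the product of the exponential with \<open>y\<close>. The products are those
  chosen by \<open>F\<close>; \<open>binary_product_slice\<close> identifies their points with pairs
  over a common base point, and under this identification the factorisation is currying.\<close>

lemma slice_product_functor_adjoint:
  assumes y: "y \<in> Obj (slice Sp B)" and F: "is_product_functor (slice Sp B) y F"
  shows "has_right_adjoint (slice Sp B) (slice Sp B) F"
proof (rule has_right_adjointI)
  let ?S = "slice Sp B"
  show functorial: "is_functor ?S ?S F" using F by (simp add: is_product_functor_def)
  fix z assume "z \<in> Obj ?S"
  then have z: "z \<in> Hom Sp (Dom Sp z) B" by (simp add: slice_Obj)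
  have y': "y \<in> Hom Sp (Dom Sp y) B" using y by (simp add: slice_Obj)
  let ?Y = "Dom Sp y" and ?Z = "Dom Sp z"
  have Y: "?Y \<in> Obj Sp" and Z: "?Z \<in> Obj Sp" using y' z S.Hom_Obj by blast+
  obtain p0 q0 where pr0: "\<forall>x\<in>Obj ?S. is_binary_product ?S x y (OMap F x) (p0 x) (q0 x)"
    and nat0: "\<forall>x\<in>Obj ?S. \<forall>x'\<in>Obj ?S. \<forall>t\<in>Hom ?S x x'.
       p0 x' \<cdot>\<^bsub>?S\<^esub> AMap F t = t \<cdot>\<^bsub>?S\<^esub> p0 x \<and> q0 x' \<cdot>\<^bsub>?S\<^esub> AMap F t = q0 x"
    using F unfolding is_product_functor_def by blast
  \<comment> \<open>The projections are slice arrows, hence triples; \<open>p\<close> and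
    \<open>q\<close> extract the underlying morphisms.\<close>
  define p where "p x = snd (snd (p0 x))" for x
  define q where "q x = snd (snd (q0 x))" for x
  have p0: "p0 x = (OMap F x, x, p x)" and q0: "q0 x = (OMap F x, y, q x)"
    and Fx: "OMap F x \<in> Hom Sp (Dom Sp (OMap F x)) B"
    and p: "p x \<in> Hom Sp (Dom Sp (OMap F x)) (Dom Sp x)" and xp: "x \<cdot>\<^bsub>Sp\<^esub> p x = OMap F x"
    and q: "q x \<in> Hom Sp (Dom Sp (OMap F x)) ?Y" and yq: "y \<cdot>\<^bsub>Sp\<^esub> q x = OMap F x"
    and x: "x \<in> Hom Sp (Dom Sp x) B"
    if x': "x \<in> Obj ?S" for x
  proof -
    have "p0 x \<in> Hom ?S (OMap F x) x" "q0 x \<in> Hom ?S (OMap F x) y"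
      using pr0 x' by (simp_all add: is_binary_product_def)
    then show "p0 x = (OMap F x, x, p x)" "q0 x = (OMap F x, y, q x)"
      "OMap F x \<in> Hom Sp (Dom Sp (OMap F x)) B"
      "p x \<in> Hom Sp (Dom Sp (OMap F x)) (Dom Sp x)" "x \<cdot>\<^bsub>Sp\<^esub> p x = OMap F x"
      "q x \<in> Hom Sp (Dom Sp (OMap F x)) ?Y" "y \<cdot>\<^bsub>Sp\<^esub> q x = OMap F x" "x \<in> Hom Sp (Dom Sp x) B"
      by (auto simp: slice_Hom p_def q_def)
  qed
  have pt: "fn x (fn (p x) w) = fn (OMap F x) w" "fn y (fn (q x) w) = fn (OMap F x) w"
    if "x \<in> Obj ?S" "w \<in> pts (Dom Sp (OMap F x))" for x w
    using fn_comp[OF p[OF that(1)] x[OF that(1)] that(2)] fn_comp[OF q[OF that(1)] y' that(2)]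
      xp[OF that(1)] yq[OF that(1)] by simp_all
  obtain E e app where e: "e \<in> Hom Sp E B"
    and so: "smooth_over E e ?Y y ?Z z app"
    and app3: "\<And>x x'. x \<in> pts E \<Longrightarrow> x' \<in> pts E \<Longrightarrow> fn e x = fn e x' \<Longrightarrow>
      (\<And>c. c \<in> pts ?Y \<Longrightarrow> fn y c = fn e x \<Longrightarrow> app x c = app x' c) \<Longrightarrow> x = x'"
    and app4: "\<And>X r k. r \<in> Hom Sp X B \<Longrightarrow> smooth_over X r ?Y y ?Z z k \<Longrightarrow>
      \<exists>m. m \<in> Hom Sp X E \<and> e \<cdot>\<^bsub>Sp\<^esub> m = r \<and>
        (\<forall>a\<in>pts X. \<forall>c\<in>pts ?Y. fn y c = fn r a \<longrightarrow> app (fn m a) c = k a c)"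
    by (rule ex_exponential[OF y' z]) blast
  note app1 = smooth_overD(1)[OF so] and app2 = smooth_overD(2)[OF so]
  have De: "Dom Sp e = E" by (rule HomD(2)[OF e])
  have eO: "e \<in> Obj ?S" using e De by (simp add: slice_Obj)
  let ?W = "Dom Sp (OMap F e)"
  note pe = p[OF eO, unfolded De] and qe = q[OF eO]
  have W: "?W \<in> Obj Sp" using pe S.Hom_Obj by blast
  have over: "fn y (fn (q e) w) = fn e (fn (p e) w)" if "w \<in> pts ?W" for w
    using pt[OF eO that] by simp
  \<comment> \<open>A point of the product consists of a point of the exponential and a point of
    \<open>Y\<close> over the same base point; evaluation applies the one to the other.\<close>
  have "smooth ?W ?Z (\<lambda>w. app (fn (p e) w) (fn (q e) w))"
    unfolding smooth_def
  proof (intro conjI ballI allI impI)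
    show "(\<lambda>w. app (fn (p e) w) (fn (q e) w)) \<in> pts ?W \<rightarrow> pts ?Z"
      using app1 fn_closed[OF pe] fn_closed[OF qe] over by blast
    fix A \<phi> assume A: "A \<in> Obj D" and \<phi>: "plot ?W A \<phi>"
    show "plot ?Z A (\<lambda>d. app (fn (p e) (\<phi> d)) (fn (q e) (\<phi> d)))"
      by (rule app2[OF A fn_plot[OF pe A \<phi>] fn_plot[OF qe A \<phi>]])
        (rule over[OF Pi_mem[OF plotD(1)[OF W A \<phi>]]])
  qed
  then obtain ev where ev: "ev \<in> Hom Sp ?W ?Z"
    and fev: "\<And>w. w \<in> pts ?W \<Longrightarrow> fn ev w = app (fn (p e) w) (fn (q e) w)"
    using ex_arr[OF W Z] by blast
  have "z \<cdot>\<^bsub>Sp\<^esub> ev = OMap F e"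
  proof (rule Sp_arr_eqI[OF S.comp_closed[OF ev z] Fx[OF eO]])
    fix w assume w: "w \<in> pts ?W"
    show "fn (z \<cdot>\<^bsub>Sp\<^esub> ev) w = fn (OMap F e) w"
      using fn_comp[OF ev z w] fev[OF w] pt(1)[OF eO w]
        app1[OF fn_closed[OF pe w] fn_closed[OF qe w] over[OF w]] by simp
  qed
  then have \<epsilon>: "(OMap F e, z, ev) \<in> Hom ?S (OMap F e) z"
    using ev z Fx[OF eO] by (simp add: slice_Hom)
  have "\<exists>!t. t \<in> Hom ?S x e \<and> (OMap F e, z, ev) \<cdot>\<^bsub>?S\<^esub> AMap F t = k"
    if xO: "x \<in> Obj ?S" and k: "k \<in> Hom ?S (OMap F x) z" for x k
  proof -
    let ?X = "Dom Sp x" and ?V = "Dom Sp (OMap F x)"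
    note bp = binary_product_slice[OF bspec[OF pr0 xO] p0[OF xO] q0[OF xO]]
    note px = p[OF xO] and qx = q[OF xO] and xH = x[OF xO]
    have V: "?V \<in> Obj Sp" and X: "?X \<in> Obj Sp" using px S.Hom_Obj by blast+
    obtain l where kl: "k = (OMap F x, z, l)" and l: "l \<in> Hom Sp ?V ?Z" and zl: "z \<cdot>\<^bsub>Sp\<^esub> l = OMap F x"
      using k by (auto simp: slice_Hom)
    \<comment> \<open>On points, \<open>F\<close> acts on \<open>m\<close> as the product of
      \<open>m\<close> with the identity of \<open>Y\<close>.\<close>
    have Ft: "\<exists>n. AMap F (x, e, m) = (OMap F x, OMap F e, n) \<and> n \<in> Hom Sp ?V ?W \<and>
        (\<forall>w\<in>pts ?V. fn (p e) (fn n w) = fn m (fn (p x) w) \<and> fn (q e) (fn n w) = fn (q x) w)"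
      if t: "(x, e, m) \<in> Hom ?S x e" for m
    proof -
      have m: "m \<in> Hom Sp ?X E" using t by (simp add: slice_Hom De)
      have "AMap F (x, e, m) \<in> Hom ?S (OMap F x) (OMap F e)"
        using functorial t xO eO unfolding is_functor_def by blast
      then obtain n where n: "AMap F (x, e, m) = (OMap F x, OMap F e, n)" "n \<in> Hom Sp ?V ?W"
        by (auto simp: slice_Hom)
      have "p e \<cdot>\<^bsub>Sp\<^esub> n = m \<cdot>\<^bsub>Sp\<^esub> p x" "q e \<cdot>\<^bsub>Sp\<^esub> n = q x"
        using bspec[OF bspec[OF bspec[OF nat0 xO] eO] t]
        by (simp_all add: p0[OF eO] q0[OF eO] p0[OF xO] q0[OF xO] n slice_Comp)
      then have "fn (p e) (fn n w) = fn m (fn (p x) w) \<and> fn (q e) (fn n w) = fn (q x) w"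
        if "w \<in> pts ?V" for w
        using fn_comp[OF n(2) pe that] fn_comp[OF n(2) qe that] fn_comp[OF px m that] by simp
      then show ?thesis using n by blast
    qed
    have "\<forall>a\<in>pts ?X. \<forall>c\<in>pts ?Y. fn y c = fn x a \<longrightarrow> (\<exists>w\<in>pts ?V. fn (p x) w = a \<and> fn (q x) w = c)"
      using bp(1) by metis
    \<comment> \<open>\<open>w a c\<close> is the point of the chosen product with projections
      \<open>a\<close> and \<open>c\<close>; \<open>w\<close> is the pairing needed to curry
      \<open>l\<close>.\<close>
    then obtain w where w: "\<And>a c. a \<in> pts ?X \<Longrightarrow> c \<in> pts ?Y \<Longrightarrow> fn y c = fn x a \<Longrightarrow>
        w a c \<in> pts ?V \<and> fn (p x) (w a c) = a \<and> fn (q x) (w a c) = c" by metis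
    have fl: "fn z (fn l v) = fn (OMap F x) v" if "v \<in> pts ?V" for v
      using fn_comp[OF l z that] zl by simp
    have "\<exists>m. m \<in> Hom Sp ?X E \<and> e \<cdot>\<^bsub>Sp\<^esub> m = x \<and>
        (\<forall>a\<in>pts ?X. \<forall>c\<in>pts ?Y. fn y c = fn x a \<longrightarrow> app (fn m a) c = fn l (w a c))"
    proof (rule app4[OF xH smooth_overI])
      fix a c assume a: "a \<in> pts ?X" and c: "c \<in> pts ?Y" and ac: "fn y c = fn x a"
      show "fn l (w a c) \<in> pts ?Z \<and> fn z (fn l (w a c)) = fn x a"
        using w[OF a c ac] fn_closed[OF l] fl pt(1)[OF xO] by metis
    next
      fix A \<phi> \<psi> assume A: "A \<in> Obj D" and \<phi>: "plot ?X A \<phi>" and \<psi>: "plot ?Y A \<psi>"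
        and eq: "\<And>d. d \<in> Pt A \<Longrightarrow> fn y (\<psi> d) = fn x (\<phi> d)"
      have wd: "w (\<phi> d) (\<psi> d) \<in> pts ?V \<and> fn (p x) (w (\<phi> d) (\<psi> d)) = \<phi> d \<and>
          fn (q x) (w (\<phi> d) (\<psi> d)) = \<psi> d" if "d \<in> Pt A" for d
        by (rule w[OF Pi_mem[OF plotD(1)[OF X A \<phi>] that] Pi_mem[OF plotD(1)[OF Y A \<psi>] that] eq[OF that]])
      have "plot ?V A (\<lambda>d. w (\<phi> d) (\<psi> d))"
      proof (rule bp(3)[OF A])
        show "(\<lambda>d. w (\<phi> d) (\<psi> d)) \<in> Pt A \<rightarrow> pts ?V" using wd by blast
        show "plot ?X A (\<lambda>d. fn (p x) (w (\<phi> d) (\<psi> d)))"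
          by (rule plot_cong[OF A X \<phi>]) (simp add: wd)
        show "plot ?Y A (\<lambda>d. fn (q x) (w (\<phi> d) (\<psi> d)))"
          by (rule plot_cong[OF A Y \<psi>]) (simp add: wd)
      qed
      then show "plot ?Z A (\<lambda>d. fn l (w (\<phi> d) (\<psi> d)))" by (rule fn_plot[OF l A])
    qed
    then obtain m where m: "m \<in> Hom Sp ?X E" and em: "e \<cdot>\<^bsub>Sp\<^esub> m = x"
      and app_m: "\<And>a c. a \<in> pts ?X \<Longrightarrow> c \<in> pts ?Y \<Longrightarrow> fn y c = fn x a \<Longrightarrow> app (fn m a) c = fn l (w a c)"
      by blast
    have t: "(x, e, m) \<in> Hom ?S x e" using m em xH e by (simp add: slice_Hom De)
    obtain n where n: "AMap F (x, e, m) = (OMap F x, OMap F e, n)" "n \<in> Hom Sp ?V ?W"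
      and pn: "\<And>v. v \<in> pts ?V \<Longrightarrow> fn (p e) (fn n v) = fn m (fn (p x) v)"
        "\<And>v. v \<in> pts ?V \<Longrightarrow> fn (q e) (fn n v) = fn (q x) v"
      using Ft[OF t] by blast
    have "ev \<cdot>\<^bsub>Sp\<^esub> n = l"
    proof (rule Sp_arr_eqI[OF S.comp_closed[OF n(2) ev] l])
      fix v assume v: "v \<in> pts ?V"
      note a = fn_closed[OF px v] and c = fn_closed[OF qx v]
      have ac: "fn y (fn (q x) v) = fn x (fn (p x) v)" using pt[OF xO v] by simp
      have "w (fn (p x) v) (fn (q x) v) = v" using bp(2)[OF _ v] w[OF a c ac] by blast
      then show "fn (ev \<cdot>\<^bsub>Sp\<^esub> n) v = fn l v"
        using fn_comp[OF n(2) ev v] fev[OF fn_closed[OF n(2) v]] pn[OF v] app_m[OF a c ac] by simp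
    qed
    then have "(OMap F e, z, ev) \<cdot>\<^bsub>?S\<^esub> AMap F (x, e, m) = k" by (simp add: n slice_Comp kl)
    moreover have "t' = (x, e, m)"
      if t': "t' \<in> Hom ?S x e" "(OMap F e, z, ev) \<cdot>\<^bsub>?S\<^esub> AMap F t' = k" for t'
    proof -
      obtain m' where m': "t' = (x, e, m')" "m' \<in> Hom Sp ?X E" "e \<cdot>\<^bsub>Sp\<^esub> m' = x"
        using t'(1) by (auto simp: slice_Hom De)
      obtain n' where n': "AMap F t' = (OMap F x, OMap F e, n')" "n' \<in> Hom Sp ?V ?W"
        and pn': "\<And>v. v \<in> pts ?V \<Longrightarrow> fn (p e) (fn n' v) = fn m' (fn (p x) v)"
          "\<And>v. v \<in> pts ?V \<Longrightarrow> fn (q e) (fn n' v) = fn (q x) v"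
        using Ft t'(1) m'(1) by blast
      have evn: "ev \<cdot>\<^bsub>Sp\<^esub> n' = l" using t'(2) by (simp add: n' slice_Comp kl)
      \<comment> \<open>Points of the exponential are compared by their base points and their
        values. The values of \<open>fn m' a\<close> are read off from \<open>evn\<close> at the
        points \<open>w a c\<close>, and these are also the values of \<open>fn m a\<close>.\<close>
      have "m' = m"
      proof (rule Sp_arr_eqI[OF m'(2) m])
        fix a assume a: "a \<in> pts ?X"
        have em_a: "fn e (fn m a) = fn x a" "fn e (fn m' a) = fn x a"
          using fn_comp[OF m e a] em fn_comp[OF m'(2) e a] m'(3) by simp_all
        show "fn m' a = fn m a"
        proof (rule app3[OF fn_closed[OF m'(2) a] fn_closed[OF m a]])
          show "fn e (fn m' a) = fn e (fn m a)" using em_a by simp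
          fix c assume c: "c \<in> pts ?Y" and "fn y c = fn e (fn m' a)"
          then have ac: "fn y c = fn x a" using em_a by simp
          have v: "w a c \<in> pts ?V" and pv: "fn (p x) (w a c) = a" "fn (q x) (w a c) = c"
            using w[OF a c ac] by blast+
          have "fn l (w a c) = app (fn m' a) c"
            using fn_comp[OF n'(2) ev v] fev[OF fn_closed[OF n'(2) v]] pn'[OF v] evn pv by simp
          then show "app (fn m' a) c = app (fn m a) c" using app_m[OF a c ac] by simp
        qed
      qed
      then show ?thesis using m'(1) by simp
    qed
    ultimately show ?thesis using t by blast
  qed
  then show "\<exists>E \<epsilon>. E \<in> Obj ?S \<and> \<epsilon> \<in> Hom ?S (OMap F E) z \<and>
      (\<forall>X\<in>Obj ?S. \<forall>k\<in>Hom ?S (OMap F X) z. \<exists>!m. m \<in> Hom ?S X E \<and> \<epsilon> \<cdot>\<^bsub>?S\<^esub> AMap F m = k)"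
    using eO \<epsilon> by blast
qed

lemma locally_cartesian_closed: "locally_cartesian_closed Sp"
  unfolding locally_cartesian_closed_def cartesian_closed_def
  using category_Sp S.category_slice slice_products slice_product_functor_adjoint by blast

lemma finite_limits: "has_finite_limits Sp"
  unfolding has_finite_limits_def using limits small_finite[OF universe] by blast

lemma finite_colimits: "has_finite_colimits Sp"
  unfolding has_finite_colimits_def using colimits small_finite[OF universe] by blast

end

theorem theorem52:
  fixes D :: "('o, 'm, 'i) concrete_site"
  assumes "universe TYPE('u)"
    and "is_concrete_site D"
    and "locally_small TYPE('u) D"
  shows "quasitopos (DSpace TYPE('u) D) \<and>
         has_small_limits TYPE('u) (DSpace TYPE('u) D) \<and>
         has_small_colimits TYPE('u) (DSpace TYPE('u) D)"
proof -
  interpret d_spaces "TYPE('u)" D using assms by unfold_locales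
  show ?thesis
    unfolding quasitopos_def has_weak_subobject_classifier_def has_small_limits_def has_small_colimits_def
    using locally_cartesian_closed finite_limits finite_colimits weak_subobject_classifier limits colimits
    by blast
qed

end
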